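(* Let $T:J\to J$ be a 3-IET which is the first return map to $J=[0,z)$ of the rotation $R$ by $\alpha$, and let $X\in\mathcal{M}_{1,2}$ be the associated torus with two marked points (see context). For $\tau>0$ let $\nu_\tau$ be the measure on $\mathcal{M}_{1,2}$ given by $$\int f\,d\nu_\tau=\frac1\tau\int_0^\tau f(g_tX)\,dt\qquad\text{for all } f\in C_c(\mathcal{M}_{1,2}).$$ If there exists a weak-* limit of $\nu_\tau$ (along some sequence $\tau\to\infty$) that is not the zero measure, then $T$ satisfies the assumptions (A0)-(A9) listed in the context.
   Context: Spaces: $\mathcal{M}_{1,2}$ is the space of flat tori of area $1$ with two (distinct) marked points. $SL(2,\mathbb{R})$ acts on it: if $Y$ is the torus with fundamental domain the parallelogram with vertices $0,v_1,v_2,v_1+v_2$ and marked points $p_1,p_2$, then $gY$ is the torus with fundamental domain the parallelogram with vertices $0,gv_1,gv_2,g(v_1+v_2)$ and marked points $gp_1,gp_2$. Let $g_t=\begin{pmatrix}e^t&0\\0&e^{-t}\end{pmatrix}$. Setup: $\alpha\in(0,1)$ is irrational, $R:[0,1)\to[0,1)$ is $R(x)=x+\alpha \bmod 1$, $\lambda$ is Lebesgue measure, $d(x,y)=\min\{|x-y|,1-|x-y|\}$, and $\|y\|$ denotes the distance from $y\in\mathbb{R}$ to $\mathbb{Z}$. Let $a_0,a_1,\dots$ be the continued fraction expansion of $\alpha$ and $p_k/q_k$ its convergents, so $q_{k+1}=a_{k+1}q_k+q_{k-1}$. $J=[0,z)\subset[0,1)$ is an interval such that $x\notin J$ implies $Rx\in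 J$, and $T:J\to J$ is the first return (induced) map of $R$ to $J$; it is a 3-interval exchange transformation (3-IET). For $r\in\mathbb{N}$ put $\psi_r(x)=\sum_{j=0}^{r-1}\chi_J(R^jx)$, $x\in[0,1)$. The torus associated to $R$ is $\hat X=\begin{pmatrix}1&-\alpha\\0&1\end{pmatrix}\hat Y$, where $\hat Y=\mathbb{R}^2/\mathbb{Z}^2$; that is, $\hat X=\mathbb{R}^2/\Lambda$ with $\Lambda$ generated by $(1,0)$ and $(-\alpha,1)$. $X\in\mathcal{M}_{1,2}$ is $\hat X$ with marked points at the endpoints $(0,0)$ and $(z,0)$ of the horizontal segment of length $z=|J|$. Assumptions (A0)-(A9): there exist constants $C_1,C_2,C_3,C_4>1$ such that for every $\ell\in\mathbb{N}$ and every sufficiently small $\eta>0$ there exist $\hat c_\eta>0$ (depending on $\eta$) and $c_\ell>0$ (depending on $\ell$) such that for every $0<c<c_\ell$ there exist a constant $k_c\in\mathbb{N}$ and infinite sequences of natural numbers $(L_i)$, $(k_i)$ such that: (A0) $q_{k_i-1}<cL_i<q_{k_i}$. (A1) $a_{k_i}<C_1$. (A2) $a_{k_i+1}<C_2$. (A3) $a_{k_i+2}<C_3$. (A4) The shortest vertical trajectory on the torus from one marked point to a $\|q_{k_i}\alpha\|$-neighborhood of the other has length at least $q_{k_i}/C_4$. (A5) There exists $u_i$ such that either $\lambda(\psi_{L_i}^{-1}(u_i))>\hat c_\eta$ and $\lambda(\psi_{L_i}^{-1}((-\infty,u_i)))<\eta\hat c_\eta$, or $\lambda(\psi_{L_i}^{-1}(u_i))>\hat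 c_\eta$ and $\lambda(\psi_{L_i}^{-1}((u_i,\infty)))<\eta\hat c_\eta$. (A6) $\lim_{i\to\infty}\int_0^1 d(R^{L_i}x,x)\,d\lambda(x)=0$. (A7) $L_i>q_{k_i+\ell}$. (A8) $\max\{j:\psi_{L_i}^{-1}(j)\neq\emptyset\}-\min\{j:\psi_{L_i}^{-1}(j)\ne\emptyset\}<k_c$. (A9) There exists $v_i$ such that $q_{v_i}\le L_i<q_{v_i+1}$ and either $L_i=q_{v_i}$, or $a_{v_i+1}>4$ and $L_i=pq_{v_i}$ for some positive integer $p\le\lfloor a_{v_i+1}/4\rfloor$. *)

theory Defs
  imports "HOL-Analysis.Analysis"
begin

section \<open>The moduli space of unit-area flat tori with two marked points\<close>

text \<open>
  A quadruple \<open>(v1, v2, p1, p2)\<close> presents the torus whose fundamental domain is the parallelogram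
  spanned by \<open>v1\<close> and \<open>v2\<close>, with marked points the classes of \<open>p1\<close> and \<open>p2\<close>. Two quadruples
  present the same point of the moduli space iff some translation of the plane induces an
  isomorphism of the tori taking the first marked point to the first and the second to the second.
\<close>

type_synonym torus_data = "(real^2) \<times> (real^2) \<times> (real^2) \<times> (real^2)"

definition torus_lattice :: "real^2 \<Rightarrow> real^2 \<Rightarrow> (real^2) set" where
  "torus_lattice v1 v2 = {of_int m *\<^sub>R v1 + of_int n *\<^sub>R v2 | m n. True}"

definition torus_data_set :: "torus_data set" where
  "torus_data_set =
     {(v1, v2, p1, p2). \<bar>det (vector [v1, v2] :: real^2^2)\<bar> = 1 \<and> p2 - p1 \<notin> torus_lattice v1 v2}"

definition torus_data_rel :: "torus_data \<Rightarrow> torus_data \<Rightarrow> bool" where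
  "torus_data_rel = (\<lambda>(v1, v2, p1, p2) (v1', v2', p1', p2').
     (v1, v2, p1, p2) \<in> torus_data_set \<and> (v1', v2', p1', p2') \<in> torus_data_set \<and>
     torus_lattice v1 v2 = torus_lattice v1' v2' \<and>
     (\<exists>w. p1 + w - p1' \<in> torus_lattice v1' v2' \<and> p2 + w - p2' \<in> torus_lattice v1' v2'))"

lemma torus_lattice_0: "0 \<in> torus_lattice v1 v2"
proof -
  have "0 = of_int 0 *\<^sub>R v1 + of_int 0 *\<^sub>R v2" by simp
  then show ?thesis unfolding torus_lattice_def by blast
qed

lemma torus_lattice_diff:
  assumes "a \<in> torus_lattice v1 v2" "b \<in> torus_lattice v1 v2"
  shows "a - b \<in> torus_lattice v1 v2"
proof -
  obtain m n m' n' where "a = of_int m *\<^sub>R v1 + of_int n *\<^sub>R v2" "b = of_int m' *\<^sub>R v1 + of_int n' *\<^sub>R v2"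
    using assms unfolding torus_lattice_def by blast
  then have "a - b = of_int (m - m') *\<^sub>R v1 + of_int (n - n') *\<^sub>R v2"
    by (simp add: algebra_simps)
  then show ?thesis unfolding torus_lattice_def by blast
qed

lemma torus_lattice_uminus: "a \<in> torus_lattice v1 v2 \<Longrightarrow> - a \<in> torus_lattice v1 v2"
  using torus_lattice_diff[OF torus_lattice_0, of a] by simp

lemma torus_lattice_add:
  "a \<in> torus_lattice v1 v2 \<Longrightarrow> b \<in> torus_lattice v1 v2 \<Longrightarrow> a + b \<in> torus_lattice v1 v2"
  using torus_lattice_diff[of a v1 v2 "- b"] torus_lattice_uminus by simp

lemma torus_data_rel_iff:
  "torus_data_rel (v1, v2, p1, p2) (v1', v2', p1', p2') \<longleftrightarrow>
     (v1, v2, p1, p2) \<in> torus_data_set \<and> (v1', v2', p1', p2') \<in> torus_data_set \<and>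
     torus_lattice v1 v2 = torus_lattice v1' v2' \<and>
     (p2 - p1) - (p2' - p1') \<in> torus_lattice v1' v2'"
proof -
  have "(\<exists>w. p1 + w - p1' \<in> torus_lattice v1' v2' \<and> p2 + w - p2' \<in> torus_lattice v1' v2')
      \<longleftrightarrow> (p2 - p1) - (p2' - p1') \<in> torus_lattice v1' v2'" (is "?L = ?R")
  proof
    assume ?L
    then obtain w where "p1 + w - p1' \<in> torus_lattice v1' v2'" "p2 + w - p2' \<in> torus_lattice v1' v2'"
      by blast
    from torus_lattice_diff[OF this(2,1)] show ?R by (simp add: algebra_simps)
  next
    assume ?R
    then show ?L
      by (intro exI[of _ "p1' - p1"]) (simp add: torus_lattice_0 algebra_simps)
  qed
  then show ?thesis unfolding torus_data_rel_def by simp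
qed

lemma torus_data_rel_refl: "x \<in> torus_data_set \<Longrightarrow> torus_data_rel x x"
  by (cases x) (simp add: torus_data_rel_iff torus_lattice_0)

lemma part_equivp_torus_data_rel: "part_equivp torus_data_rel"
proof (rule part_equivpI)
  have det: "det (vector [vector [1, 0], vector [0, 1]] :: real^2^2) = 1"
    by (simp add: det_2)
  have "vector [1/2, 0] \<notin> torus_lattice (vector [1, 0]) (vector [0, 1])"
  proof
    assume "vector [1/2, 0] \<in> torus_lattice (vector [1, 0]) (vector [0, 1])"
    then obtain m n :: int where
      "(vector [1/2, 0] :: real^2) = of_int m *\<^sub>R vector [1, 0] + of_int n *\<^sub>R vector [0, 1]"
      unfolding torus_lattice_def by blast
    from arg_cong[OF this, of "\<lambda>v. v $ 1"] have "1 / 2 = real_of_int m"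
      unfolding vector_add_component vector_scaleR_component vector_2 by simp
    then have "2 * m = 1" by linarith
    then show False by presburger
  qed
  then have "(vector [1, 0], vector [0, 1], 0, vector [1/2, 0]) \<in> torus_data_set"
    by (simp add: torus_data_set_def det)
  then show "\<exists>x. torus_data_rel x x" using torus_data_rel_refl by blast
  show "symp torus_data_rel"
  proof (rule sympI)
    fix x y assume xy: "torus_data_rel x y"
    obtain v1 v2 p1 p2 where x: "x = (v1, v2, p1, p2)" by (cases x)
    obtain v1' v2' p1' p2' where y: "y = (v1', v2', p1', p2')" by (cases y)
    have "(p2' - p1') - (p2 - p1) \<in> torus_lattice v1 v2"
      using xy torus_lattice_uminus[of "(p2 - p1) - (p2' - p1')" v1' v2']
      unfolding x y torus_data_rel_iff by simp
    then show "torus_data_rel y x"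
      using xy unfolding x y torus_data_rel_iff by simp
  qed
  show "transp torus_data_rel"
  proof (rule transpI)
    fix x y z assume xy: "torus_data_rel x y" and yz: "torus_data_rel y z"
    obtain v1 v2 p1 p2 where x: "x = (v1, v2, p1, p2)" by (cases x)
    obtain v1' v2' p1' p2' where y: "y = (v1', v2', p1', p2')" by (cases y)
    obtain v1'' v2'' p1'' p2'' where z: "z = (v1'', v2'', p1'', p2'')" by (cases z)
    have "((p2 - p1) - (p2' - p1')) + ((p2' - p1') - (p2'' - p1'')) \<in> torus_lattice v1'' v2''"
      using xy yz unfolding x y z torus_data_rel_iff by (intro torus_lattice_add) simp_all
    then have "(p2 - p1) - (p2'' - p1'') \<in> torus_lattice v1'' v2''"
      by (metis diff_add_cancel add_diff_eq)
    then show "torus_data_rel x z"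
      using xy yz unfolding x y z torus_data_rel_iff by simp
  qed
qed

quotient_type marked_torus = "torus_data" / partial: torus_data_rel
  by (rule part_equivp_torus_data_rel)

instantiation marked_torus :: topological_space
begin

definition open_marked_torus :: "marked_torus set \<Rightarrow> bool" where
  "open_marked_torus U \<longleftrightarrow>
     openin (top_of_set torus_data_set) {x \<in> torus_data_set. abs_marked_torus x \<in> U}"

instance
proof
  show "open (UNIV :: marked_torus set)"
    by (simp add: open_marked_torus_def)
next
  fix S T :: "marked_torus set"
  assume "open S" "open T"
  then have "openin (top_of_set torus_data_set)
      ({x \<in> torus_data_set. abs_marked_torus x \<in> S} \<inter> {x \<in> torus_data_set. abs_marked_torus x \<in> T})"
    unfolding open_marked_torus_def by (rule openin_Int)
  also have "{x \<in> torus_data_set. abs_marked_torus x \<in> S} \<inter> {x \<in> torus_data_set. abs_marked_torus x \<in> T}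
      = {x \<in> torus_data_set. abs_marked_torus x \<in> S \<inter> T}" by blast
  finally show "open (S \<inter> T)" unfolding open_marked_torus_def .
next
  fix K :: "marked_torus set set"
  assume "\<forall>S\<in>K. open S"
  then have "openin (top_of_set torus_data_set) (\<Union>S\<in>K. {x \<in> torus_data_set. abs_marked_torus x \<in> S})"
    unfolding open_marked_torus_def by (intro openin_Union) blast
  also have "(\<Union>S\<in>K. {x \<in> torus_data_set. abs_marked_torus x \<in> S})
      = {x \<in> torus_data_set. abs_marked_torus x \<in> \<Union>K}" by blast
  finally show "open (\<Union>K)" unfolding open_marked_torus_def .
qed

end

section \<open>The action of \<open>SL(2,\<real>)\<close>\<close>

typedef sl2 = "{A :: real^2^2. det A = 1}"
  by (rule exI[of _ "mat 1"]) simp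

setup_lifting type_definition_sl2

lemma torus_lattice_matrix:
  "torus_lattice (A *v v1) (A *v v2) = (\<lambda>x. A *v x) ` torus_lattice v1 v2"
proof -
  have range: "torus_lattice u1 u2 = range (\<lambda>(m, n). of_int m *\<^sub>R u1 + of_int n *\<^sub>R u2)" for u1 u2
    unfolding torus_lattice_def by auto
  show ?thesis unfolding range image_image
    by (simp add: case_prod_beta matrix_vector_right_distrib matrix_vector_mult_scaleR)
qed

lemma det_sl2_rows:
  assumes "det A = 1"
  shows "det (vector [A *v v1, A *v v2] :: real^2^2) = det (vector [v1, v2] :: real^2^2)"
proof -
  have "det (vector [A *v v1, A *v v2] :: real^2^2) = det A * det (vector [v1, v2] :: real^2^2)"
    by (simp add: det_2 matrix_vector_mult_def sum_2 algebra_simps)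
  then show ?thesis using assms by simp
qed

lemma sl2_mem_lattice:
  assumes "det A = (1::real)"
  shows "A *v x \<in> torus_lattice (A *v v1) (A *v v2) \<longleftrightarrow> x \<in> torus_lattice v1 v2"
proof -
  have "invertible A" using assms by (simp add: invertible_det_nz)
  then have "inj (\<lambda>x. A *v x)"
    by (metis inj_matrix_vector_mult)
  then show ?thesis unfolding torus_lattice_matrix by (simp add: inj_image_mem_iff)
qed

lemma sl2_torus_data_set:
  assumes "det A = 1" "(v1, v2, p1, p2) \<in> torus_data_set"
  shows "(A *v v1, A *v v2, A *v p1, A *v p2) \<in> torus_data_set"
proof -
  have "A *v p2 - A *v p1 = A *v (p2 - p1)" by (simp add: matrix_vector_mult_diff_distrib)
  then show ?thesis using assms
    by (simp add: torus_data_set_def det_sl2_rows sl2_mem_lattice)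
qed

lift_definition sl2_act :: "sl2 \<Rightarrow> marked_torus \<Rightarrow> marked_torus" is
  "\<lambda>A (v1, v2, p1, p2). (A *v v1, A *v v2, A *v p1, A *v p2)"
proof -
  fix A x y
  assume A: "det (A :: real^2^2) = 1" and xy: "torus_data_rel x y"
  obtain v1 v2 p1 p2 where x: "x = (v1, v2, p1, p2)" by (cases x)
  obtain v1' v2' p1' p2' where y: "y = (v1', v2', p1', p2')" by (cases y)
  have *: "A *v p2 - A *v p1 - (A *v p2' - A *v p1') = A *v ((p2 - p1) - (p2' - p1'))"
    by (simp add: matrix_vector_mult_diff_distrib)
  show "torus_data_rel (case x of (v1, v2, p1, p2) \<Rightarrow> (A *v v1, A *v v2, A *v p1, A *v p2))
      (case y of (v1, v2, p1, p2) \<Rightarrow> (A *v v1, A *v v2, A *v p1, A *v p2))"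
    using xy A unfolding x y
    by (simp add: torus_data_rel_iff * sl2_mem_lattice sl2_torus_data_set)
       (simp add: torus_lattice_matrix)
qed

lift_definition geod :: "real \<Rightarrow> sl2" is
  "\<lambda>t. vector [vector [exp t, 0], vector [0, exp (- t)]]"
  by (simp add: det_2 flip: exp_add)

section \<open>Averages along the geodesic flow and weak-* limits\<close>

text \<open>The tested class of functions is \<open>C\<^sub>c\<close>; measures are Borel measures finite on compact sets.\<close>

definition compactly_supported_continuous :: "('a::topological_space \<Rightarrow> real) \<Rightarrow> bool" where
  "compactly_supported_continuous f \<longleftrightarrow>
     continuous_on UNIV f \<and> (\<exists>K. compact K \<and> (\<forall>x. x \<notin> K \<longrightarrow> f x = 0))"

definition weak_star_convergent ::
    "(nat \<Rightarrow> 'a::topological_space measure) \<Rightarrow> 'a measure \<Rightarrow> bool" where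
  "weak_star_convergent \<mu> \<nu> \<longleftrightarrow>
     sets \<nu> = sets borel \<and> (\<forall>K \<in> sets borel. compact K \<longrightarrow> emeasure \<nu> K < \<infinity>) \<and>
     (\<forall>f. compactly_supported_continuous f \<longrightarrow>
        (\<lambda>n. integral\<^sup>L (\<mu> n) f) \<longlonglongrightarrow> integral\<^sup>L \<nu> f)"

definition geod_average :: "marked_torus \<Rightarrow> real \<Rightarrow> marked_torus measure" where
  "geod_average X \<tau> = distr (uniform_measure lborel {0..\<tau>}) borel (\<lambda>t. sl2_act (geod t) X)"

lemma continuous_geod_orbit: "continuous_on UNIV (\<lambda>t. sl2_act (geod t) X)"
proof -
  obtain x where x: "torus_data_rel x x" "X = abs_marked_torus x"
    by (metis Quotient3_def Quotient3_marked_torus)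
  obtain v1 v2 p1 p2 where xe: "x = (v1, v2, p1, p2)" by (cases x)
  define M where "M = (\<lambda>t::real. vector [vector [exp t, 0], vector [0, exp (- t)]] :: real^2^2)"
  define F where "F = (\<lambda>t. (M t *v v1, M t *v v2, M t *v p1, M t *v p2))"
  have detM: "det (M t) = 1" for t by (simp add: M_def det_2 flip: exp_add)
  have xs: "(v1, v2, p1, p2) \<in> torus_data_set" using x(1) unfolding xe torus_data_rel_iff by blast
  have eq: "sl2_act (geod t) X = abs_marked_torus (F t)" for t
  proof -
    have "eq_onp (\<lambda>A. det A = 1) (M t) (M t)" by (simp add: eq_onp_same_args detM)
    from sl2_act.abs_eq[OF this x(1)] show ?thesis
      unfolding x(2) xe F_def geod_def M_def by simp
  qed
  have Fs: "F t \<in> torus_data_set" for t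
    unfolding F_def by (rule sl2_torus_data_set[OF detM xs])
  have contv: "continuous_on UNIV (\<lambda>t. M t *v v)" for v
  proof -
    have "(\<lambda>t. M t *v v) = (\<lambda>t. \<chi> i. if i = 1 then exp t * v $ 1 else exp (- t) * v $ 2)"
      by (rule ext) (simp add: vec_eq_iff forall_2 M_def matrix_vector_mult_def sum_2)
    moreover have "continuous_on UNIV (\<lambda>t. \<chi> i::2. if i = 1 then exp t * v $ 1 else exp (- t) * v $ 2)"
    proof (rule continuous_on_vec_lambda)
      show "continuous_on UNIV (\<lambda>t. if i = 1 then exp t * v $ 1 else exp (- t) * v $ 2)" for i :: 2
        by (cases "i = 1") (auto intro!: continuous_intros)
    qed
    ultimately show ?thesis by (simp only:)
  qed
  have contF: "continuous_on UNIV F"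
    unfolding F_def by (intro continuous_on_Pair contv)
  show ?thesis
  proof (rule continuous_on_open_vimage[THEN iffD2, rule_format, OF open_UNIV])
    fix U :: "marked_torus set" assume "open U"
    then obtain W where W: "open W" "{x \<in> torus_data_set. abs_marked_torus x \<in> U} = torus_data_set \<inter> W"
      unfolding open_marked_torus_def openin_open by blast
    have "(\<lambda>t. sl2_act (geod t) X) -` U \<inter> UNIV = F -` W"
      using W(2) Fs unfolding eq by blast
    moreover have "open (F -` W)" using W(1) contF by (simp add: open_vimage)
    ultimately show "open ((\<lambda>t. sl2_act (geod t) X) -` U \<inter> UNIV)" by simp
  qed
qed

lemma integral_geod_average:
  assumes "0 < \<tau>" "compactly_supported_continuous f"
  shows "integral\<^sup>L (geod_average X \<tau>) f = 1 / \<tau> * (LBINT t:{0..\<tau>}. f (sl2_act (geod t) X))"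
proof -
  have f: "f \<in> borel_measurable borel"
    using assms(2) unfolding compactly_supported_continuous_def
    by (auto intro: borel_measurable_continuous_onI)
  have g: "(\<lambda>t. sl2_act (geod t) X) \<in> borel_measurable borel"
    by (rule borel_measurable_continuous_onI[OF continuous_geod_orbit])
  have fg: "(\<lambda>t. f (sl2_act (geod t) X)) \<in> borel_measurable borel"
    using measurable_compose[OF g f] .
  have "integral\<^sup>L (geod_average X \<tau>) f
      = (\<integral>t. f (sl2_act (geod t) X) \<partial>uniform_measure lborel {0..\<tau>})"
    unfolding geod_average_def using f g by (subst integral_distr) auto
  also have "uniform_measure lborel {0..\<tau>} = density lborel (\<lambda>t. ennreal (indicator {0..\<tau>} t / \<tau>))"
    unfolding uniform_measure_def
  proof (rule arg_cong[of _ _ "density lborel"], rule ext)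
    fix t show "indicator {0..\<tau>} t / emeasure lborel {0..\<tau>} = ennreal (indicator {0..\<tau>} t / \<tau>)"
      using assms(1) by (simp add: divide_ennreal flip: ennreal_indicator)
  qed
  also have "(\<integral>t. f (sl2_act (geod t) X) \<partial>density lborel (\<lambda>t. ennreal (indicator {0..\<tau>} t / \<tau>)))
      = (\<integral>t. (indicator {0..\<tau>} t / \<tau>) *\<^sub>R f (sl2_act (geod t) X) \<partial>lborel)"
    using assms(1) fg by (subst integral_density) auto
  also have "\<dots> = 1 / \<tau> * (LBINT t:{0..\<tau>}. f (sl2_act (geod t) X))"
    unfolding set_lebesgue_integral_def
    by (simp add: algebra_simps flip: integral_divide_zero)
  finally show ?thesis .
qed

section \<open>Rotations, induced maps and the associated torus\<close>

definition rot :: "real \<Rightarrow> real \<Rightarrow> real" where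
  "rot \<alpha> x = frac (x + \<alpha>)"

definition first_return_map :: "('a \<Rightarrow> 'a) \<Rightarrow> 'a set \<Rightarrow> 'a \<Rightarrow> 'a" where
  "first_return_map f A x = (f ^^ (LEAST n. 0 < n \<and> (f ^^ n) x \<in> A)) x"

text \<open>A bijection of \<open>[0,z)\<close> that is a translation on each of three consecutive intervals.\<close>

definition three_iet :: "real \<Rightarrow> (real \<Rightarrow> real) \<Rightarrow> bool" where
  "three_iet z T \<longleftrightarrow>
     bij_betw T {0..<z} {0..<z} \<and>
     (\<exists>b1 b2 d1 d2 d3. 0 < b1 \<and> b1 < b2 \<and> b2 < z \<and>
        (\<forall>x\<in>{0..<b1}. T x = x + d1) \<and> (\<forall>x\<in>{b1..<b2}. T x = x + d2) \<and> (\<forall>x\<in>{b2..<z}. T x = x + d3))"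

text \<open>This is the intended torus only if the marked points are distinct, as is the case for \<open>0 < z < 1\<close>.\<close>

definition assoc_torus :: "real \<Rightarrow> real \<Rightarrow> marked_torus" where
  "assoc_torus \<alpha> z = abs_marked_torus (vector [1, 0], vector [- \<alpha>, 1], vector [0, 0], vector [z, 0])"

lemma assoc_torus_data:
  assumes "0 < z" "z < 1"
  shows "(vector [1, 0], vector [- \<alpha>, 1], vector [0, 0], vector [z, 0]) \<in> torus_data_set"
proof -
  have "(vector [z, 0] - vector [0, 0] :: real^2) \<notin> torus_lattice (vector [1, 0]) (vector [- \<alpha>, 1])"
  proof
    assume "(vector [z, 0] - vector [0, 0] :: real^2) \<in> torus_lattice (vector [1, 0]) (vector [- \<alpha>, 1])"
    then obtain m n :: int where *: "(vector [z, 0] - vector [0, 0] :: real^2)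
        = of_int m *\<^sub>R vector [1, 0] + of_int n *\<^sub>R vector [- \<alpha>, 1]"
      unfolding torus_lattice_def by blast
    have "n = 0" using arg_cong[OF *, of "\<lambda>v. v $ 2"] by simp
    then have "z = of_int m" using arg_cong[OF *, of "\<lambda>v. v $ 1"] by simp
    then show False using assms by simp
  qed
  then show ?thesis by (simp add: torus_data_set_def det_2)
qed

text \<open>
  Lengths of vertical trajectories leading from one marked point to the open \<open>r\<close>-neighbourhood
  of the other, the torus carrying the flat metric. As \<open>s\<close> may have either sign, trajectories in
  both vertical directions are included, and so, by symmetry, are those starting at \<open>p2\<close>.
\<close>

lift_definition vertical_lengths :: "marked_torus \<Rightarrow> real \<Rightarrow> real set" is
  "\<lambda>(v1, v2, p1, p2) r.
     {\<bar>s\<bar> | s. \<exists>w \<in> torus_lattice v1 v2. dist (p1 + vector [0, s]) (p2 + w) < r}"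
proof -
  fix x y assume xy: "torus_data_rel x y"
  obtain v1 v2 p1 p2 where x: "x = (v1, v2, p1, p2)" by (cases x)
  obtain v1' v2' p1' p2' where y: "y = (v1', v2', p1', p2')" by (cases y)
  define L where "L = torus_lattice v1' v2'"
  define u where "u = (p2 - p1) - (p2' - p1')"
  have L: "torus_lattice v1 v2 = L" and u: "u \<in> L"
    using xy unfolding x y torus_data_rel_iff L_def u_def by auto
  have "(\<exists>w\<in>L. dist (p1 + vector [0, s]) (p2 + w) < r) \<longleftrightarrow>
        (\<exists>w\<in>L. dist (p1' + vector [0, s]) (p2' + w) < r)" for s r
  proof
    assume "\<exists>w\<in>L. dist (p1 + vector [0, s]) (p2 + w) < r"
    then obtain w where w: "w \<in> L" "dist (p1 + vector [0, s]) (p2 + w) < r" by blast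
    have "dist (p1' + vector [0, s]) (p2' + (u + w)) = dist (p1 + vector [0, s]) (p2 + w)"
      by (simp add: dist_norm u_def algebra_simps)
    then show "\<exists>w\<in>L. dist (p1' + vector [0, s]) (p2' + w) < r"
      using w u torus_lattice_add unfolding L_def by metis
  next
    assume "\<exists>w\<in>L. dist (p1' + vector [0, s]) (p2' + w) < r"
    then obtain w where w: "w \<in> L" "dist (p1' + vector [0, s]) (p2' + w) < r" by blast
    have "dist (p1 + vector [0, s]) (p2 + (w - u)) = dist (p1' + vector [0, s]) (p2' + w)"
      by (simp add: dist_norm u_def algebra_simps)
    then show "\<exists>w\<in>L. dist (p1 + vector [0, s]) (p2 + w) < r"
      using w u torus_lattice_diff unfolding L_def by metis
  qed
  then show "(case x of (v1, v2, p1, p2) \<Rightarrow>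
        \<lambda>r. {\<bar>s\<bar> | s. \<exists>w\<in>torus_lattice v1 v2. dist (p1 + vector [0, s]) (p2 + w) < r}) =
      (case y of (v1, v2, p1, p2) \<Rightarrow>
        \<lambda>r. {\<bar>s\<bar> | s. \<exists>w\<in>torus_lattice v1 v2. dist (p1 + vector [0, s]) (p2 + w) < r})"
    unfolding x y by (simp add: L flip: L_def)
qed

section \<open>Continued fractions\<close>

text \<open>Complete quotients, partial quotients and denominators of convergents, for irrational \<open>\<alpha> > 0\<close>.\<close>

primrec cf_rem :: "real \<Rightarrow> nat \<Rightarrow> real" where
  "cf_rem \<alpha> 0 = \<alpha>"
| "cf_rem \<alpha> (Suc k) = 1 / frac (cf_rem \<alpha> k)"

definition cf_digit :: "real \<Rightarrow> nat \<Rightarrow> nat" where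
  "cf_digit \<alpha> k = nat \<lfloor>cf_rem \<alpha> k\<rfloor>"

fun cf_denom :: "real \<Rightarrow> nat \<Rightarrow> nat" where
  "cf_denom \<alpha> 0 = 1"
| "cf_denom \<alpha> (Suc 0) = cf_digit \<alpha> 1"
| "cf_denom \<alpha> (Suc (Suc k)) = cf_digit \<alpha> (Suc (Suc k)) * cf_denom \<alpha> (Suc k) + cf_denom \<alpha> k"

section \<open>The assumptions (A0)--(A9)\<close>

definition circle_dist :: "real \<Rightarrow> real \<Rightarrow> real" where
  "circle_dist x y = min \<bar>x - y\<bar> (1 - \<bar>x - y\<bar>)"

definition visits :: "real \<Rightarrow> real \<Rightarrow> nat \<Rightarrow> real \<Rightarrow> nat" where
  "visits \<alpha> z r x = (\<Sum>j<r. indicator {0..<z} ((rot \<alpha> ^^ j) x))"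

text \<open>
  \<open>ch\<close> is the value of the constant belonging to \<open>\<eta>\<close>. Since \<open>\<alpha>\<close> is irrational, (A6) and (A9) force
  \<open>L i\<close> to tend to infinity, and then (A0) does the same for \<open>k i\<close>, so no monotonicity of the sequences
  has to be asked for. In (A0) the truncated \<open>k i - 1\<close> is harmless: for \<open>k i = 0\<close> the two inequalities contradict
  each other, so \<open>k i \<ge> 1\<close>.
\<close>

definition A_sequences ::
    "real \<Rightarrow> real \<Rightarrow> real \<Rightarrow> real \<Rightarrow> real \<Rightarrow> real \<Rightarrow> nat \<Rightarrow> real \<Rightarrow> real \<Rightarrow> real \<Rightarrow> nat
      \<Rightarrow> (nat \<Rightarrow> nat) \<Rightarrow> (nat \<Rightarrow> nat) \<Rightarrow> bool" where
  "A_sequences \<alpha> z C1 C2 C3 C4 l \<eta> ch c kc L k \<longleftrightarrow>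
     \<comment> \<open>(A0)\<close>
     (\<forall>i. real (cf_denom \<alpha> (k i - 1)) < c * real (L i) \<and> c * real (L i) < real (cf_denom \<alpha> (k i))) \<and>
     \<comment> \<open>(A1)--(A3)\<close>
     (\<forall>i. real (cf_digit \<alpha> (k i)) < C1) \<and>
     (\<forall>i. real (cf_digit \<alpha> (k i + 1)) < C2) \<and>
     (\<forall>i. real (cf_digit \<alpha> (k i + 2)) < C3) \<and>
     \<comment> \<open>(A4)\<close>
     (\<forall>i. \<forall>h \<in> vertical_lengths (assoc_torus \<alpha> z) (infdist (real (cf_denom \<alpha> (k i)) * \<alpha>) \<int>).
        real (cf_denom \<alpha> (k i)) / C4 \<le> h) \<and>
     \<comment> \<open>(A5)\<close>
     (\<forall>i. \<exists>u. measure lborel {x \<in> {0..<1}. visits \<alpha> z (L i) x = u} > ch \<and>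
        (measure lborel {x \<in> {0..<1}. visits \<alpha> z (L i) x < u} < \<eta> * ch \<or>
         measure lborel {x \<in> {0..<1}. visits \<alpha> z (L i) x > u} < \<eta> * ch)) \<and>
     \<comment> \<open>(A6)\<close>
     (\<lambda>i. LBINT x:{0..<1}. circle_dist ((rot \<alpha> ^^ L i) x) x) \<longlonglongrightarrow> 0 \<and>
     \<comment> \<open>(A7)\<close>
     (\<forall>i. L i > cf_denom \<alpha> (k i + l)) \<and>
     \<comment> \<open>(A8)\<close>
     (\<forall>i. Max (visits \<alpha> z (L i) ` {0..<1}) - Min (visits \<alpha> z (L i) ` {0..<1}) < kc) \<and>
     \<comment> \<open>(A9)\<close>
     (\<forall>i. \<exists>v. cf_denom \<alpha> v \<le> L i \<and> L i < cf_denom \<alpha> (v + 1) \<and>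
        (L i = cf_denom \<alpha> v \<or>
         cf_digit \<alpha> (v + 1) > 4 \<and>
         (\<exists>p. 0 < p \<and> p \<le> cf_digit \<alpha> (v + 1) div 4 \<and> L i = p * cf_denom \<alpha> v)))"

text \<open>
  The constants carry subscripts that record what they depend on: one function \<open>ch\<close> of \<open>\<eta>\<close>, one
  function \<open>cl\<close> of \<open>l\<close> and one function \<open>kc\<close> of \<open>c\<close> serve all values of the other parameters.
\<close>

definition A_assumptions :: "real \<Rightarrow> real \<Rightarrow> bool" where
  "A_assumptions \<alpha> z \<longleftrightarrow>
     (\<exists>C1 C2 C3 C4 \<eta>0. C1 > 1 \<and> C2 > 1 \<and> C3 > 1 \<and> C4 > 1 \<and> \<eta>0 > 0 \<and>
       (\<exists>(ch :: real \<Rightarrow> real) (cl :: nat \<Rightarrow> real) (kc :: real \<Rightarrow> nat).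
          (\<forall>\<eta>. 0 < \<eta> \<and> \<eta> < \<eta>0 \<longrightarrow> ch \<eta> > 0) \<and> (\<forall>l. cl l > 0) \<and>
          (\<forall>l \<eta> c. 0 < \<eta> \<and> \<eta> < \<eta>0 \<and> 0 < c \<and> c < cl l \<longrightarrow>
             (\<exists>L k. A_sequences \<alpha> z C1 C2 C3 C4 l \<eta> (ch \<eta>) c (kc c) L k))))"

end

theory Submission
  imports Defs
begin

text \<open>
  A nonzero weak-* limit means that the orbit \<open>g\<^sub>t X\<close> spends a positive proportion of its time in a compact
  part of the moduli space, where neither the lattice nor the set of vectors joining the marked points
  contains short vectors. Such thick times \<open>n\<close> have positive density with respect to a shift-invariant,
  finitely additive density on \<open>\<nat>\<close>, so any property that fails only on a set of small density may be
  imposed in addition.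

  For a thick \<open>n\<close>, some convergent has a denominator comparable to \<open>e\<^sup>n\<close>; Markov's inequality, applied to
  the increments of the logarithms of the denominators, bounds the next digits. This gives (A0)-(A4) and (A7).
  The number \<open>L\<close>, about \<open>e\<^sup>n / c\<close>, is chosen as a multiple \<open>p q\<^sub>v\<close> admissible for (A9), and (A6) follows.
  The sets of times \<open>s\<close> on which \<open>e\<^sup>s / q\<^sub>v\<close> lies in disjoint windows have total density at most one, so
  this ratio, and with it \<open>p\<close>, is bounded independently of \<open>c\<close> off a set of small density. Then Koksma's argument
  bounds the range of \<open>\<psi>\<^sub>L\<close>, which is (A8). Finally, each of the boundedly many values of \<open>\<psi>\<^sub>L\<close> can
  spoil (A5) for one scale of the constant only, so some scale, independent of \<open>c\<close> and \<open>\<ell>\<close>, works off a set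
  of small density.
\<close>

section \<open>Systole and compactness on the moduli space\<close>

text \<open>The order of the quantifiers shapes the proof. The digit bounds, the constant of (A4)
  and \<open>ch\<close> must be fixed before c and \<ell>, although L is chosen at the time s = n +
  \<sigma>, about ln (1/c) after the thick time n, and nothing is known about thickness at s.
  Conditions at s are therefore imposed through densities: the bad sets of times s are fixed before
  \<sigma>, or their density is bounded uniformly in it, and the density of a translated set is no
  larger, so they cost the same for every c. Only the growth of the denominators up to q_(k+\<ell>)
  depends on \<ell>, and it enters through \<open>cl\<close> alone. The strict inequalities of (A0)
  raise a separate problem, since c L may coincide with a denominator when c is rational. An
  arithmetic argument about the errors q_k \<alpha> - p_k excludes this from some level on, which
  costs only finitely many times.\<close>

definition cross :: "real^2 \<Rightarrow> real^2 \<Rightarrow> real" where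
  "cross a b = a $ 1 * b $ 2 - a $ 2 * b $ 1"

lemma det_rows_eq_cross: "det (vector [a, b] :: real^2^2) = cross a b"
  by (simp add: det_2 cross_def)

lemma norm_power2_2: "norm (a :: real^2) ^ 2 = (a $ 1)\<^sup>2 + (a $ 2)\<^sup>2"
  by (simp add: norm_vec_def L2_set_def sum_2)

lemma lagrange_identity_2: "(cross a b)\<^sup>2 + (a \<bullet> b)\<^sup>2 = (norm a)\<^sup>2 * (norm b)\<^sup>2"
  unfolding norm_power2_2 by (simp add: cross_def inner_vec_def sum_2 power2_eq_square algebra_simps)

lemma abs_cross_le: "\<bar>cross a b\<bar> \<le> norm a * norm b"
proof (rule abs_le_square_iff[THEN iffD2, of "cross a b" "norm a * norm b", unfolded abs_mult abs_norm_cancel])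
  show "(cross a b)\<^sup>2 \<le> (norm a * norm b)\<^sup>2"
    using lagrange_identity_2[of a b] by (simp add: power_mult_distrib) (smt (verit) zero_le_power2)
qed

lemma cross_simps:
  "cross (a + b) c = cross a c + cross b c" "cross c (a + b) = cross c a + cross c b"
  "cross (a - b) c = cross a c - cross b c" "cross c (a - b) = cross c a - cross c b"
  "cross (r *\<^sub>R a) b = r * cross a b" "cross a (r *\<^sub>R b) = r * cross a b"
  "cross a a = 0" 
  by (simp_all add: cross_def algebra_simps)

lemma cross_swap: "cross b a = - cross a b"
  by (simp add: cross_def)

text \<open>Cramer's rule: each coefficient is, up to sign, the \<open>cross\<close> product of the
  vector with the other basis vector. Short lattice vectors therefore have small
  coefficients.\<close>

lemma lattice_coeff_bound:
  assumes "\<bar>cross v1 v2\<bar> = 1"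
  shows "\<bar>m\<bar> + \<bar>n\<bar> \<le> norm (m *\<^sub>R v1 + n *\<^sub>R v2) * (norm v1 + norm v2)"
proof -
  let ?w = "m *\<^sub>R v1 + n *\<^sub>R v2"
  have "\<bar>m\<bar> = \<bar>cross ?w v2\<bar>" "\<bar>n\<bar> = \<bar>cross v1 ?w\<bar>"
    using assms by (simp_all add: cross_simps abs_mult)
  with abs_cross_le[of ?w v2] abs_cross_le[of v1 ?w] show ?thesis
    by (simp add: algebra_simps)
qed

text \<open>Zero is removed from the lattice only: on \<open>torus_data_set\<close> the joining
  vectors never vanish. One orientation suffices, the opposite joining vectors being their
  negatives.\<close>

definition short_vectors :: "torus_data \<Rightarrow> (real^2) set" where
  "short_vectors = (\<lambda>(v1, v2, p1, p2).
     (torus_lattice v1 v2 - {0}) \<union> (\<lambda>w. p2 - p1 + w) ` torus_lattice v1 v2)"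

text \<open>Two degenerations have to be detected, short closed geodesics and colliding marked
  points; only then are the superlevel sets compact.\<close>

lift_definition systole :: "marked_torus \<Rightarrow> real" is "\<lambda>x. Inf (norm ` short_vectors x)"
proof -
  fix x y assume xy: "torus_data_rel x y"
  obtain v1 v2 p1 p2 where x: "x = (v1, v2, p1, p2)" by (cases x)
  obtain v1' v2' p1' p2' where y: "y = (v1', v2', p1', p2')" by (cases y)
  define L u where "L = torus_lattice v1' v2'" and "u = (p2 - p1) - (p2' - p1')"
  have L: "torus_lattice v1 v2 = L" and u: "u \<in> L"
    using xy unfolding x y torus_data_rel_iff L_def u_def by auto
  have "(\<lambda>w. p2 - p1 + w) ` L = (\<lambda>w. p2' - p1' + w) ` L"
  proof (intro equalityI subsetI)
    fix a assume "a \<in> (\<lambda>w. p2 - p1 + w) ` L"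
    then obtain w where w: "w \<in> L" "a = p2 - p1 + w" by blast
    then have "a = p2' - p1' + (u + w)" by (simp add: u_def)
    moreover have "u + w \<in> L" using u w torus_lattice_add unfolding L_def by blast
    ultimately show "a \<in> (\<lambda>w. p2' - p1' + w) ` L" by blast
  next
    fix a assume "a \<in> (\<lambda>w. p2' - p1' + w) ` L"
    then obtain w where w: "w \<in> L" "a = p2' - p1' + w" by blast
    then have "a = p2 - p1 + (w - u)" by (simp add: u_def)
    moreover have "w - u \<in> L" using u w torus_lattice_diff unfolding L_def by blast
    ultimately show "a \<in> (\<lambda>w. p2 - p1 + w) ` L" by blast
  qed
  then have "short_vectors x = short_vectors y"
    unfolding short_vectors_def x y by (simp add: L flip: L_def)
  then show "Inf (norm ` short_vectors x) = Inf (norm ` short_vectors y)" by simp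
qed

lemma marked_torus_cases:
  obtains v1 v2 p1 p2 where "X = abs_marked_torus (v1, v2, p1, p2)" "(v1, v2, p1, p2) \<in> torus_data_set"
proof -
  obtain x where x: "torus_data_rel x x" "X = abs_marked_torus x"
    by (metis Quotient3_def Quotient3_marked_torus)
  obtain v1 v2 p1 p2 where "x = (v1, v2, p1, p2)" by (cases x)
  with x show ?thesis using that[of v1 v2 p1 p2] by (simp add: torus_data_rel_iff)
qed

lemma systole_abs: "x \<in> torus_data_set \<Longrightarrow> systole (abs_marked_torus x) = Inf (norm ` short_vectors x)"
  by (rule systole.abs_eq) (rule torus_data_rel_refl)

lemma torus_data_set_iff:
  "(v1, v2, p1, p2) \<in> torus_data_set \<longleftrightarrow> \<bar>cross v1 v2\<bar> = 1 \<and> p2 - p1 \<notin> torus_lattice v1 v2"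
  by (simp add: torus_data_set_def det_rows_eq_cross)

lemma short_vectors_nonempty: "short_vectors x \<noteq> {}"
  using torus_lattice_0 by (cases x) (auto simp: short_vectors_def)

lemma systole_ge_iff:
  assumes "x \<in> torus_data_set"
  shows "e \<le> systole (abs_marked_torus x) \<longleftrightarrow> (\<forall>w\<in>short_vectors x. e \<le> norm w)"
  unfolding systole_abs[OF assms]
  by (subst le_cInf_iff) (auto simp: short_vectors_nonempty intro: bdd_belowI[of _ 0])

lemma systole_le_norm:
  assumes "x \<in> torus_data_set" "w \<in> short_vectors x"
  shows "systole (abs_marked_torus x) \<le> norm w"
  using systole_ge_iff[OF assms(1)] assms(2) by blast

lemma short_vectors_iff:
  "w \<in> short_vectors (v1, v2, p1, p2) \<longleftrightarrow>
     (\<exists>m n. w = of_int m *\<^sub>R v1 + of_int n *\<^sub>R v2 \<and> w \<noteq> 0) \<or>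
     (\<exists>m n. w = p2 - p1 + (of_int m *\<^sub>R v1 + of_int n *\<^sub>R v2))"
  unfolding short_vectors_def torus_lattice_def by (auto simp: image_iff; blast)

text \<open>Joining vectors of norm at most 1 have bounded coefficients, so finitely many compete,
  and nonzero lattice vectors have norm at least 1 / \<open>\<rho>\<close>. Positivity lets
  countably many superlevel sets exhaust the moduli space.\<close>

lemma systole_pos: "0 < systole X"
proof (cases X rule: marked_torus_cases)
  case (1 v1 v2 p1 p2)
  let ?x = "(v1, v2, p1, p2)"
  define \<rho> where "\<rho> = norm v1 + norm v2"
  have c: "\<bar>cross v1 v2\<bar> = 1" and p: "p2 - p1 \<notin> torus_lattice v1 v2"
    using 1(2) by (auto simp: torus_data_set_iff)
  have \<rho>: "\<rho> > 0" unfolding \<rho>_def using c by (auto simp: cross_def add_pos_nonneg intro!: add_pos_nonneg)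
  define M :: int where "M = \<lceil>(1 + norm (p2 - p1)) * \<rho>\<rceil>"
  define F where "F = (\<lambda>(m, n). norm (p2 - p1 + (of_int m *\<^sub>R v1 + of_int n *\<^sub>R v2))) ` ({-M..M} \<times> {-M..M})"
  have "finite F" unfolding F_def by simp
  have Fpos: "0 < a" if "a \<in> F" for a
  proof -
    from that obtain m n where a: "a = norm (p2 - p1 + (of_int m *\<^sub>R v1 + of_int n *\<^sub>R v2))"
      unfolding F_def by auto
    have "p2 - p1 + (of_int m *\<^sub>R v1 + of_int n *\<^sub>R v2) \<noteq> 0"
    proof
      assume "p2 - p1 + (of_int m *\<^sub>R v1 + of_int n *\<^sub>R v2) = 0"
      then have "p2 - p1 = of_int (-m) *\<^sub>R v1 + of_int (-n) *\<^sub>R v2"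
        by (simp add: algebra_simps eq_neg_iff_add_eq_0)
      then show False using p unfolding torus_lattice_def by blast
    qed
    then show ?thesis unfolding a by simp
  qed
  define e where "e = Min ({1, 1 / \<rho>} \<union> F)"
  have e: "0 < e" unfolding e_def using \<open>finite F\<close> Fpos \<rho> by (subst Min_gr_iff) auto
  have eF: "e \<le> a" if "a \<in> {1, 1 / \<rho>} \<union> F" for a
    unfolding e_def using that \<open>finite F\<close> by (intro Min_le) auto
  have "e \<le> norm w" if "w \<in> short_vectors ?x" for w
    using that unfolding short_vectors_iff
  proof (elim disjE exE conjE)
    fix m n assume w: "w = of_int m *\<^sub>R v1 + of_int n *\<^sub>R v2" "w \<noteq> 0"
    have "m \<noteq> 0 \<or> n \<noteq> 0" using w by auto
    then have "1 \<le> \<bar>real_of_int m\<bar> + \<bar>real_of_int n\<bar>" by linarith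
    also have "\<dots> \<le> norm w * \<rho>" unfolding w(1) \<rho>_def by (rule lattice_coeff_bound[OF c])
    finally have "1 / \<rho> \<le> norm w" using \<rho> by (simp add: field_simps)
    then show ?thesis using eF[of "1 / \<rho>"] by auto
  next
    fix m n assume w: "w = p2 - p1 + (of_int m *\<^sub>R v1 + of_int n *\<^sub>R v2)"
    let ?w = "of_int m *\<^sub>R v1 + of_int n *\<^sub>R v2"
    show ?thesis
    proof (cases "norm w \<le> 1")
      case True
      have "norm ?w \<le> norm w + norm (p2 - p1)" unfolding w
        by (metis add_diff_cancel_left' norm_triangle_ineq4)
      then have "norm ?w * \<rho> \<le> (1 + norm (p2 - p1)) * \<rho>" using True \<rho> by simp
      then have "\<bar>real_of_int m\<bar> + \<bar>real_of_int n\<bar> \<le> (1 + norm (p2 - p1)) * \<rho>"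
        using lattice_coeff_bound[OF c, of "of_int m" "of_int n"] unfolding \<rho>_def by linarith
      then have "\<bar>m\<bar> + \<bar>n\<bar> \<le> M" unfolding M_def by linarith
      then have "m \<in> {-M..M}" "n \<in> {-M..M}" by auto
      then have "norm w \<in> F" unfolding F_def w by force
      then show ?thesis using eF by blast
    next
      case False
      then show ?thesis using eF[of 1] by auto
    qed
  qed
  then have "e \<le> systole X" unfolding 1(1) systole_ge_iff[OF 1(2)] by blast
  with e show ?thesis by simp
qed


text \<open>Moving the basis by r displaces the lattice vector with coefficients m, n by at most r
  (|m| + |n|), hence by at most r \<open>\<rho>\<close> times its own length. Such a relative
  estimate passes to the infimum without a minimiser.\<close>

lemma systole_perturb:
  assumes x: "(v1, v2, p1, p2) \<in> torus_data_set" and x': "(v1', v2', p1', p2') \<in> torus_data_set"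
    and r: "norm (v1' - v1) \<le> r" "norm (v2' - v2) \<le> r" "norm (p1' - p1) \<le> r" "norm (p2' - p2) \<le> r"
  shows "systole (abs_marked_torus (v1', v2', p1', p2')) \<le>
    systole (abs_marked_torus (v1, v2, p1, p2)) * (1 + r * (norm v1 + norm v2))
    + r * (2 + (norm v1 + norm v2) * norm (p2 - p1))" (is "?s' \<le> ?s * ?a + ?b")
proof -
  define \<rho> where "\<rho> = norm v1 + norm v2"
  have c: "\<bar>cross v1 v2\<bar> = 1" using x by (simp add: torus_data_set_iff)
  have r0: "0 \<le> r" using r(1) norm_ge_zero order_trans by blast
  have \<rho>0: "0 \<le> \<rho>" by (simp add: \<rho>_def)
  have a: "0 < ?a" using r0 \<rho>0 unfolding \<rho>_def[symmetric] by (simp add: add_pos_nonneg)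
  have lat: "norm (of_int m *\<^sub>R v1' + of_int n *\<^sub>R v2' - (of_int m *\<^sub>R v1 + of_int n *\<^sub>R v2))
       \<le> r * (norm (of_int m *\<^sub>R v1 + of_int n *\<^sub>R v2) * \<rho>)" for m n :: int
  proof -
    have "of_int m *\<^sub>R v1' + of_int n *\<^sub>R v2' - (of_int m *\<^sub>R v1 + of_int n *\<^sub>R v2)
        = of_int m *\<^sub>R (v1' - v1) + of_int n *\<^sub>R (v2' - v2)" by (simp add: algebra_simps)
    also have "norm \<dots> \<le> \<bar>of_int m\<bar> * norm (v1' - v1) + \<bar>of_int n\<bar> * norm (v2' - v2)"
      by (rule order_trans[OF norm_triangle_ineq]) simp
    also have "\<dots> \<le> \<bar>of_int m\<bar> * r + \<bar>of_int n\<bar> * r"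
      using r by (intro add_mono mult_left_mono) auto
    also have "\<dots> = r * (\<bar>of_int m\<bar> + \<bar>of_int n\<bar>)" by (simp add: algebra_simps)
    also have "\<dots> \<le> r * (norm (of_int m *\<^sub>R v1 + of_int n *\<^sub>R v2) * \<rho>)"
      unfolding \<rho>_def by (intro mult_left_mono lattice_coeff_bound[OF c] r0)
    finally show ?thesis .
  qed
  have tri: "norm (b' - a' + l') \<le> norm (b - a + l) + norm (b' - b) + norm (a' - a) + norm (l' - l)"
    for a b l a' b' l' :: "real^2" by norm
  have tri2: "norm l \<le> norm (d + l) + norm d" for d l :: "real^2" by norm
  have bnd: "(?s' - ?b) / ?a \<le> norm w" if "w \<in> short_vectors (v1, v2, p1, p2)" for w
  proof -
    have "?s' \<le> norm w * ?a + ?b"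
      using that unfolding short_vectors_iff
    proof (elim disjE exE conjE)
      fix m n assume w: "w = of_int m *\<^sub>R v1 + of_int n *\<^sub>R v2" "w \<noteq> 0"
      let ?w' = "of_int m *\<^sub>R v1' + of_int n *\<^sub>R v2'"
      have "m \<noteq> 0 \<or> n \<noteq> 0" using w by auto
      moreover have "\<bar>cross v1' v2'\<bar> = 1" using x' by (simp add: torus_data_set_iff)
      ultimately have "?w' \<noteq> 0" using lattice_coeff_bound[of v1' v2' "of_int m" "of_int n"] by auto
      then have "?s' \<le> norm ?w'" by (intro systole_le_norm[OF x']) (auto simp: short_vectors_iff)
      also have "\<dots> \<le> norm w + norm (?w' - w)" by (rule norm_triangle_sub)
      also have "\<dots> \<le> norm w + r * (norm w * \<rho>)" using lat[of m n] unfolding w(1) by simp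
      also have "\<dots> \<le> norm w * ?a + ?b" using r0 \<rho>0 unfolding \<rho>_def[symmetric] by (simp add: algebra_simps)
      finally show ?thesis .
    next
      fix m n assume w: "w = p2 - p1 + (of_int m *\<^sub>R v1 + of_int n *\<^sub>R v2)"
      let ?l' = "of_int m *\<^sub>R v1' + of_int n *\<^sub>R v2'" and ?l = "of_int m *\<^sub>R v1 + of_int n *\<^sub>R v2"
      let ?w' = "p2' - p1' + ?l'"
      have "?s' \<le> norm ?w'" by (intro systole_le_norm[OF x']) (auto simp: short_vectors_iff)
      also have "\<dots> \<le> norm w + norm (p2' - p2) + norm (p1' - p1) + norm (?l' - ?l)" unfolding w by (rule tri)
      also have "\<dots> \<le> norm w + r + r + r * (norm ?l * \<rho>)"
        using lat[of m n] r by linarith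
      also have "\<dots> \<le> norm w + r + r + r * ((norm w + norm (p2 - p1)) * \<rho>)"
      proof -
        have "norm ?l \<le> norm w + norm (p2 - p1)" unfolding w by (rule tri2)
        then show ?thesis using r0 \<rho>0 by (intro add_left_mono mult_left_mono mult_right_mono)
      qed
      also have "\<dots> = norm w * ?a + ?b" unfolding \<rho>_def[symmetric] by (simp add: algebra_simps)
      finally show ?thesis .
    qed
    then show ?thesis using a by (simp add: field_simps)
  qed
  then have "(?s' - ?b) / ?a \<le> ?s" unfolding systole_ge_iff[OF x] by blast
  then show ?thesis using a by (simp add: field_simps)
qed

lemma continuous_on_systole: "continuous_on UNIV systole"
proof -
  have cont: "continuous_on torus_data_set (\<lambda>x. systole (abs_marked_torus x))"
    unfolding continuous_on_def
  proof
    fix x assume xs: "x \<in> torus_data_set"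
    define \<rho> where "\<rho> = (\<lambda>(v1 :: real^2, v2 :: real^2, p1 :: real^2, p2 :: real^2). norm v1 + norm v2)"
    define \<pi> where "\<pi> = (\<lambda>(v1 :: real^2, v2 :: real^2, p1 :: real^2, p2 :: real^2). norm (p2 - p1))"
    define s where "s = (\<lambda>x. systole (abs_marked_torus x))"
    have pert: "s y' \<le> s y * (1 + dist y' y * \<rho> y) + dist y' y * (2 + \<rho> y * \<pi> y)"
      if y: "y \<in> torus_data_set" "y' \<in> torus_data_set" for y y'
    proof -
      obtain v1 v2 p1 p2 where e: "y = (v1, v2, p1, p2)" by (cases y)
      obtain v1' v2' p1' p2' where e': "y' = (v1', v2', p1', p2')" by (cases y')
      have d: "dist v1' v1 \<le> dist y' y" "dist v2' v2 \<le> dist y' y" "dist p1' p1 \<le> dist y' y" "dist p2' p2 \<le> dist y' y"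
        unfolding e e' using dist_fst_le[of y' y] dist_snd_le[of y' y]
          dist_fst_le[of "snd y'" "snd y"] dist_snd_le[of "snd y'" "snd y"]
          dist_fst_le[of "snd (snd y')" "snd (snd y)"] dist_snd_le[of "snd (snd y')" "snd (snd y)"]
        by (auto simp: e e')
      show ?thesis using systole_perturb[of v1 v2 p1 p2 v1' v2' p1' p2' "dist y' y"] y d
        unfolding s_def \<rho>_def \<pi>_def e e' by (simp add: dist_norm)
    qed
    let ?F = "at x within torus_data_set"
    have lim: "((\<lambda>y. y) \<longlongrightarrow> x) ?F" by (rule tendsto_ident_at)
    have dl: "((\<lambda>y. dist y x) \<longlongrightarrow> 0) ?F" using tendsto_dist[OF lim tendsto_const[of x]] by simp
    have comp: "((\<lambda>y. \<rho> y) \<longlongrightarrow> \<rho> x) ?F" "((\<lambda>y. \<pi> y) \<longlongrightarrow> \<pi> x) ?F"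
      unfolding \<rho>_def \<pi>_def case_prod_beta by (intro tendsto_intros lim)+
    have up: "((\<lambda>y. s x * (1 + dist y x * \<rho> x) + dist y x * (2 + \<rho> x * \<pi> x)) \<longlongrightarrow> s x * (1 + 0 * \<rho> x) + 0 * (2 + \<rho> x * \<pi> x)) ?F"
      by (intro tendsto_intros dl)
    \<comment> \<open>The perturbation estimate based at y instead of x, solved for s y; its
      coefficients vary with y but converge.\<close>
    have lo: "((\<lambda>y. (s x - dist y x * (2 + \<rho> y * \<pi> y)) / (1 + dist y x * \<rho> y)) \<longlongrightarrow> (s x - 0 * (2 + \<rho> x * \<pi> x)) / (1 + 0 * \<rho> x)) ?F"
      by (intro tendsto_intros dl comp) simp
    have ev: "eventually (\<lambda>y. y \<in> torus_data_set) ?F" by (simp add: eventually_at_filter)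
    have \<rho>0: "0 \<le> \<rho> y" for y by (auto simp: \<rho>_def split: prod.splits)
    have "(s \<longlongrightarrow> s x) ?F"
    proof (rule tendsto_sandwich[OF _ _ _ up[simplified]])
      show "\<forall>\<^sub>F y in ?F. s y \<le> s x * (1 + dist y x * \<rho> x) + dist y x * (2 + \<rho> x * \<pi> x)"
        using ev by eventually_elim (use pert[OF xs] in auto)
      show "((\<lambda>y. (s x - dist y x * (2 + \<rho> y * \<pi> y)) / (1 + dist y x * \<rho> y)) \<longlongrightarrow> s x) ?F"
        using lo by simp
      show "\<forall>\<^sub>F y in ?F. (s x - dist y x * (2 + \<rho> y * \<pi> y)) / (1 + dist y x * \<rho> y) \<le> s y"
        using ev
      proof eventually_elim
        case (elim y)
        have pos: "0 < 1 + dist y x * \<rho> y" using \<rho>0[of y] by (simp add: add_pos_nonneg)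
        have "s x \<le> s y * (1 + dist y x * \<rho> y) + dist y x * (2 + \<rho> y * \<pi> y)"
          using pert[OF elim xs] by (simp add: dist_commute)
        then show ?case using pos by (simp add: field_simps)
      qed
    qed
    then show "((\<lambda>x. systole (abs_marked_torus x)) \<longlongrightarrow> systole (abs_marked_torus x)) ?F"
      unfolding s_def .
  qed
  show ?thesis unfolding continuous_on_open_vimage[OF open_UNIV]
  proof (intro allI impI)
    fix B :: "real set" assume B: "open B"
    have "{x \<in> torus_data_set. abs_marked_torus x \<in> systole -` B \<inter> UNIV}
        = torus_data_set \<inter> (\<lambda>x. systole (abs_marked_torus x)) -` B" by auto
    moreover have "openin (top_of_set torus_data_set) \<dots>"
      using cont B by (simp add: continuous_openin_preimage_gen)
    ultimately show "open (systole -` B \<inter> UNIV)" unfolding open_marked_torus_def by simp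
  qed
qed

section \<open>Lattice reduction and compactness of the thick part\<close>

lemma torus_lattice_swap: "torus_lattice b a = torus_lattice a b"
  unfolding torus_lattice_def by (metis (lifting) add.commute)

lemma torus_lattice_shear: "torus_lattice a (b + of_int k *\<^sub>R a) = torus_lattice a b"
proof -
  have *: "torus_lattice a (b + of_int k *\<^sub>R a) \<subseteq> torus_lattice a b" for k and b :: "real^2"
  proof
    fix w assume "w \<in> torus_lattice a (b + of_int k *\<^sub>R a)"
    then obtain m n where "w = of_int m *\<^sub>R a + of_int n *\<^sub>R (b + of_int k *\<^sub>R a)"
      unfolding torus_lattice_def by blast
    then have "w = of_int (m + n * k) *\<^sub>R a + of_int n *\<^sub>R b" by (simp add: algebra_simps)
    then show "w \<in> torus_lattice a b" unfolding torus_lattice_def by blast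
  qed
  from *[of b k] *[of "b + of_int k *\<^sub>R a" "-k"] show ?thesis by auto
qed

text \<open>Lagrange-Gauss reduction with a near-minimiser of the sum of squared norms, which spares
  a proof that the minimum is attained. Comparison with the shears u2 + u1 and u2 - u1 bounds the
  inner product; Lagrange's identity with covolume 1 then bounds both norms.\<close>

lemma reduced_basis:
  assumes c: "\<bar>cross v1 v2\<bar> = 1" and e: "0 < e" "\<forall>w\<in>torus_lattice v1 v2 - {0}. e \<le> norm w"
  obtains u1 u2 where "torus_lattice u1 u2 = torus_lattice v1 v2" "\<bar>cross u1 u2\<bar> = 1"
    "norm u1 \<le> 1 / e + 2" "norm u2 \<le> 1 / e + 2"
proof -
  define L where "L = torus_lattice v1 v2"
  define B where "B = {(u1, u2). torus_lattice u1 u2 = L \<and> \<bar>cross u1 u2\<bar> = 1}"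
  define f :: "(real^2) \<times> (real^2) \<Rightarrow> real" where "f = (\<lambda>(u1, u2). (norm u1)\<^sup>2 + (norm u2)\<^sup>2)"
  \<comment> \<open>At most half of |u1|^2, so that the comparison with the shears gives an inner
    product of at most 3/4 |u1|^2; a factor below 1 is what closes the estimate.\<close>
  define \<kappa> where "\<kappa> = e\<^sup>2 / 2"
  have \<kappa>: "\<kappa> > 0" using e by (simp add: \<kappa>_def)
  have B0: "f ` B \<noteq> {}" using c by (auto simp: B_def L_def)
  have bdd: "bdd_below (f ` B)" by (rule bdd_belowI[of _ 0]) (auto simp: f_def)
  obtain u where u: "u \<in> B" "f u < Inf (f ` B) + \<kappa>"
    using cInf_lessD[OF B0, of "Inf (f ` B) + \<kappa>"] \<kappa> by auto
  have min: "f u \<le> f u' + \<kappa>" if "u' \<in> B" for u'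
    using cInf_lower[OF imageI[OF that, of f] bdd] u(2) by linarith
  have swap: "(b, a) \<in> B" if "(a, b) \<in> B" for a b
    using that by (simp add: B_def torus_lattice_swap[of b a] cross_swap[of b a])
  have "\<exists>u1 u2. (u1, u2) \<in> B \<and> norm u1 \<le> norm u2 \<and> f (u1, u2) = f u"
  proof (cases u)
    case (Pair a b)
    show ?thesis
    proof (cases "norm a \<le> norm b")
      case True
      then show ?thesis using u(1) Pair by blast
    next
      case False
      then show ?thesis using u(1) Pair swap[of a b]
        by (intro exI[of _ b] exI[of _ a]) (auto simp: f_def)
    qed
  qed
  then obtain u1 u2 where U: "(u1, u2) \<in> B" "norm u1 \<le> norm u2" "f (u1, u2) = f u" by blast
  have L12: "torus_lattice u1 u2 = L" and c12: "\<bar>cross u1 u2\<bar> = 1" using U(1) by (auto simp: B_def)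
  have sh: "(norm u2)\<^sup>2 \<le> (norm (u2 + of_int k *\<^sub>R u1))\<^sup>2 + \<kappa>" for k
  proof -
    have "(u1, u2 + of_int k *\<^sub>R u1) \<in> B"
      using U(1) by (simp add: B_def torus_lattice_shear cross_simps)
    from min[OF this] show ?thesis unfolding U(3)[symmetric] by (simp add: f_def)
  qed
  have exp: "(norm (u2 + t *\<^sub>R u1))\<^sup>2 = (norm u2)\<^sup>2 + 2 * t * (u1 \<bullet> u2) + t\<^sup>2 * (norm u1)\<^sup>2" for t
    unfolding power2_norm_eq_inner by (simp add: inner_simps inner_commute power2_eq_square algebra_simps)
  have "u1 = of_int 1 *\<^sub>R u1 + of_int 0 *\<^sub>R u2" by simp
  then have "u1 \<in> torus_lattice u1 u2" unfolding torus_lattice_def by blast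
  moreover have "u1 \<noteq> 0" using c12 by (auto simp: cross_def)
  ultimately have n1: "e \<le> norm u1" using e(2) L12 by (simp add: L_def)
  then have n1s: "e\<^sup>2 \<le> (norm u1)\<^sup>2" using e(1) by (intro power_mono) auto
  have "2 * \<bar>u1 \<bullet> u2\<bar> \<le> (norm u1)\<^sup>2 + \<kappa>"
    using sh[of 1] sh[of "-1"] exp[of 1] exp[of "-1"] by (simp add: abs_le_iff)
  then have dot: "\<bar>u1 \<bullet> u2\<bar> \<le> 3/4 * (norm u1)\<^sup>2" using n1s unfolding \<kappa>_def by simp
  define a b where "a = (norm u1)\<^sup>2" and "b = (norm u2)\<^sup>2"
  have ab: "a \<le> b" "0 < a" using U(2) n1 e(1) unfolding a_def b_def by (auto intro!: power_mono)
  have "(u1 \<bullet> u2)\<^sup>2 \<le> (3/4 * a)\<^sup>2"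
    using dot ab(2) by (intro abs_le_square_iff[THEN iffD1]) (simp add: a_def)
  moreover have "(cross u1 u2)\<^sup>2 = 1" using c12 by (metis power2_abs power_one)
  ultimately have key: "a * b \<le> 1 + 9/16 * a\<^sup>2"
    using lagrange_identity_2[of u1 u2] unfolding a_def b_def by (simp add: power_mult_distrib power2_eq_square)
  have "a * a \<le> a * b" using ab by simp
  with key have "7/16 * a\<^sup>2 \<le> 1" by (simp add: power2_eq_square)
  have a2: "a \<le> 2"
  proof (rule ccontr)
    assume "\<not> a \<le> 2"
    then have "2\<^sup>2 < a\<^sup>2" by (intro power_strict_mono) auto
    then show False using \<open>7/16 * a\<^sup>2 \<le> 1\<close> by simp
  qed
  have "b \<le> 1 / a + 9/16 * a" using key ab(2) by (simp add: field_simps power2_eq_square)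
  moreover have "1 / a \<le> 1 / e\<^sup>2" using n1s e(1) unfolding a_def by (intro divide_left_mono) (auto intro!: mult_pos_pos)
  ultimately have b: "b \<le> (1 / e)\<^sup>2 + 2" using a2 by (simp add: power_divide)
  have R: "(1 / e)\<^sup>2 + 2 \<le> (1 / e + 2)\<^sup>2" using e(1) by (simp add: power2_sum)
  have "norm u2 \<le> 1 / e + 2"
  proof (rule power2_le_imp_le)
    show "(norm u2)\<^sup>2 \<le> (1 / e + 2)\<^sup>2" using order_trans[OF b R] unfolding b_def .
  qed (use e(1) in simp)
  then show ?thesis using that[of u1 u2] L12 c12 U(2) unfolding L_def by auto
qed

text \<open>Mahler's criterion, for tori with two marked points.\<close>

lemma compact_systole_ge:
  assumes e: "0 < e"
  shows "compact {X. e \<le> systole X}"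
proof -
  define R where "R = 1 / e + 2"
  \<comment> \<open>Indexed by coefficients instead of vectors, these are closed conditions;
    \<open>mem\<close> translates them back.\<close>
  define P where "P = (\<lambda>x :: torus_data. \<bar>cross (fst x) (fst (snd x))\<bar> = 1 \<and>
     (\<forall>m n :: int. m \<noteq> 0 \<or> n \<noteq> 0 \<longrightarrow> e \<le> norm (of_int m *\<^sub>R fst x + of_int n *\<^sub>R fst (snd x))) \<and>
     (\<forall>m n :: int. e \<le> norm (snd (snd (snd x)) - fst (snd (snd x)) +
       (of_int m *\<^sub>R fst x + of_int n *\<^sub>R fst (snd x)))))"
  define C where "C = (cball 0 R \<times> cball 0 R \<times> {0} \<times> cball 0 (2 * R)) \<inter> {x. P x}"
  have "compact C" unfolding C_def
  proof (rule compact_Int_closed)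
    show "compact (cball (0::real^2) R \<times> cball (0::real^2) R \<times> {0::real^2} \<times> cball (0::real^2) (2 * R))"
      by (intro compact_Times compact_cball) auto
    show "closed {x. P x}"
      unfolding P_def cross_def
      by (intro closed_Collect_conj closed_Collect_all closed_Collect_imp closed_Collect_eq closed_Collect_le
          open_Collect_const continuous_intros)
  qed
  have mem: "(v1, v2, p1, p2) \<in> C \<longleftrightarrow> norm v1 \<le> R \<and> norm v2 \<le> R \<and> p1 = 0 \<and> norm p2 \<le> 2 * R \<and>
      \<bar>cross v1 v2\<bar> = 1 \<and> (\<forall>w\<in>short_vectors (v1, v2, p1, p2). e \<le> norm w)" for v1 v2 p1 p2
  proof (cases "\<bar>cross v1 v2\<bar> = 1")
    case True
    have nz: "of_int m *\<^sub>R v1 + of_int n *\<^sub>R v2 = 0 \<longleftrightarrow> m = 0 \<and> n = 0" for m n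
      using lattice_coeff_bound[OF True, of "of_int m" "of_int n"] by auto
    have "P (v1, v2, p1, p2) \<longleftrightarrow> (\<forall>w\<in>short_vectors (v1, v2, p1, p2). e \<le> norm w)"
      using True unfolding P_def Ball_def short_vectors_iff fst_conv snd_conv by (metis nz)
    then show ?thesis using True unfolding C_def by auto
  qed (simp add: C_def P_def)
  have CT: "C \<subseteq> torus_data_set"
  proof
    fix x assume x: "x \<in> C"
    obtain v1 v2 p1 p2 where xe: "x = (v1, v2, p1, p2)" by (cases x)
    have "p2 - p1 \<notin> torus_lattice v1 v2"
    proof
      assume "p2 - p1 \<in> torus_lattice v1 v2"
      then have "- (p2 - p1) \<in> torus_lattice v1 v2" by (rule torus_lattice_uminus)
      then have "p2 - p1 + - (p2 - p1) \<in> short_vectors x" unfolding xe short_vectors_def by blast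
      then show False using x e unfolding xe mem by fastforce
    qed
    then show "x \<in> torus_data_set" using x unfolding xe torus_data_set_iff mem by blast
  qed
  have cont: "continuous_on torus_data_set abs_marked_torus"
    unfolding continuous_on_open_invariant
  proof (intro allI impI)
    fix B :: "marked_torus set" assume "open B"
    then obtain A where "open A" "{x \<in> torus_data_set. abs_marked_torus x \<in> B} = torus_data_set \<inter> A"
      unfolding open_marked_torus_def openin_open by blast
    then show "\<exists>A. open A \<and> A \<inter> torus_data_set = abs_marked_torus -` B \<inter> torus_data_set"
      by (intro exI[of _ A]) auto
  qed
  have "{X. e \<le> systole X} = abs_marked_torus ` C"
  proof (intro equalityI subsetI)
    fix X assume "X \<in> abs_marked_torus ` C"
    then obtain x where x: "x \<in> C" "X = abs_marked_torus x" by blast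
    obtain v1 v2 p1 p2 where xe: "x = (v1, v2, p1, p2)" by (cases x)
    show "X \<in> {X. e \<le> systole X}" using x CT mem systole_ge_iff[of x e] unfolding xe by blast
  next
    fix X assume "X \<in> {X. e \<le> systole X}"
    then have Xe: "e \<le> systole X" by simp
    obtain v1 v2 p1 p2 where X: "X = abs_marked_torus (v1, v2, p1, p2)" "(v1, v2, p1, p2) \<in> torus_data_set"
      by (rule marked_torus_cases)
    have sv: "\<forall>w\<in>short_vectors (v1, v2, p1, p2). e \<le> norm w"
      using Xe unfolding X(1) systole_ge_iff[OF X(2)] .
    then have "\<forall>w\<in>torus_lattice v1 v2 - {0}. e \<le> norm w" unfolding short_vectors_def by blast
    then obtain u1 u2 where u: "torus_lattice u1 u2 = torus_lattice v1 v2" "\<bar>cross u1 u2\<bar> = 1"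
        "norm u1 \<le> R" "norm u2 \<le> R"
      using reduced_basis[of v1 v2 e] X(2) e unfolding R_def torus_data_set_iff by metis
    define p where "p = p2 - p1"
    \<comment> \<open>Coordinates of p by Cramer's rule; their fractional parts move the second
      marked point into the fundamental parallelogram, hence to norm at most 2
      \<open>R\<close>.\<close>
    define x y where "x = cross p u2 / cross u1 u2" and "y = cross u1 p / cross u1 u2"
    have "cross u1 u2 *\<^sub>R p = cross p u2 *\<^sub>R u1 + cross u1 p *\<^sub>R u2"
      by (simp add: vec_eq_iff forall_2 cross_def algebra_simps)
    then have "(1 / cross u1 u2) *\<^sub>R (cross u1 u2 *\<^sub>R p) = x *\<^sub>R u1 + y *\<^sub>R u2"
      unfolding x_def y_def by (simp add: scaleR_add_right)
    moreover have "cross u1 u2 \<noteq> 0" using u(2) by auto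
    ultimately have p: "p = x *\<^sub>R u1 + y *\<^sub>R u2" by simp
    define q where "q = frac x *\<^sub>R u1 + frac y *\<^sub>R u2"
    have "p - q = of_int \<lfloor>x\<rfloor> *\<^sub>R u1 + of_int \<lfloor>y\<rfloor> *\<^sub>R u2"
      unfolding p q_def frac_def by (simp add: algebra_simps)
    then have pq: "p - q \<in> torus_lattice u1 u2" unfolding torus_lattice_def by blast
    have "norm q \<le> frac x * norm u1 + frac y * norm u2"
      unfolding q_def by (rule order_trans[OF norm_triangle_ineq]) simp
    also have "\<dots> \<le> 1 * R + 1 * R"
      using u(3,4) by (intro add_mono mult_mono) (auto simp: less_imp_le[OF frac_lt_1])
    finally have q: "norm q \<le> 2 * R" by simp
    have qL: "q \<notin> torus_lattice u1 u2"
    proof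
      assume "q \<in> torus_lattice u1 u2"
      from torus_lattice_add[OF pq this] show False
        using X(2) u(1) by (simp add: torus_data_set_iff p_def)
    qed
    then have T: "(u1, u2, 0, q) \<in> torus_data_set" using u(2) by (simp add: torus_data_set_iff)
    have rel: "torus_data_rel (v1, v2, p1, p2) (u1, u2, 0, q)"
      using X(2) T u(1) pq by (simp add: torus_data_rel_iff p_def)
    then have eq: "X = abs_marked_torus (u1, u2, 0, q)"
      unfolding X(1) by (metis Quotient3_marked_torus Quotient3_rel)
    have "\<forall>w\<in>short_vectors (u1, u2, 0, q). e \<le> norm w"
      using Xe unfolding eq systole_ge_iff[OF T] .
    then have "(u1, u2, 0, q) \<in> C" using u q mem by blast
    then show "X \<in> abs_marked_torus ` C" using eq by blast
  qed
  moreover have "compact (abs_marked_torus ` C)"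
    using compact_continuous_image[OF continuous_on_subset[OF cont CT] \<open>compact C\<close>] .
  ultimately show ?thesis by simp
qed

section \<open>Frequency of thick times\<close>

lemma systole_orbit_measurable [measurable]:
  "(\<lambda>t. systole (sl2_act (geod t) X)) \<in> borel_measurable borel"
  by (rule borel_measurable_continuous_onI, rule continuous_on_compose2[OF continuous_on_systole continuous_geod_orbit]) auto

text \<open>Weak-* convergence is applied to a single test function, supported in a compact
  superlevel set of the systole, whose integral is positive.\<close>

lemma positive_thick_frequency:
  fixes \<tau> :: "nat \<Rightarrow> real"
  assumes \<tau>: "\<And>n. 0 < \<tau> n" and ws: "weak_star_convergent (\<lambda>n. geod_average X (\<tau> n)) \<nu>"
    and \<nu>: "\<nu> \<noteq> null_measure borel"
  obtains e \<delta> where "0 < e" "0 < \<delta>"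
    "\<forall>\<^sub>F n in sequentially. \<delta> * \<tau> n \<le> measure lborel {t \<in> {0..\<tau> n}. e \<le> systole (sl2_act (geod t) X)}"
proof -
  have sets: "sets \<nu> = sets borel" and space: "space \<nu> = UNIV"
    using ws sets_eq_imp_space_eq[of \<nu> borel] by (auto simp: weak_star_convergent_def)
  have [measurable]: "systole \<in> borel_measurable borel"
    by (rule borel_measurable_continuous_onI[OF continuous_on_systole])
  have meas\<nu>: "systole \<in> borel_measurable \<nu>" using sets by (simp cong: measurable_cong_sets)
  have "\<exists>n. emeasure \<nu> {Y. 1 / real (Suc n) < systole Y} \<noteq> 0"
  proof (rule ccontr)
    assume a: "\<not> ?thesis"
    have "emeasure \<nu> (\<Union>n. {Y. 1 / real (Suc n) < systole Y}) = 0"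
      using a by (intro emeasure_UN_eq_0) (auto simp: sets)
    moreover have "(\<Union>n. {Y. 1 / real (Suc n) < systole Y}) = UNIV"
      using reals_Archimedean[OF systole_pos] by (auto simp: inverse_eq_divide)
    ultimately have "emeasure \<nu> UNIV = 0" by simp
    then have "emeasure \<nu> A = 0" for A
      by (metis emeasure_mono le_zero_eq sets.top space subset_UNIV)
    then have "\<nu> = null_measure borel" by (intro measure_eqI) (auto simp: sets)
    with \<nu> show False by simp
  qed
  then obtain n0 where n0: "emeasure \<nu> {Y. 1 / real (Suc n0) < systole Y} \<noteq> 0" by blast
  define e where "e = 1 / real (Suc n0)"
  have e: "0 < e" by (simp add: e_def)
  \<comment> \<open>Positive exactly where the systole exceeds e, and below the indicator of
    \<open>K\<close>.\<close>
  define f where "f = (\<lambda>Y. max 0 (min 1 (systole Y / e - 1)))"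
  define K where "K = {Y. e \<le> systole Y}"
  have K: "compact K" "K \<in> sets borel" unfolding K_def using compact_systole_ge[OF e] by auto
  have f_le: "f Y \<le> indicator K Y" and f0: "0 \<le> f Y" for Y
    using e by (auto simp: f_def K_def indicator_def field_simps)
  have cf: "continuous_on UNIV f" unfolding f_def using e
    by (intro continuous_intros continuous_on_systole) auto
  have "f Y = 0" if "Y \<notin> K" for Y using f_le[of Y] f0[of Y] that by simp
  then have ccf: "compactly_supported_continuous f"
    unfolding compactly_supported_continuous_def using cf K(1) by blast
  have fm: "f \<in> borel_measurable \<nu>"
    using borel_measurable_continuous_onI[OF cf] sets by (simp cong: measurable_cong_sets)
  have "emeasure \<nu> K < \<infinity>" using ws K unfolding weak_star_convergent_def by blast
  then have "integrable \<nu> (indicator K :: _ \<Rightarrow> real)" using K(2) sets by (simp add: integrable_indicator_iff)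
  then have fint: "integrable \<nu> f"
    by (rule Bochner_Integration.integrable_bound[OF _ fm]) (use f_le f0 in auto)
  define I where "I = integral\<^sup>L \<nu> f"
  have "I \<noteq> 0"
  proof
    assume "I = 0"
    then have "AE Y in \<nu>. f Y = 0"
      using integral_nonneg_eq_0_iff_AE[OF fint] f0 unfolding I_def by simp
    then have "emeasure \<nu> {Y \<in> space \<nu>. f Y \<noteq> 0} = 0"
      using fm by (subst (asm) AE_iff_measurable[OF _ refl]) auto
    moreover have "{Y \<in> space \<nu>. f Y \<noteq> 0} = {Y. e < systole Y}"
      using e by (auto simp: f_def space field_simps min_def max_def)
    ultimately show False using n0 by (simp add: e_def)
  qed
  moreover have "0 \<le> I" unfolding I_def using f0 by simp
  ultimately have I: "0 < I" by simp
  have "(\<lambda>n. integral\<^sup>L (geod_average X (\<tau> n)) f) \<longlonglongrightarrow> I"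
    using ws ccf unfolding weak_star_convergent_def I_def by blast
  then have "\<forall>\<^sub>F n in sequentially. I / 2 < integral\<^sup>L (geod_average X (\<tau> n)) f"
    using I by (intro order_tendstoD) auto
  then have "\<forall>\<^sub>F n in sequentially. I / 2 * \<tau> n \<le> measure lborel {t \<in> {0..\<tau> n}. e \<le> systole (sl2_act (geod t) X)}"
  proof eventually_elim
    case (elim n)
    let ?A = "{t \<in> {0..\<tau> n}. e \<le> systole (sl2_act (geod t) X)}"
    have A[measurable]: "?A \<in> sets borel" by measurable
    have Afin: "emeasure lborel ?A < \<infinity>"
      by (rule le_less_trans[OF emeasure_mono[of ?A "{0..\<tau> n}" lborel]]) (use \<tau>[of n] in auto)
    have fgm: "(\<lambda>t. f (sl2_act (geod t) X)) \<in> borel_measurable borel"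
      by (rule borel_measurable_continuous_onI, rule continuous_on_compose2[OF cf continuous_geod_orbit]) auto
    have iA: "integrable lborel (indicator ?A :: real \<Rightarrow> real)" using Afin A by (simp add: integrable_indicator_iff)
    have le: "indicator {0..\<tau> n} t *\<^sub>R f (sl2_act (geod t) X) \<le> indicator ?A t" for t
      using f_le[of "sl2_act (geod t) X"] by (auto simp: indicator_def K_def split: if_splits)
    have "(LBINT t:{0..\<tau> n}. f (sl2_act (geod t) X)) \<le> integral\<^sup>L lborel (indicator ?A :: real \<Rightarrow> real)"
      unfolding set_lebesgue_integral_def
    proof (rule integral_mono[OF _ iA le])
      show "integrable lborel (\<lambda>t. indicator {0..\<tau> n} t *\<^sub>R f (sl2_act (geod t) X))"
      proof (rule Bochner_Integration.integrable_bound[OF iA])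
        show "(\<lambda>t. indicator {0..\<tau> n} t *\<^sub>R f (sl2_act (geod t) X)) \<in> borel_measurable lborel"
          using fgm by measurable
      qed (use le f0 in auto)
    qed
    also have "\<dots> = measure lborel ?A" by simp
    finally have "integral\<^sup>L (geod_average X (\<tau> n)) f \<le> 1 / \<tau> n * measure lborel ?A"
      unfolding integral_geod_average[OF \<tau> ccf] using \<tau>[of n] by (intro mult_left_mono) auto
    with elim have "I / 2 < 1 / \<tau> n * measure lborel ?A" by (rule less_le_trans)
    then show ?case using \<tau>[of n] by (simp add: field_simps)
  qed
  with e I that[of e "I / 2"] show ?thesis by simp
qed

text \<open>No lattice vector and no vector joining the marked points has \<open>\<ell>\<^sup>1\<close>-norm below \<open>e\<close> on the torus at time \<open>t\<close>.\<close>

definition thick_time :: "real \<Rightarrow> real \<Rightarrow> real \<Rightarrow> real \<Rightarrow> bool" where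
  "thick_time \<alpha> z e t \<longleftrightarrow>
     (\<forall>m n :: int. m \<noteq> 0 \<or> n \<noteq> 0 \<longrightarrow> e \<le> exp t * \<bar>of_int m - of_int n * \<alpha>\<bar> + exp (- t) * \<bar>of_int n\<bar>) \<and>
     (\<forall>m n :: int. e \<le> exp t * \<bar>z + of_int m - of_int n * \<alpha>\<bar> + exp (- t) * \<bar>of_int n\<bar>)"

text \<open>Both exponentials change by a factor of at most exp 1 within unit time, so thickness
  survives rounding the time to an integer.\<close>

lemma thick_time_shift:
  assumes "thick_time \<alpha> z e t" "\<bar>t - t'\<bar> \<le> 1" "0 < e"
  shows "thick_time \<alpha> z (e / exp 1) t'"
proof -
  have *: "e / exp 1 \<le> exp t' * a + exp (- t') * b" if "e \<le> exp t * a + exp (- t) * b" "0 \<le> a" "0 \<le> b" for a b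
  proof -
    have "exp t * a + exp (- t) * b \<le> exp (1 + t') * a + exp (1 + (- t')) * b"
      using that assms(2) by (intro add_mono mult_right_mono) auto
    also have "\<dots> = exp 1 * (exp t' * a + exp (- t') * b)" by (simp only: exp_add) (simp add: algebra_simps)
    finally have "e \<le> exp 1 * (exp t' * a + exp (- t') * b)" using that by linarith
    then show ?thesis by (simp add: field_simps)
  qed
  show ?thesis using assms(1) unfolding thick_time_def by (auto intro!: *)
qed

lemma thick_time_systole:
  assumes "0 < z" "z < 1" "e \<le> systole (sl2_act (geod t) (assoc_torus \<alpha> z))"
  shows "thick_time \<alpha> z e t"
proof -
  define M where "M = (vector [vector [exp t, 0], vector [0, exp (- t)]] :: real^2^2)"
  have detM: "det M = 1" by (simp add: M_def det_2 flip: exp_add)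
  note T = assoc_torus_data[OF assms(1,2), of \<alpha>]
  let ?v1 = "vector [1, 0] :: real^2" and ?v2 = "vector [- \<alpha>, 1] :: real^2"
    and ?p1 = "vector [0, 0] :: real^2" and ?p2 = "vector [z, 0] :: real^2"
  have eq: "sl2_act (geod t) (assoc_torus \<alpha> z) = abs_marked_torus (M *v ?v1, M *v ?v2, M *v ?p1, M *v ?p2)"
  proof -
    have "eq_onp (\<lambda>A. det A = 1) M M" by (simp add: eq_onp_same_args detM)
    from sl2_act.abs_eq[OF this torus_data_rel_refl[OF T]] show ?thesis
      unfolding assoc_torus_def geod_def M_def by simp
  qed
  have T': "(M *v ?v1, M *v ?v2, M *v ?p1, M *v ?p2) \<in> torus_data_set"
    by (rule sl2_torus_data_set[OF detM T])
  have Mv: "M *v vector [a, b] = vector [exp t * a, exp (- t) * b]" for a b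
    by (simp add: vec_eq_iff forall_2 M_def matrix_vector_mult_def sum_2)
  have nrm: "norm (vector [a, b] :: real^2) \<le> \<bar>a\<bar> + \<bar>b\<bar>" for a b
    using norm_le_l1_cart[of "vector [a, b] :: real^2"] by (simp add: sum_2)
  have lat: "of_int m *\<^sub>R (M *v ?v1) + of_int n *\<^sub>R (M *v ?v2)
      = vector [exp t * (of_int m - of_int n * \<alpha>), exp (- t) * of_int n]" for m n
    unfolding Mv by (simp add: vec_eq_iff forall_2 algebra_simps)
  have rel: "M *v ?p2 - M *v ?p1 + (of_int m *\<^sub>R (M *v ?v1) + of_int n *\<^sub>R (M *v ?v2))
      = vector [exp t * (z + of_int m - of_int n * \<alpha>), exp (- t) * of_int n]" for m n
    unfolding lat Mv by (simp add: vec_eq_iff forall_2 algebra_simps)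
  note sv = assms(3)[unfolded eq systole_ge_iff[OF T'] Ball_def short_vectors_iff, rule_format]
  show ?thesis unfolding thick_time_def
  proof (intro conjI allI impI)
    fix m n :: int assume mn: "m \<noteq> 0 \<or> n \<noteq> 0"
    have "vector [exp t * (of_int m - of_int n * \<alpha>), exp (- t) * of_int n] \<noteq> (0 :: real^2)"
      using mn by (auto simp: vec_eq_iff forall_2)
    then have "e \<le> norm (vector [exp t * (of_int m - of_int n * \<alpha>), exp (- t) * of_int n] :: real^2)"
      using lat by (intro sv disjI1) metis
    also note nrm
    finally show "e \<le> exp t * \<bar>of_int m - of_int n * \<alpha>\<bar> + exp (- t) * \<bar>of_int n\<bar>"
      by (simp add: abs_mult)
  next
    fix m n :: int
    have "e \<le> norm (vector [exp t * (z + of_int m - of_int n * \<alpha>), exp (- t) * of_int n] :: real^2)"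
      using rel by (intro sv disjI2) metis
    also note nrm
    finally show "e \<le> exp t * \<bar>z + of_int m - of_int n * \<alpha>\<bar> + exp (- t) * \<bar>of_int n\<bar>"
      by (simp add: abs_mult)
  qed
qed


lemma positive_thick_integer_frequency:
  assumes z: "0 < z" "z < 1" and \<tau>: "\<And>n. 0 < \<tau> n" "filterlim \<tau> at_top sequentially"
    and ws: "weak_star_convergent (\<lambda>n. geod_average (assoc_torus \<alpha> z) (\<tau> n)) \<nu>"
    and \<nu>: "\<nu> \<noteq> null_measure borel"
  obtains e \<delta> and N :: "nat \<Rightarrow> nat" where "0 < e" "0 < \<delta>" "filterlim N at_top sequentially"
    "\<forall>\<^sub>F i in sequentially. \<delta> * real (N i) \<le> real (card ({n. thick_time \<alpha> z e (real n)} \<inter> {..<N i}))"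
proof -
  obtain e \<delta> where e: "0 < e" and \<delta>: "0 < \<delta>" and ev: "\<forall>\<^sub>F i in sequentially.
      \<delta> * \<tau> i \<le> measure lborel {t \<in> {0..\<tau> i}. e \<le> systole (sl2_act (geod t) (assoc_torus \<alpha> z))}"
    using positive_thick_frequency[OF \<tau>(1) ws \<nu>] by blast
  \<comment> \<open>The number of unit intervals covering [0, \<open>\<tau> i\<close>]; it is at
    most 2 \<open>\<tau> i\<close> once \<open>\<tau> i\<close> \<ge> 1, whence \<delta> / 2
    below.\<close>
  define N where "N = (\<lambda>i. Suc (nat \<lfloor>\<tau> i\<rfloor>))"
  define H where "H = {n. thick_time \<alpha> z (e / exp 1) (real n)}"
  have "filterlim (\<lambda>i. nat \<lfloor>\<tau> i\<rfloor>) at_top sequentially"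
    using filterlim_compose[OF filterlim_nat_sequentially filterlim_compose[OF filterlim_floor_sequentially \<tau>(2)]] .
  then have lim: "filterlim N at_top sequentially"
    unfolding N_def by (rule filterlim_compose[OF filterlim_Suc])
  have "\<forall>\<^sub>F i in sequentially. 1 \<le> \<tau> i"
    using \<tau>(2) unfolding filterlim_at_top by blast
  with ev have "\<forall>\<^sub>F i in sequentially. \<delta> / 2 * real (N i) \<le> real (card (H \<inter> {..<N i}))"
  proof eventually_elim
    case (elim i)
    let ?A = "{t \<in> {0..\<tau> i}. e \<le> systole (sl2_act (geod t) (assoc_torus \<alpha> z))}"
    let ?B = "\<Union>n\<in>H \<inter> {..<N i}. {real n..real n + 1}"
    have "?A \<subseteq> ?B"
    proof
      fix t assume t: "t \<in> ?A"
      let ?n = "nat \<lfloor>t\<rfloor>"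
      have "real ?n = of_int \<lfloor>t\<rfloor>" using t by simp
      then have n: "real ?n \<le> t" "t \<le> real ?n + 1" by linarith+
      have "thick_time \<alpha> z e t" using t z by (intro thick_time_systole) auto
      moreover have "\<bar>t - real ?n\<bar> \<le> 1" using n by linarith
      ultimately have "?n \<in> H" unfolding H_def mem_Collect_eq using e by (rule thick_time_shift)
      moreover have "?n \<le> nat \<lfloor>\<tau> i\<rfloor>" using t by (intro nat_mono floor_mono) simp
      then have "?n < N i" unfolding N_def by simp
      ultimately show "t \<in> ?B" using n by (intro UN_I[of ?n]) simp_all
    qed
    moreover have "emeasure lborel ?B < \<infinity>"
      by (rule le_less_trans[OF emeasure_subadditive_finite]) (auto simp: ennreal_of_nat_eq_real_of_nat)
    ultimately have "measure lborel ?A \<le> measure lborel ?B"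
      by (intro measure_mono_fmeasurable) (auto simp: fmeasurable_def, measurable)
    also have "\<dots> \<le> (\<Sum>n\<in>H \<inter> {..<N i}. measure lborel {real n..real n + 1})"
      by (rule measure_UNION_le) auto
    also have "\<dots> = real (card (H \<inter> {..<N i}))" by simp
    finally have "\<delta> * \<tau> i \<le> real (card (H \<inter> {..<N i}))" using elim by linarith
    moreover have "real (N i) \<le> 2 * \<tau> i" using elim(2) unfolding N_def by simp linarith
    then have "\<delta> / 2 * real (N i) \<le> \<delta> / 2 * (2 * \<tau> i)" using \<delta> by (intro mult_left_mono) auto
    ultimately show ?case by simp
  qed
  with lim e \<delta> show ?thesis using that[of "e / exp 1" "\<delta> / 2" N] unfolding H_def by simp
qed

section \<open>Finitely additive densities\<close>

text \<open>Along U the frequencies of all sets converge at once. An upper density would be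
  subadditive too, but a sum of upper densities cannot be bounded by counting multiplicities, as
  \<open>sum_density_le\<close> does.\<close>

locale limit_density =
  fixes N :: "nat \<Rightarrow> nat" and U :: "nat filter" and d :: "nat set \<Rightarrow> real"
  assumes N_lim: "filterlim N at_top U" and U: "U \<noteq> bot"
    and d_lim: "\<And>A. ((\<lambda>i. real (card (A \<inter> {..<N i})) / real (N i)) \<longlongrightarrow> d A) U"

text \<open>Tychonoff's theorem provides a cluster point of the counting frequencies of all sets at once.\<close>

lemma limit_density_exists:
  fixes N :: "nat \<Rightarrow> nat"
  assumes "filterlim N at_top sequentially"
  obtains U d where "U \<le> sequentially" "limit_density N U d"
proof -
  define f where "f = (\<lambda>i A. real (card (A \<inter> {..<N i})) / real (N i))"
  define S :: "(nat set \<Rightarrow> real) set" where "S = PiE UNIV (\<lambda>_. {0..1})"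
  have "compactin (product_topology (\<lambda>_. euclideanreal) UNIV) S"
    unfolding S_def compactin_PiE by simp
  then have S: "compact S" by (simp add: euclidean_product_topology)
  have fS: "f i \<in> S" for i
  proof -
    have "card (A \<inter> {..<N i}) \<le> N i" for A using card_mono[of "{..<N i}" "A \<inter> {..<N i}"] by simp
    then show ?thesis unfolding S_def f_def by (auto simp: divide_le_eq_1)
  qed
  define F where "F = filtermap f sequentially"
  have "F \<noteq> bot" "eventually (\<lambda>x. x \<in> S) F" unfolding F_def using fS by (auto simp: filtermap_bot_iff eventually_filtermap)
  then obtain d where d: "inf (nhds d) F \<noteq> bot" using S unfolding compact_filter by blast
  \<comment> \<open>The coarsest filter below \<open>sequentially\<close> along which f tends to d;
    it is proper because d is a cluster point.\<close>
  define U where "U = inf sequentially (filtercomap f (nhds d))"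
  have "U \<noteq> bot"
  proof
    assume "U = bot"
    then have "eventually (\<lambda>_. False) U" by simp
    then obtain P Q where PQ: "eventually P sequentially" "eventually Q (filtercomap f (nhds d))" "\<And>x. P x \<Longrightarrow> Q x \<Longrightarrow> False"
      unfolding U_def eventually_inf by blast
    then obtain R where R: "eventually R (nhds d)" "\<And>x. R (f x) \<Longrightarrow> Q x"
      unfolding eventually_filtercomap by blast
    have "eventually (\<lambda>x. \<not> R x) F" unfolding F_def eventually_filtermap
      using PQ(1) by eventually_elim (use PQ(3) R(2) in blast)
    with R(1) have "eventually (\<lambda>_. False) (inf (nhds d) F)" unfolding eventually_inf by blast
    with d show False by simp
  qed
  moreover have "((\<lambda>i. f i A) \<longlongrightarrow> d A) U" for A
  proof -
    have "filterlim f (nhds d) U" unfolding U_def filterlim_iff_le_filtercomap by simp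
    then show ?thesis
      by (rule continuous_on_tendsto_compose[OF continuous_on_product_coordinates]) auto
  qed
  moreover have "U \<le> sequentially" by (simp add: U_def)
  ultimately show ?thesis using that[of U d] assms filterlim_mono[OF assms order_refl \<open>U \<le> sequentially\<close>]
    unfolding limit_density_def f_def by blast
qed

context limit_density
begin

lemma N_pos: "\<forall>\<^sub>F i in U. 0 < N i"
proof -
  have "\<forall>\<^sub>F i in U. 1 \<le> N i" using N_lim unfolding filterlim_at_top by blast
  then show ?thesis by eventually_elim simp
qed

lemma N_real_lim: "filterlim (\<lambda>i. real (N i)) at_top U"
  by (rule filterlim_compose[OF filterlim_real_sequentially N_lim])

lemma density_le:
  assumes "\<And>n. real (card (A \<inter> {..<n})) \<le> \<epsilon> * real n + C"
  shows "d A \<le> \<epsilon>"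
proof -
  have "((\<lambda>i. \<epsilon> + C / real (N i)) \<longlongrightarrow> \<epsilon> + 0) U"
    by (intro tendsto_intros real_tendsto_divide_at_top[OF tendsto_const N_real_lim])
  moreover have "\<forall>\<^sub>F i in U. real (card (A \<inter> {..<N i})) / real (N i) \<le> \<epsilon> + C / real (N i)"
    using N_pos
  proof eventually_elim
    case (elim i)
    then show ?case using assms[of "N i"] by (simp add: field_simps)
  qed
  ultimately show ?thesis using tendsto_le[OF U _ d_lim] by simp
qed

lemma density_ge:
  assumes "\<forall>\<^sub>F i in U. \<delta> * real (N i) \<le> real (card (A \<inter> {..<N i}))"
  shows "\<delta> \<le> d A"
proof (rule tendsto_lowerbound[OF d_lim _ U])
  show "\<forall>\<^sub>F i in U. \<delta> \<le> real (card (A \<inter> {..<N i})) / real (N i)"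
    using assms N_pos by eventually_elim (simp add: field_simps)
qed

lemma density_nonneg: "0 \<le> d A"
  by (rule density_ge) simp

lemma density_mono:
  assumes "A \<subseteq> B" shows "d A \<le> d B"
proof (rule tendsto_le[OF U d_lim d_lim])
  show "\<forall>\<^sub>F i in U. real (card (A \<inter> {..<N i})) / real (N i) \<le> real (card (B \<inter> {..<N i})) / real (N i)"
    using assms by (intro always_eventually allI divide_right_mono) (auto intro!: card_mono)
qed

lemma density_Un_le: "d (A \<union> B) \<le> d A + d B"
proof (rule tendsto_le[OF U tendsto_add[OF d_lim[of A] d_lim[of B]] d_lim])
  show "\<forall>\<^sub>F i in U. real (card ((A \<union> B) \<inter> {..<N i})) / real (N i)
      \<le> real (card (A \<inter> {..<N i})) / real (N i) + real (card (B \<inter> {..<N i})) / real (N i)"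
    unfolding add_divide_distrib[symmetric] Int_Un_distrib2
    by (intro always_eventually allI divide_right_mono) (auto simp flip: of_nat_add intro: card_Un_le)
qed

lemma density_finite:
  assumes "finite A" shows "d A = 0"
proof -
  have "d A \<le> 0"
    using assms by (intro density_le[of _ _ "real (card A)"]) (auto intro!: card_mono)
  with density_nonneg[of A] show ?thesis by simp
qed

text \<open>Translation brings at most \<sigma> new points into the window, which vanish after
  division by \<open>N i\<close>. Conditions at time n + \<sigma> thus cost no more than conditions
  at time n.\<close>

lemma density_vimage_add_le: "d {n. n + \<sigma> \<in> A} \<le> d A"
proof -
  have "((\<lambda>i. real (card (A \<inter> {..<N i})) / real (N i) + real \<sigma> / real (N i)) \<longlongrightarrow> d A + 0) U"
    by (intro tendsto_add d_lim real_tendsto_divide_at_top[OF tendsto_const N_real_lim])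
  moreover have "\<forall>\<^sub>F i in U. real (card ({n. n + \<sigma> \<in> A} \<inter> {..<N i})) / real (N i)
      \<le> real (card (A \<inter> {..<N i})) / real (N i) + real \<sigma> / real (N i)"
  proof (intro always_eventually allI)
    fix i
    have "card ({n. n + \<sigma> \<in> A} \<inter> {..<N i}) = card ((\<lambda>n. n + \<sigma>) ` ({n. n + \<sigma> \<in> A} \<inter> {..<N i}))"
      by (rule card_image[symmetric]) (simp add: inj_on_def)
    also have "\<dots> \<le> card ((A \<inter> {..<N i}) \<union> {N i..<N i + \<sigma>})" by (intro card_mono) auto
    also have "\<dots> \<le> card (A \<inter> {..<N i}) + \<sigma>"
      by (rule order_trans[OF card_Un_le]) simp
    finally have "real (card ({n. n + \<sigma> \<in> A} \<inter> {..<N i})) \<le> real (card (A \<inter> {..<N i})) + real \<sigma>"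
      by (simp flip: of_nat_add)
    then show "real (card ({n. n + \<sigma> \<in> A} \<inter> {..<N i})) / real (N i)
      \<le> real (card (A \<inter> {..<N i})) / real (N i) + real \<sigma> / real (N i)"
      unfolding add_divide_distrib[symmetric] by (rule divide_right_mono) simp
  qed
  ultimately show ?thesis using tendsto_le[OF U _ d_lim] by simp
qed

text \<open>Double counting: each n contributes at most K to the sum of the counts.\<close>

lemma sum_density_le:
  assumes I: "finite I" and K: "\<And>n. card {i \<in> I. n \<in> A i} \<le> K"
  shows "(\<Sum>i\<in>I. d (A i)) \<le> real K"
proof (rule tendsto_upperbound[OF tendsto_sum[OF d_lim] _ U])
  show "\<forall>\<^sub>F j in U. (\<Sum>i\<in>I. real (card (A i \<inter> {..<N j})) / real (N j)) \<le> real K"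
    using N_pos
  proof eventually_elim
    case (elim j)
    have "(\<Sum>i\<in>I. card (A i \<inter> {..<N j})) = (\<Sum>i\<in>I. \<Sum>n<N j. of_bool (n \<in> A i))"
      by (intro sum.cong refl) (simp add: Int_commute Int_def)
    also have "\<dots> = (\<Sum>n<N j. \<Sum>i\<in>I. of_bool (n \<in> A i))" by (rule sum.swap)
    also have "\<dots> \<le> (\<Sum>n<N j. K)"
      using K I by (intro sum_mono) (simp add: Int_def)
    finally have "(\<Sum>i\<in>I. card (A i \<inter> {..<N j})) \<le> N j * K" by simp
    then have "(\<Sum>i\<in>I. real (card (A i \<inter> {..<N j}))) \<le> real (N j) * real K"
      by (simp flip: of_nat_sum of_nat_mult)
    then show ?case using elim by (simp add: field_simps flip: sum_divide_distrib)
  qed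
qed

text \<open>Pigeonhole: otherwise more than K / \<epsilon> of the sets would have total density
  above K.\<close>

lemma density_small_member:
  assumes "0 < \<epsilon>" and K: "\<And>m n. card {i \<in> {..<m}. n \<in> A i} \<le> K"
  obtains i :: nat where "d (A i) \<le> \<epsilon>"
proof -
  obtain m where m: "real K / \<epsilon> < real m" using reals_Archimedean2 by blast
  have "\<exists>i. d (A i) \<le> \<epsilon>"
  proof (rule ccontr)
    assume "\<not> ?thesis"
    then have "(\<Sum>i<m. \<epsilon>) \<le> (\<Sum>i<m. d (A i))" by (intro sum_mono) (simp add: less_imp_le not_le)
    also have "\<dots> \<le> real K" by (rule sum_density_le) (use K in auto)
    finally show False using m assms(1) by (simp add: field_simps)
  qed
  with that show ?thesis by blast
qed

text \<open>The fibres of h are disjoint, so their densities form a summable series. The upper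
  cutoff Z is essential, since a finitely additive density may lose mass at infinity; what matters
  is that B does not depend on Z.\<close>

lemma density_tail:
  fixes h :: "nat \<Rightarrow> nat"
  assumes "0 < \<epsilon>"
  obtains B where "\<And>Z. d {n. B \<le> h n \<and> h n < Z} \<le> \<epsilon>"
proof -
  have fin_le: "d {n. a \<le> h n \<and> h n < b} \<le> (\<Sum>i\<in>{a..<b}. d {n. h n = i})" for a b
  proof (induction b)
    case 0
    then show ?case using density_finite[of "{}"] by simp
  next
    case (Suc b)
    show ?case
    proof (cases "a \<le> b")
      case True
      have "{n. a \<le> h n \<and> h n < Suc b} = {n. a \<le> h n \<and> h n < b} \<union> {n. h n = b}" using True by auto
      then have "d {n. a \<le> h n \<and> h n < Suc b} \<le> d {n. a \<le> h n \<and> h n < b} + d {n. h n = b}"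
        using density_Un_le by simp
      with Suc True show ?thesis by simp
    next
      case False
      then have e: "{n. a \<le> h n \<and> h n < Suc b} = {}" by auto
      show ?thesis unfolding e using density_finite[of "{}"] False by simp
    qed
  qed
  have card1: "card {i \<in> I. n \<in> {n. h n = i}} \<le> 1" for I n
    using card_mono[of "{h n}" "{i \<in> I. n \<in> {n. h n = i}}"] by auto
  have "summable (\<lambda>i. d {n. h n = i})"
  proof (rule bounded_imp_summable)
    show "(\<Sum>i\<le>n. d {k. h k = i}) \<le> real 1" for n
      by (rule sum_density_le[OF _ card1]) simp
  qed (rule density_nonneg)
  then obtain B where B: "\<And>m n. B \<le> m \<Longrightarrow> norm (\<Sum>i\<in>{m..<n}. d {k. h k = i}) < \<epsilon>"
    using assms unfolding summable_Cauchy by blast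
  show ?thesis
  proof (rule that[of B])
    fix Z
    show "d {n. B \<le> h n \<and> h n < Z} \<le> \<epsilon>" using B[of B Z] fin_le[of B Z] by simp
  qed
qed

end

section \<open>Continued fractions\<close>

text \<open>Numerators of the convergents for 0 < \<alpha> < 1: the initial values 0 and 1 encode
  a_0 = 0.\<close>

fun cf_num :: "real \<Rightarrow> nat \<Rightarrow> int" where
  "cf_num \<alpha> 0 = 0"
| "cf_num \<alpha> (Suc 0) = 1"
| "cf_num \<alpha> (Suc (Suc k)) = int (cf_digit \<alpha> (Suc (Suc k))) * cf_num \<alpha> (Suc k) + cf_num \<alpha> k"

definition cf_err :: "real \<Rightarrow> nat \<Rightarrow> real" where
  "cf_err \<alpha> k = real (cf_denom \<alpha> k) * \<alpha> - of_int (cf_num \<alpha> k)"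

text \<open>For x \<ge> 1 this is the last v with q_v \<le> x, also in the degenerate case q_0 = q_1
  = 1.\<close>

definition cf_index :: "real \<Rightarrow> real \<Rightarrow> nat" where
  "cf_index \<alpha> x = (LEAST v. x < real (cf_denom \<alpha> (Suc v)))"

lemma frac_not_Rats: "x \<notin> \<rat> \<Longrightarrow> frac x \<notin> \<rat>" for x :: real
  unfolding frac_def by (metis Rats_add Rats_of_int diff_add_cancel)

locale irrational_rotation =
  fixes \<alpha> :: real
  assumes pos: "0 < \<alpha>" and less_1: "\<alpha> < 1" and irrational: "\<alpha> \<notin> \<rat>"
begin

abbreviation "q \<equiv> cf_denom \<alpha>"
abbreviation "a \<equiv> cf_digit \<alpha>"
abbreviation "\<theta> \<equiv> cf_err \<alpha>"

lemma rem_irrational: "cf_rem \<alpha> k \<notin> \<rat>"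
proof (induction k)
  case (Suc k)
  show ?case
  proof
    assume "cf_rem \<alpha> (Suc k) \<in> \<rat>"
    then have "inverse (cf_rem \<alpha> (Suc k)) \<in> \<rat>" by (rule Rats_inverse)
    then show False using frac_not_Rats[OF Suc] by (simp add: inverse_eq_divide)
  qed
qed (simp add: irrational)

lemma frac_rem_pos: "0 < frac (cf_rem \<alpha> k)"
  using rem_irrational[of k] Ints_subset_Rats by (auto simp: frac_gt_0_iff)

lemma rem_pos: "0 < cf_rem \<alpha> k"
  using pos frac_rem_pos by (cases k) auto

lemma rem_Suc_gt_1: "1 < cf_rem \<alpha> (Suc k)"
  using frac_rem_pos[of k] frac_lt_1[of "cf_rem \<alpha> k"] by simp

lemma rem_eq: "cf_rem \<alpha> k = real (a k) + frac (cf_rem \<alpha> k)"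
  using rem_pos[of k] by (simp add: cf_digit_def frac_def)

lemma digit_Suc_ge_1: "1 \<le> a (Suc k)"
  using rem_Suc_gt_1[of k] unfolding cf_digit_def by (simp add: le_nat_iff le_floor_iff del: cf_rem.simps)

lemma denom_pos: "0 < q k"
  using digit_Suc_ge_1 by (induction \<alpha> k rule: cf_denom.induct) (auto simp: Suc_le_eq)

lemma denom_Suc_Suc_ge: "q (Suc k) + q k \<le> q (Suc (Suc k))"
  using digit_Suc_ge_1[of "Suc k"] by simp

lemma denom_le_Suc: "q k \<le> q (Suc k)"
proof (cases k)
  case 0
  then show ?thesis using digit_Suc_ge_1[of 0] by simp
next
  case (Suc m)
  show ?thesis unfolding Suc using denom_Suc_Suc_ge[of m] by linarith
qed

lemma denom_mono: "i \<le> j \<Longrightarrow> q i \<le> q j"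
  using denom_le_Suc by (rule lift_Suc_mono_le)

lemma denom_strict: "q (Suc k) < q (Suc (Suc k))"
  using denom_Suc_Suc_ge[of k] denom_pos[of k] by linarith

lemma denom_add_even: "2 ^ i * q k \<le> q (k + 2 * i)"
proof (induction i)
  case (Suc i)
  have "2 * q (k + 2 * i) \<le> q (k + 2 * Suc i)"
    using denom_Suc_Suc_ge[of "k + 2 * i"] denom_le_Suc[of "k + 2 * i"] by (simp only: mult_Suc_right add_2_eq_Suc add_Suc_right)
  with Suc show ?case by simp
qed simp

lemma denom_unbounded: "\<exists>k. x < real (q k)"
proof -
  have "\<exists>i. x < 2 ^ i" by (rule real_arch_pow) simp
  then obtain i where i: "x < 2 ^ i" by blast
  have "2 ^ i \<le> q (2 * i)" using denom_add_even[of i 0] by simp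
  then have "real (2 ^ i) \<le> real (q (2 * i))" by (rule of_nat_mono)
  then have "2 ^ i \<le> real (q (2 * i))" by simp
  with i show ?thesis using less_le_trans by blast
qed

lemma denom_Suc_le: "q (Suc k) \<le> (a (Suc k) + 1) * q k"
  using denom_le_Suc by (cases k) auto

lemma digit_mult_denom_le: "a (Suc k) * q k \<le> q (Suc k)"
  by (cases k) auto

text \<open>The recurrence of the errors is that of the complete quotients. Alternating signs,
  non-vanishing and strict decrease in absolute value follow from this identity.\<close>

lemma err_Suc: "\<theta> (Suc k) = - \<theta> k * frac (cf_rem \<alpha> (Suc k))"
proof (induction k)
  case 0
  have "real (a 1) = 1 / \<alpha> - frac (1 / \<alpha>)"
  proof -
    have "frac \<alpha> = \<alpha>" using pos less_1 by (simp add: frac_eq)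
    then have "cf_rem \<alpha> 1 = 1 / \<alpha>" by simp
    then show ?thesis using rem_eq[of 1, unfolded \<open>cf_rem \<alpha> 1 = 1 / \<alpha>\<close>] by linarith
  qed
  then have "\<alpha> * real (a 1) = \<alpha> * (1 / \<alpha> - frac (1 / \<alpha>))" by simp
  then have "\<alpha> * real (a 1) = 1 - \<alpha> * frac (1 / \<alpha>)" using pos by (simp add: right_diff_distrib)
  then show ?case using pos less_1
    by (simp add: cf_err_def frac_eq algebra_simps)
next
  case (Suc k)
  have nz: "frac (cf_rem \<alpha> (Suc k)) \<noteq> 0" using frac_rem_pos[of "Suc k"] by simp
  have "\<theta> (Suc (Suc k)) = real (a (Suc (Suc k))) * \<theta> (Suc k) + \<theta> k"
    by (simp add: cf_err_def algebra_simps)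
  also have "\<theta> k = - \<theta> (Suc k) * cf_rem \<alpha> (Suc (Suc k))"
    using Suc nz by (simp add: field_simps del: cf_rem.simps) (simp add: field_simps)
  also have "cf_rem \<alpha> (Suc (Suc k)) = real (a (Suc (Suc k))) + frac (cf_rem \<alpha> (Suc (Suc k)))"
    by (rule rem_eq)
  finally show ?case by (simp add: algebra_simps del: cf_rem.simps)
qed

lemma err_nonzero: "\<theta> k \<noteq> 0"
proof (induction k)
  case 0
  then show ?case using pos by (simp add: cf_err_def)
next
  case (Suc k)
  then show ?case using frac_rem_pos[of "Suc k"] by (simp add: err_Suc del: cf_rem.simps)
qed

lemma abs_err_Suc_less: "\<bar>\<theta> (Suc k)\<bar> < \<bar>\<theta> k\<bar>"
  using err_nonzero[of k] frac_rem_pos[of "Suc k"] frac_lt_1[of "cf_rem \<alpha> (Suc k)"]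
  by (simp add: err_Suc abs_mult del: cf_rem.simps)

lemma abs_err_less: "i < j \<Longrightarrow> \<bar>\<theta> j\<bar> < \<bar>\<theta> i\<bar>"
proof (induction j)
  case (Suc j)
  then show ?case using abs_err_Suc_less[of j] by (cases "i = j") auto
qed simp

lemma convergent_det: "\<bar>int (q (Suc k)) * cf_num \<alpha> k - int (q k) * cf_num \<alpha> (Suc k)\<bar> = 1"
proof (induction k)
  case (Suc k)
  have "int (q (Suc (Suc k))) * cf_num \<alpha> (Suc k) - int (q (Suc k)) * cf_num \<alpha> (Suc (Suc k))
     = - (int (q (Suc k)) * cf_num \<alpha> k - int (q k) * cf_num \<alpha> (Suc k))"
    by (simp add: algebra_simps)
  with Suc show ?case by (simp only: abs_minus_cancel)
qed simp

lemma coprime_convergent: "coprime (cf_num \<alpha> k) (int (q k))"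
proof (rule coprimeI)
  fix c assume "c dvd cf_num \<alpha> k" "c dvd int (q k)"
  then have "c dvd int (q (Suc k)) * cf_num \<alpha> k - int (q k) * cf_num \<alpha> (Suc k)"
    by (intro dvd_diff dvd_mult dvd_mult2)
  then have "c dvd \<bar>int (q (Suc k)) * cf_num \<alpha> k - int (q k) * cf_num \<alpha> (Suc k)\<bar>" by simp
  then show "is_unit c" unfolding convergent_det .
qed

text \<open>The determinant of consecutive convergents is 1 in absolute value, and because the
  errors alternate in sign its two terms add up without cancellation.\<close>

lemma abs_err_less_inverse: "\<bar>\<theta> k\<bar> < 1 / real (q (Suc k))"
proof -
  have "real (q (Suc k)) * \<theta> k - real (q k) * \<theta> (Suc k)
      = of_int (- (int (q (Suc k)) * cf_num \<alpha> k - int (q k) * cf_num \<alpha> (Suc k)))"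
    by (simp add: cf_err_def algebra_simps del: cf_denom.simps cf_num.simps)
  then have "\<bar>real (q (Suc k)) * \<theta> k - real (q k) * \<theta> (Suc k)\<bar> = 1"
    using convergent_det[of k] by (metis abs_minus_cancel of_int_1 of_int_abs)
  moreover have "\<bar>real (q (Suc k)) * \<theta> k - real (q k) * \<theta> (Suc k)\<bar>
      = \<bar>\<theta> k\<bar> * (real (q (Suc k)) + real (q k) * frac (cf_rem \<alpha> (Suc k)))"
  proof -
    have "real (q (Suc k)) * \<theta> k - real (q k) * \<theta> (Suc k)
      = \<theta> k * (real (q (Suc k)) + real (q k) * frac (cf_rem \<alpha> (Suc k)))"
      by (simp add: err_Suc algebra_simps del: cf_rem.simps cf_denom.simps)
    then show ?thesis using frac_ge_0[of "cf_rem \<alpha> (Suc k)"] by (simp add: abs_mult del: cf_rem.simps cf_denom.simps)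
  qed
  moreover have "\<bar>\<theta> k\<bar> * real (q (Suc k)) < \<bar>\<theta> k\<bar> * (real (q (Suc k)) + real (q k) * frac (cf_rem \<alpha> (Suc k)))"
    using err_nonzero[of k] denom_pos[of k] frac_rem_pos[of "Suc k"]
    by (intro mult_strict_left_mono) (auto simp del: cf_rem.simps cf_denom.simps)
  ultimately have "\<bar>\<theta> k\<bar> * real (q (Suc k)) < 1" by linarith
  then show ?thesis using denom_pos[of "Suc k"] by (simp add: field_simps del: cf_denom.simps)
qed

lemma index_bounds:
  assumes "1 \<le> x"
  shows "real (q (cf_index \<alpha> x)) \<le> x" "x < real (q (Suc (cf_index \<alpha> x)))"
proof -
  obtain k where "x < real (q k)" using denom_unbounded by blast
  then have "x < real (q (Suc k))" using denom_le_Suc[of k] by linarith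
  then show "x < real (q (Suc (cf_index \<alpha> x)))" unfolding cf_index_def by (rule LeastI)
  show "real (q (cf_index \<alpha> x)) \<le> x"
  proof (cases "cf_index \<alpha> x")
    case 0
    then show ?thesis using assms by simp
  next
    case (Suc m)
    then have "\<not> x < real (q (Suc m))"
      unfolding cf_index_def by (intro not_less_Least) simp
    then show ?thesis unfolding Suc by (simp only: not_less)
  qed
qed

lemma le_index:
  assumes "1 \<le> x" "real (q j) \<le> x" shows "j \<le> cf_index \<alpha> x"
proof (rule ccontr)
  assume "\<not> j \<le> cf_index \<alpha> x"
  then have "Suc (cf_index \<alpha> x) \<le> j" by simp
  then have "q (Suc (cf_index \<alpha> x)) \<le> q j" by (rule denom_mono)
  then show False using index_bounds(2)[OF assms(1)] assms(2) by linarith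
qed

lemma index_mono:
  assumes "1 \<le> x" "x \<le> y" shows "cf_index \<alpha> x \<le> cf_index \<alpha> y"
  using assms index_bounds(1)[OF assms(1)] by (intro le_index) auto

lemma err_tendsto_0: "\<theta> \<longlonglongrightarrow> 0"
proof (rule LIMSEQ_I)
  fix r :: real assume r: "0 < r"
  obtain k where k: "1 / r < real (q k)" using denom_unbounded by blast
  have "\<bar>\<theta> j\<bar> < r" if "k \<le> j" for j
  proof -
    have "q k \<le> q (Suc j)" using that by (intro denom_mono) simp
    then have "1 / real (q (Suc j)) \<le> 1 / real (q k)"
      using denom_pos[of k] denom_pos[of "Suc j"] by (intro divide_left_mono) (auto simp del: cf_denom.simps)
    also have "\<dots> < r" using k r denom_pos[of k] by (simp add: field_simps)
    finally show ?thesis using abs_err_less_inverse[of j] by linarith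
  qed
  then show "\<exists>no. \<forall>n\<ge>no. norm (\<theta> n - 0) < r" by auto
qed

text \<open>If \<open>c = r / s\<close> with \<open>r, s \<in> \<nat>\<close>, then \<open>c p q\<^sub>v = q\<^sub>j\<close> forces \<open>r p \<theta>\<^sub>v - s \<theta>\<^sub>j\<close> to be an integer, hence to
  vanish once both summands are small, which contradicts the monotonicity of \<open>\<bar>\<theta>\<bar>\<close>.\<close>

lemma multiple_denom_ne_denom:
  assumes c: "0 < c" and P: "0 < P"
  shows "\<exists>k0. \<forall>j v p. k0 \<le> j \<longrightarrow> j < v \<longrightarrow> 0 < p \<longrightarrow> p \<le> P \<longrightarrow> c * (real p * real (q v)) \<noteq> real (q j)"
proof (cases "c \<in> \<rat>")
  case False
  have "c * (real p * real (q v)) \<noteq> real (q j)" if "0 < p" for p v j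
  proof
    assume "c * (real p * real (q v)) = real (q j)"
    then have "c = real (q j) / (real p * real (q v))" using that denom_pos[of v] by (simp add: field_simps)
    then show False using False by simp
  qed
  then show ?thesis by blast
next
  case True
  then obtain m n where mn: "n \<noteq> 0" "\<bar>c\<bar> = real m / real n" by (rule Rats_abs_nat_div_natE)
  then have cmn: "c = real m / real n" "0 < m" using c by (auto intro: gr0I)
  \<comment> \<open>A common bound for both integer coefficients: errors below 1 / (2 S) keep each
    term below 1/2.\<close>
  define S where "S = real m * real P + real n"
  have S: "0 < S" using mn(1) unfolding S_def by (simp add: add_nonneg_pos)
  have "\<forall>\<^sub>F j in sequentially. \<bar>\<theta> j\<bar> < 1 / (2 * S)"
    using order_tendstoD(2)[OF tendsto_rabs_zero[OF err_tendsto_0], of "1 / (2 * S)"] S by simp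
  then obtain k0 where k0: "\<And>j. k0 \<le> j \<Longrightarrow> \<bar>\<theta> j\<bar> < 1 / (2 * S)"
    unfolding eventually_sequentially by blast
  show ?thesis
  proof (intro exI[of _ k0] allI impI notI)
    fix j v p assume j: "k0 \<le> j" "j < v" and p: "0 < p" "p \<le> P" and e: "c * (real p * real (q v)) = real (q j)"
    have e1: "real m * real p * real (q v) = real n * real (q j)"
      using e mn(1) unfolding cmn(1) by (simp add: field_simps)
    define i where "i = int m * int p * cf_num \<alpha> v - int n * cf_num \<alpha> j"
    have "real n * \<theta> j - real m * real p * \<theta> v
        = (real n * real (q j) - real m * real p * real (q v)) * \<alpha> + of_int i"
      by (simp add: cf_err_def i_def algebra_simps)
    then have i: "real n * \<theta> j - real m * real p * \<theta> v = of_int i" using e1 by simp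
    have "real m * real p \<le> real m * real P" using p by (intro mult_left_mono) auto
    then have le: "real n \<le> S" "real m * real p \<le> S" unfolding S_def by simp_all
    have "real n * \<bar>\<theta> j\<bar> < S * (1 / (2 * S))"
      by (rule mult_le_less_imp_less[OF le(1) k0[OF j(1)]]) (use mn(1) in auto)
    moreover have "real m * real p * \<bar>\<theta> v\<bar> < S * (1 / (2 * S))"
      by (rule mult_le_less_imp_less[OF le(2) k0]) (use p cmn(2) j in auto)
    ultimately have "\<bar>real n * \<theta> j\<bar> < 1/2" "\<bar>real m * real p * \<theta> v\<bar> < 1/2"
      using S by (simp_all add: abs_mult)
    then have "\<bar>of_int i :: real\<bar> < 1" unfolding i[symmetric] by linarith
    then have "i = 0" by simp
    then have "\<bar>real n * \<theta> j\<bar> = \<bar>real m * real p * \<theta> v\<bar>" using i by simp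
    then have eq: "real n * \<bar>\<theta> j\<bar> = real m * real p * \<bar>\<theta> v\<bar>" by (simp add: abs_mult)
    \<comment> \<open>The contradiction: equality of the two terms and the smaller error at v force
      n < m p, whereas m p q_v = n q_j and q_j \<le> q_v force m p \<le> n.\<close>
    have lt: "real n * \<bar>\<theta> v\<bar> < real n * \<bar>\<theta> j\<bar>" using abs_err_less[OF j(2)] mn(1) by simp
    have "real n < real m * real p"
    proof (rule ccontr)
      assume "\<not> real n < real m * real p"
      then have "real m * real p * \<bar>\<theta> v\<bar> \<le> real n * \<bar>\<theta> v\<bar>" by (intro mult_right_mono) auto
      with lt eq show False by linarith
    qed
    then have "real n * real (q v) < real m * real p * real (q v)" using denom_pos[of v] by simp
    also have "\<dots> \<le> real n * real (q v)" unfolding e1 using denom_mono[of j v] j(2) by (intro mult_left_mono) auto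
    finally show False by simp
  qed
qed

end

section \<open>Visits to the interval\<close>

lemma frac_add_frac: "frac (frac x + y) = frac (x + y)" for x y :: real
proof -
  have "frac x + y - frac (x + y) \<in> \<int>"
    unfolding frac_def by (simp add: algebra_simps)
  then show ?thesis unfolding frac_unique_iff by (simp add: frac_lt_1)
qed

lemma rot_funpow:
  assumes "x \<in> {0..<1}"
  shows "(rot \<alpha> ^^ j) x = frac (x + real j * \<alpha>)"
proof (induction j)
  case 0
  then show ?case using assms by (simp add: frac_eq)
next
  case (Suc j)
  then show ?case by (simp add: rot_def frac_add_frac algebra_simps)
qed

lemma visits_eq_card:
  assumes "x \<in> {0..<1}"
  shows "visits \<alpha> z r x = card {j \<in> {..<r}. frac (x + real j * \<alpha>) < z}"
proof -
  have "visits \<alpha> z r x = (\<Sum>j<r. of_bool (frac (x + real j * \<alpha>) < z))"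
    unfolding visits_def rot_funpow[OF assms] by (intro sum.cong refl) (auto simp: indicator_def)
  then show ?thesis by (simp add: Int_def)
qed

lemma visits_add: "visits \<alpha> z (r + s) x = visits \<alpha> z r x + visits \<alpha> z s ((rot \<alpha> ^^ r) x)"
proof (induction s)
  case (Suc s)
  have "(rot \<alpha> ^^ (r + s)) x = (rot \<alpha> ^^ s) ((rot \<alpha> ^^ r) x)"
    by (simp add: funpow_add add.commute[of r])
  with Suc show ?case by (simp add: visits_def)
qed (simp add: visits_def)

lemma visits_mult: "visits \<alpha> z (p * r) x = (\<Sum>i<p. visits \<alpha> z r ((rot \<alpha> ^^ (i * r)) x))"
proof (induction p)
  case (Suc p)
  then show ?case using visits_add[of \<alpha> z "p * r" r x] by (simp add: add.commute)
qed (simp add: visits_def)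

lemma rot_measurable [measurable]: "rot \<alpha> \<in> borel_measurable borel"
  unfolding rot_def[abs_def] frac_def by measurable

lemma rot_funpow_measurable [measurable]: "(rot \<alpha> ^^ j) \<in> borel_measurable borel"
proof (induction j)
  case (Suc j)
  then show ?case by (simp add: measurable_comp)
qed simp

lemma visits_measurable: "{x \<in> {0..<1}. P (visits \<alpha> z r x)} \<in> sets lborel"
proof -
  have "(\<lambda>x. indicator {0..<z} ((rot \<alpha> ^^ j) x) :: nat) \<in> borel \<rightarrow>\<^sub>M count_space UNIV" for j
    unfolding indicator_def of_bool_def by measurable
  then have "visits \<alpha> z r \<in> borel \<rightarrow>\<^sub>M count_space UNIV"
    unfolding visits_def[abs_def] by (induction r) auto
  then have "visits \<alpha> z r -` {n. P n} \<inter> space borel \<in> sets borel" by (rule measurable_sets) simp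
  then have "visits \<alpha> z r -` {n. P n} \<inter> {0..<1} \<in> sets borel" by (simp add: sets.Int)
  moreover have "visits \<alpha> z r -` {n. P n} \<inter> {0..<1} = {x \<in> {0..<1}. P (visits \<alpha> z r x)}" by auto
  ultimately show ?thesis by simp
qed

lemma finite_visits_image: "finite (visits \<alpha> z r ` A)"
proof (rule finite_subset)
  have "visits \<alpha> z r x \<le> (\<Sum>j<r. 1)" for x
    unfolding visits_def by (intro sum_mono) (simp add: indicator_def)
  then show "visits \<alpha> z r ` A \<subseteq> {..r}" by auto
qed simp

text \<open>Koksma's argument: if \<open>j \<alpha>\<close> is replaced by \<open>j p / q\<close>, no point of the orbit moves by more than \<open>1 / q\<close>.\<close>

lemma card_orbit_bounds:
  fixes p :: int and q :: nat
  assumes q: "0 < q" and cop: "coprime p (int q)" and appr: "\<bar>real q * \<alpha> - of_int p\<bar> * real q < 1"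
    and z: "0 < z" "z < 1"
  shows "\<bar>real (card {j \<in> {..<q}. frac (x + real j * \<alpha>) < z}) - real q * z\<bar> \<le> 3"
proof -
  define a where "a = \<lfloor>real q * x\<rfloor>"
  define \<theta> where "\<theta> = real q * \<alpha> - of_int p"
  \<comment> \<open>The approximate position of the j-th orbit point on the grid of mesh 1 / q;
    coprimality makes this a bijection onto the residues.\<close>
  define \<phi> where "\<phi> = (\<lambda>j::nat. (a + int j * p) mod int q)"
  define V where "V = {j \<in> {..<q}. frac (x + real j * \<alpha>) < z}"
  have inj: "inj_on \<phi> {..<q}"
  proof (rule inj_onI)
    fix i j assume ij: "i \<in> {..<q}" "j \<in> {..<q}" "\<phi> i = \<phi> j"
    then have "int q dvd (a + int i * p) - (a + int j * p)"
      unfolding \<phi>_def by (simp add: mod_eq_dvd_iff)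
    then have "int q dvd (int i - int j) * p" by (simp add: algebra_simps)
    then have "int q dvd int i - int j" using cop
      by (simp add: coprime_dvd_mult_left_iff coprime_commute)
    moreover have "\<bar>int i - int j\<bar> < int q" using ij by auto
    ultimately show "i = j" using zdvd_imp_le[of "int q" "\<bar>int i - int j\<bar>"] by fastforce
  qed
  have im: "\<phi> ` {..<q} = {0..<int q}"
  proof (rule card_subset_eq)
    show "\<phi> ` {..<q} \<subseteq> {0..<int q}" using q by (auto simp: \<phi>_def)
    show "card (\<phi> ` {..<q}) = card {0..<int q}" using card_image[OF inj] by simp
  qed simp
  \<comment> \<open>The deviation, in units of 1 / q, is the fractional part of q x plus an
    accumulated approximation error in (-1, 1).\<close>
  have key: "\<exists>k::int. \<exists>\<epsilon>. real q * (x + real j * \<alpha>) = of_int (\<phi> j) + real q * of_int k + \<epsilon> \<and> - 1 < \<epsilon> \<and> \<epsilon> < 2"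
    if "j < q" for j
  proof (intro exI conjI)
    let ?k = "(a + int j * p) div int q" and ?\<epsilon> = "frac (real q * x) + real j * \<theta>"
    have "a + int j * p = \<phi> j + int q * ?k" unfolding \<phi>_def by simp
    then have "real_of_int a + real j * of_int p = of_int (\<phi> j) + real q * of_int ?k"
      by (metis of_int_add of_int_mult of_int_of_nat_eq)
    then show "real q * (x + real j * \<alpha>) = of_int (\<phi> j) + real q * of_int ?k + ?\<epsilon>"
      unfolding frac_def a_def \<theta>_def by (simp add: algebra_simps)
    have "\<bar>real j * \<theta>\<bar> \<le> \<bar>\<theta>\<bar> * real q" using that by (simp add: abs_mult mult.commute mult_left_mono)
    then have "\<bar>real j * \<theta>\<bar> < 1" using appr unfolding \<theta>_def by linarith
    then show "- 1 < ?\<epsilon>" "?\<epsilon> < 2" using frac_ge_0[of "real q * x"] frac_lt_1[of "real q * x"] by linarith+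
  qed
  have qz: "real q * z < real q" using q z by simp
  \<comment> \<open>The extra residue q - 1 arises when the positive deviation carries a point past
    the end of the circle.\<close>
  have "\<phi> ` V \<subseteq> {0..\<lceil>real q * z\<rceil>} \<union> {int q - 1}"
  proof
    fix i assume "i \<in> \<phi> ` V"
    then obtain j where j: "j < q" "frac (x + real j * \<alpha>) < z" "i = \<phi> j" unfolding V_def by auto
    obtain k \<epsilon> where k: "real q * (x + real j * \<alpha>) = of_int i + real q * of_int k + \<epsilon>" "- 1 < \<epsilon>" "\<epsilon> < 2"
      using key[OF j(1)] j(3) by blast
    define f where "f = frac (x + real j * \<alpha>)"
    define n where "n = \<lfloor>x + real j * \<alpha>\<rfloor> - k"
    have f: "0 \<le> f" "f < z" using j(2) by (auto simp: f_def)
    have i: "0 \<le> i" "i < int q" using im j(1,3) by auto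
    have "x + real j * \<alpha> = of_int \<lfloor>x + real j * \<alpha>\<rfloor> + f" unfolding f_def frac_def by simp
    then have "real q * (x + real j * \<alpha>) = real q * (of_int \<lfloor>x + real j * \<alpha>\<rfloor> + f)" by simp
    then have eq: "of_int i + \<epsilon> = real q * f + real q * of_int n"
      using k(1) unfolding n_def by (simp add: algebra_simps)
    have qf: "0 \<le> real q * f" "real q * f < real q * z" using f q by auto
    have "- 1 < real q * z + real q * of_int n" using eq k(2) i qf by linarith
    consider "n \<le> - 1" | "n = 0" | "n \<ge> 1" by linarith
    then show "i \<in> {0..\<lceil>real q * z\<rceil>} \<union> {int q - 1}"
    proof cases
      case 1
      then have "real q * of_int n \<le> real q * (- 1)" using q by (intro mult_left_mono) auto
      then have "of_int i < (1 :: real)" using eq k(2) qf qz by linarith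
      then have "i = 0" using i by linarith
      moreover have "0 \<le> \<lceil>real q * z\<rceil>" using qf by linarith
      ultimately show ?thesis by simp
    next
      case 2
      then have "of_int i < real q * z + 1" using eq k(2) qf by simp
      then have "i \<le> \<lceil>real q * z\<rceil>" by linarith
      then show ?thesis using i by simp
    next
      case 3
      then have "real q * 1 \<le> real q * of_int n" using q by (intro mult_left_mono) auto
      then have "real q - 2 < of_int i" using eq k(3) qf by linarith
      then show ?thesis using i by auto
    qed
  qed
  then have "card (\<phi> ` V) \<le> card ({0..\<lceil>real q * z\<rceil>} \<union> {int q - 1})" by (intro card_mono) auto
  also have "\<dots> \<le> nat (\<lceil>real q * z\<rceil> + 1) + 1" by (rule order_trans[OF card_Un_le]) simp
  finally have "real (card (\<phi> ` V)) \<le> real (nat (\<lceil>real q * z\<rceil> + 1) + 1)" by (rule of_nat_mono)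
  also have "\<dots> \<le> real q * z + 3"
  proof -
    have "0 \<le> real q * z" using z by simp
    then have "real (nat (\<lceil>real q * z\<rceil> + 1)) = of_int (\<lceil>real q * z\<rceil> + 1)" by (intro of_nat_nat) linarith
    then show ?thesis by simp linarith
  qed
  finally have up: "real (card (\<phi> ` V)) \<le> real q * z + 3" .
  \<comment> \<open>These residues are far enough from both ends of the interval to be visits
    whatever the deviation is.\<close>
  have "{1..\<lfloor>real q * z\<rfloor> - 2} \<subseteq> \<phi> ` V"
  proof
    fix i assume i: "i \<in> {1..\<lfloor>real q * z\<rfloor> - 2}"
    have "of_int i \<le> real q * z - 2" using i by (simp add: le_floor_iff) linarith
    then have "i < int q" using qz by linarith
    then have "i \<in> \<phi> ` {..<q}" unfolding im using i by simp
    then obtain j where j: "j < q" "i = \<phi> j" by auto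
    obtain k \<epsilon> where k: "real q * (x + real j * \<alpha>) = of_int i + real q * of_int k + \<epsilon>" "- 1 < \<epsilon>" "\<epsilon> < 2"
      using key[OF j(1)] j(2) by blast
    have "0 < of_int i + \<epsilon>" "of_int i + \<epsilon> < real q * z" using i k \<open>of_int i \<le> real q * z - 2\<close> by auto
    then have b: "0 < (of_int i + \<epsilon>) / real q" "(of_int i + \<epsilon>) / real q < z"
      using q by (auto simp: field_simps)
    have "x + real j * \<alpha> = of_int k + (of_int i + \<epsilon>) / real q" using k(1) q by (simp add: field_simps)
    then have "frac (x + real j * \<alpha>) = (of_int i + \<epsilon>) / real q"
      unfolding frac_unique_iff using b z by simp
    then have "j \<in> V" unfolding V_def using j b by simp
    then show "i \<in> \<phi> ` V" using j by blast
  qed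
  then have "card {1..\<lfloor>real q * z\<rfloor> - 2} \<le> card (\<phi> ` V)" by (intro card_mono) (auto simp: V_def)
  then have "nat (\<lfloor>real q * z\<rfloor> - 2) \<le> card (\<phi> ` V)" by simp
  then have "real q * z - 3 \<le> real (card (\<phi> ` V))" by linarith
  moreover have "card (\<phi> ` V) = card V"
    by (rule card_image, rule inj_on_subset[OF inj]) (auto simp: V_def)
  ultimately show ?thesis using up unfolding V_def by linarith
qed

context irrational_rotation
begin

text \<open>The orbit splits into p blocks of length q_v, and Koksma's bound 3 applies to each
  block.\<close>

lemma visits_multiple_denom_bounds:
  assumes z: "0 < z" "z < 1" and x: "x \<in> {0..<1}"
  shows "\<bar>real (visits \<alpha> z (p * q v) x) - real p * (real (q v) * z)\<bar> \<le> 3 * real p"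
proof -
  have base: "\<bar>real (visits \<alpha> z (q v) y) - real (q v) * z\<bar> \<le> 3" if "y \<in> {0..<1}" for y
  proof -
    have "\<bar>\<theta> v\<bar> * real (q (Suc v)) < 1"
      using abs_err_less_inverse[of v] denom_pos[of "Suc v"] by (simp add: field_simps del: cf_denom.simps)
    moreover have "\<bar>\<theta> v\<bar> * real (q v) \<le> \<bar>\<theta> v\<bar> * real (q (Suc v))"
      using denom_le_Suc[of v] by (intro mult_left_mono) (auto simp del: cf_denom.simps)
    ultimately have "\<bar>\<theta> v\<bar> * real (q v) < 1" by linarith
    then show ?thesis unfolding visits_eq_card[OF that]
      by (intro card_orbit_bounds[OF denom_pos coprime_convergent _ z]) (simp add: cf_err_def)
  qed
  have mem: "(rot \<alpha> ^^ j) x \<in> {0..<1}" for j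
    unfolding rot_funpow[OF x] by (simp add: frac_lt_1)
  have "real (visits \<alpha> z (p * q v) x) - real p * (real (q v) * z)
      = (\<Sum>i<p. real (visits \<alpha> z (q v) ((rot \<alpha> ^^ (i * q v)) x)) - real (q v) * z)"
    unfolding visits_mult by (simp add: sum_subtractf)
  also have "\<bar>\<dots>\<bar> \<le> (\<Sum>i<p. 3)"
    by (rule order_trans[OF sum_abs sum_mono]) (rule base[OF mem])
  finally show ?thesis by simp
qed

lemma circle_dist_rot_le:
  assumes x: "x \<in> {0..<1}" and b: "real L * \<alpha> - of_int P = \<delta>"
  shows "0 \<le> circle_dist ((rot \<alpha> ^^ L) x) x" "circle_dist ((rot \<alpha> ^^ L) x) x \<le> \<bar>\<delta>\<bar>"
proof -
  define y where "y = frac (x + real L * \<alpha>)"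
  have y: "0 \<le> y" "y < 1" by (auto simp: y_def frac_lt_1)
  have e: "(rot \<alpha> ^^ L) x = y" unfolding rot_funpow[OF x] y_def ..
  show "0 \<le> circle_dist ((rot \<alpha> ^^ L) x) x" unfolding e circle_dist_def using x y by auto
  define n where "n = P - \<lfloor>x + real L * \<alpha>\<rfloor>"
  have "y = x + real L * \<alpha> - of_int \<lfloor>x + real L * \<alpha>\<rfloor>" unfolding y_def frac_def ..
  then have n: "y - x = \<delta> + of_int n" using b unfolding n_def by simp
  show "circle_dist ((rot \<alpha> ^^ L) x) x \<le> \<bar>\<delta>\<bar>"
  proof (cases "n = 0")
    case True
    then show ?thesis unfolding e circle_dist_def using n by simp
  next
    case False
    then have "1 \<le> \<bar>of_int n :: real\<bar>" by linarith
    then have "1 - \<bar>y - x\<bar> \<le> \<bar>\<delta>\<bar>" unfolding n by linarith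
    then show ?thesis unfolding e circle_dist_def by simp
  qed
qed

lemma integral_circle_dist_le:
  assumes "real L * \<alpha> - of_int P = \<delta>"
  shows "\<bar>LBINT x:{0..<1}. circle_dist ((rot \<alpha> ^^ L) x) x\<bar> \<le> \<bar>\<delta>\<bar>"
proof -
  have i: "set_integrable lborel {0..<1} (\<lambda>x::real. \<bar>\<delta>\<bar>)"
    unfolding set_integrable_def by (simp add: integrable_indicator_iff emeasure_lborel_Ico)
  note c = circle_dist_rot_le[OF _ assms]
  have m: "set_borel_measurable lborel {0..<1} (\<lambda>x. circle_dist ((rot \<alpha> ^^ L) x) x)"
    unfolding set_borel_measurable_def circle_dist_def by measurable
  have i2: "set_integrable lborel {0..<1} (\<lambda>x. circle_dist ((rot \<alpha> ^^ L) x) x)"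
    by (rule set_integrable_bound[OF i m]) (use c in \<open>auto simp: abs_of_nonneg\<close>)
  have "(LBINT x:{0..<1}. circle_dist ((rot \<alpha> ^^ L) x) x) \<le> (LBINT x:{0..<1::real}. \<bar>\<delta>\<bar>)"
    by (rule set_integral_mono[OF i2 i]) (use c in auto)
  also have "\<dots> = \<bar>\<delta>\<bar>" by (simp add: set_integral_const)
  finally have "(LBINT x:{0..<1}. circle_dist ((rot \<alpha> ^^ L) x) x) \<le> \<bar>\<delta>\<bar>" .
  moreover have "0 \<le> (LBINT x:{0..<1}. circle_dist ((rot \<alpha> ^^ L) x) x)"
    unfolding set_lebesgue_integral_def
    by (rule Bochner_Integration.integral_nonneg) (use c in \<open>auto simp: indicator_def\<close>)
  ultimately show ?thesis by simp
qed

end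

section \<open>The distribution of the visit counts and the scales for (A5)\<close>

definition visits_cdf :: "real \<Rightarrow> real \<Rightarrow> nat \<Rightarrow> nat \<Rightarrow> real" where
  "visits_cdf \<alpha> z L u = measure lborel {x \<in> {0..<1}. visits \<alpha> z L x < u}"

text \<open>The ratio of consecutive scales is so small that the windows in \<open>bad_scale\<close> are disjoint.\<close>

definition scale :: "real \<Rightarrow> nat \<Rightarrow> real" where
  "scale \<eta> j = (\<eta> / 3) ^ j / 4"

text \<open>If no value of the distribution function lies in the window, the function jumps across
  it in one step, and the visit count at the jump serves as u in (A5).\<close>

definition bad_scale :: "real \<Rightarrow> real \<Rightarrow> real \<Rightarrow> nat \<Rightarrow> nat \<Rightarrow> bool" where
  "bad_scale \<alpha> z \<eta> L j \<longleftrightarrow>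
     (\<exists>u. \<eta> * scale \<eta> j \<le> visits_cdf \<alpha> z L u \<and> visits_cdf \<alpha> z L u \<le> 2 * scale \<eta> j)"

lemma emeasure_subset_unit_interval_finite: "A \<subseteq> {0..<1::real} \<Longrightarrow> emeasure lborel A \<noteq> \<infinity>"
  using emeasure_mono[of A "{0..<1}" lborel] by (auto simp: emeasure_lborel_Ico top_unique)

lemma visits_cdf_Suc:
  "visits_cdf \<alpha> z L (Suc u) = visits_cdf \<alpha> z L u + measure lborel {x \<in> {0..<1}. visits \<alpha> z L x = u}"
proof -
  have "{x \<in> {0..<1}. visits \<alpha> z L x < Suc u}
      = {x \<in> {0..<1}. visits \<alpha> z L x < u} \<union> {x \<in> {0..<1}. visits \<alpha> z L x = u}" by auto
  moreover have "measure lborel ({x \<in> {0..<1}. visits \<alpha> z L x < u} \<union> {x \<in> {0..<1}. visits \<alpha> z L x = u})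
      = measure lborel {x \<in> {0..<1}. visits \<alpha> z L x < u} + measure lborel {x \<in> {0..<1}. visits \<alpha> z L x = u}"
  proof (rule measure_Union)
    show "emeasure lborel {x \<in> {0..<1}. visits \<alpha> z L x < u} \<noteq> \<infinity>"
      "emeasure lborel {x \<in> {0..<1}. visits \<alpha> z L x = u} \<noteq> \<infinity>"
      by (rule emeasure_subset_unit_interval_finite, blast)+
    show "{x \<in> {0..<1}. visits \<alpha> z L x < u} \<in> sets lborel"
      by (rule visits_measurable[where P = "\<lambda>n. n < u"])
    show "{x \<in> {0..<1}. visits \<alpha> z L x = u} \<in> sets lborel"
      by (rule visits_measurable[where P = "\<lambda>n. n = u"])
  qed auto
  ultimately show ?thesis unfolding visits_cdf_def by simp
qed

lemma scale_pos: "0 < \<eta> \<Longrightarrow> 0 < scale \<eta> j"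
  by (simp add: scale_def)

lemma scale_less:
  assumes "0 < \<eta>" "\<eta> < 1" "i < j" shows "2 * scale \<eta> j < \<eta> * scale \<eta> i"
proof -
  have "(\<eta> / 3) ^ j \<le> (\<eta> / 3) ^ Suc i" using assms by (intro power_decreasing) auto
  moreover have "2 * (\<eta> / 3) * (\<eta> / 3) ^ i < \<eta> * (\<eta> / 3) ^ i" using assms by (intro mult_strict_right_mono) auto
  ultimately show ?thesis unfolding scale_def by simp
qed

lemma scale_le: "0 < \<eta> \<Longrightarrow> \<eta> < 1 \<Longrightarrow> scale \<eta> j \<le> 1 / 4"
  unfolding scale_def by (simp add: power_le_one)

lemma visits_cdf_trivial:
  shows "u \<le> Min (visits \<alpha> z L ` {0..<1}) \<Longrightarrow> visits_cdf \<alpha> z L u = 0"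
    and "Max (visits \<alpha> z L ` {0..<1}) < u \<Longrightarrow> visits_cdf \<alpha> z L u = 1"
proof -
  have b: "Min (visits \<alpha> z L ` {0..<1}) \<le> visits \<alpha> z L x" "visits \<alpha> z L x \<le> Max (visits \<alpha> z L ` {0..<1})"
    if "x \<in> {0..<1}" for x
    using that by (auto intro!: Min_le Max_ge finite_visits_image)
  show "visits_cdf \<alpha> z L u = 0" if u: "u \<le> Min (visits \<alpha> z L ` {0..<1})"
  proof -
    have "u \<le> visits \<alpha> z L x" if "x \<in> {0..<1}" for x using order_trans[OF u b(1)[OF that]] .
    then have "{x \<in> {0..<1}. visits \<alpha> z L x < u} = {}" by (blast dest: leD)
    then show ?thesis unfolding visits_cdf_def by (simp only: measure_empty)
  qed
  show "visits_cdf \<alpha> z L u = 1" if u: "Max (visits \<alpha> z L ` {0..<1}) < u"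
  proof -
    have "visits \<alpha> z L x < u" if "x \<in> {0..<1}" for x using le_less_trans[OF b(2)[OF that] u] .
    then have "{x \<in> {0..<1}. visits \<alpha> z L x < u} = {0..<1}" by blast
    then show ?thesis unfolding visits_cdf_def by simp
  qed
qed

text \<open>Disjoint windows force distinct witnesses u for distinct bad scales. A witness lies
  above the minimum and not above the maximum of the visit counts, since there the distribution
  function is neither 0 nor 1.\<close>

lemma card_bad_scales:
  assumes \<eta>: "0 < \<eta>" "\<eta> < 1"
  shows "card {j \<in> {..<m}. bad_scale \<alpha> z \<eta> L j} \<le> Max (visits \<alpha> z L ` {0..<1}) - Min (visits \<alpha> z L ` {0..<1})"
proof -
  let ?J = "{j \<in> {..<m}. bad_scale \<alpha> z \<eta> L j}"
  let ?lo = "Min (visits \<alpha> z L ` {0..<1})" and ?hi = "Max (visits \<alpha> z L ` {0..<1})"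
  have "\<forall>j\<in>?J. \<exists>u. \<eta> * scale \<eta> j \<le> visits_cdf \<alpha> z L u \<and> visits_cdf \<alpha> z L u \<le> 2 * scale \<eta> j"
    by (auto simp: bad_scale_def)
  from bchoice[OF this] obtain u
    where u: "\<And>j. j \<in> ?J \<Longrightarrow> \<eta> * scale \<eta> j \<le> visits_cdf \<alpha> z L (u j) \<and> visits_cdf \<alpha> z L (u j) \<le> 2 * scale \<eta> j"
    by blast
  have neq: "u i \<noteq> u j" if "i \<in> ?J" "j \<in> ?J" "i < j" for i j
    using u[OF that(1)] u[OF that(2)] scale_less[OF \<eta> that(3)] by (intro notI) simp
  have "inj_on u ?J"
    by (rule inj_onI) (metis neq linorder_neqE_nat)
  moreover have "u ` ?J \<subseteq> {?lo<..?hi}"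
  proof
    fix v assume "v \<in> u ` ?J"
    then obtain j where j: "j \<in> ?J" "v = u j" by blast
    \<comment> \<open>The factor 1/4 in \<open>scale\<close> keeps the whole window strictly below
      1.\<close>
    have p: "0 < \<eta> * scale \<eta> j" "2 * scale \<eta> j < 1"
      using scale_pos[of \<eta> j] scale_le[OF \<eta>, of j] \<eta> by auto
    then have F: "0 < visits_cdf \<alpha> z L v" "visits_cdf \<alpha> z L v < 1" using u[OF j(1)] unfolding j(2) by linarith+
    have "?lo < v" using visits_cdf_trivial(1)[of v \<alpha> z L] F(1) by (cases "?lo < v") auto
    moreover have "v \<le> ?hi" using visits_cdf_trivial(2)[of \<alpha> z L v] F(2) by (cases "v \<le> ?hi") auto
    ultimately show "v \<in> {?lo<..?hi}" by simp
  qed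
  ultimately have "card ?J \<le> card {?lo<..?hi}" using card_inj_on_le by blast
  then show ?thesis by simp
qed

lemma good_scale_level:
  assumes \<eta>: "0 < \<eta>" "\<eta> < 1" and good: "\<not> bad_scale \<alpha> z \<eta> L j"
  shows "\<exists>u. scale \<eta> j < measure lborel {x \<in> {0..<1}. visits \<alpha> z L x = u} \<and>
    measure lborel {x \<in> {0..<1}. visits \<alpha> z L x < u} < \<eta> * scale \<eta> j"
proof -
  let ?P = "\<lambda>u. \<eta> * scale \<eta> j \<le> visits_cdf \<alpha> z L u"
  have sc: "0 < scale \<eta> j" "scale \<eta> j \<le> 1 / 4" using scale_pos[OF \<eta>(1)] scale_le[OF \<eta>] by auto
  have "\<eta> * scale \<eta> j \<le> 1 * scale \<eta> j" using \<eta> sc by (intro mult_right_mono) auto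
  then have "?P (Suc (Max (visits \<alpha> z L ` {0..<1})))"
    unfolding visits_cdf_trivial(2)[OF lessI] using sc by linarith
  moreover have "0 < \<eta> * scale \<eta> j" using \<eta> sc by simp
  then have "\<not> ?P 0" using visits_cdf_trivial(1)[of 0 \<alpha> z L] by simp
  ultimately obtain u where u: "\<not> ?P u" "?P (Suc u)"
    using ex_least_nat_less[of ?P] by blast
  \<comment> \<open>The jump at u exceeds 2 - \<eta> times the scale, hence the scale itself; this
    is why the window reaches up to twice the scale.\<close>
  have "2 * scale \<eta> j < visits_cdf \<alpha> z L (Suc u)" using good u(2) unfolding bad_scale_def by (meson not_le)
  moreover have "\<eta> * scale \<eta> j < scale \<eta> j" using \<eta> sc by simp
  ultimately show ?thesis using u(1) unfolding visits_cdf_Suc by (intro exI[of _ u]) (simp add: visits_cdf_def)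
qed

section \<open>Convergents at thick times\<close>

lemma card_le_of_diameter:
  fixes S :: "nat set"
  assumes "\<And>i j. i \<in> S \<Longrightarrow> j \<in> S \<Longrightarrow> j \<le> i + K"
  shows "card S \<le> K + 1"
proof (cases "S = {}")
  case False
  then obtain i where i: "i \<in> S" "\<And>j. j \<in> S \<Longrightarrow> i \<le> j"
    using LeastI_ex[of "\<lambda>i. i \<in> S"] Least_le[of "\<lambda>i. i \<in> S"] by blast
  then have "S \<subseteq> {i..i + K}" using assms by auto
  from card_mono[OF _ this] show ?thesis by simp
qed simp

lemma card_exp_window: "card {n::nat. A \<le> exp (real n) \<and> exp (real n) \<le> D * A} \<le> nat \<lfloor>ln D\<rfloor> + 1"
  if "0 < A" "0 < D" for A D :: real
proof (rule card_le_of_diameter)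
  fix i j assume "i \<in> {n::nat. A \<le> exp (real n) \<and> exp (real n) \<le> D * A}" "j \<in> {n::nat. A \<le> exp (real n) \<and> exp (real n) \<le> D * A}"
  then have "A \<le> exp (real i)" "exp (real j) \<le> D * A" by auto
  then have "exp (real j) \<le> D * exp (real i)" using that by (meson mult_left_mono less_imp_le order_trans)
  also have "\<dots> = exp (ln D + real i)" using that by (simp add: exp_add)
  finally have "real j \<le> ln D + real i" by simp
  then show "j \<le> i + nat \<lfloor>ln D\<rfloor>" by linarith
qed

section \<open>Thick times and the growth of the denominators\<close>

context irrational_rotation
begin

definition level :: "nat \<Rightarrow> nat" where
  "level n = cf_index \<alpha> (exp (real n))"

lemma level_bounds: "real (q (level n)) \<le> exp (real n)" "exp (real n) < real (q (Suc (level n)))"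
  unfolding level_def by (rule index_bounds, simp)+

lemma level_mono: "m \<le> n \<Longrightarrow> level m \<le> level n"
  unfolding level_def by (rule index_mono) auto

lemma level_unbounded: "filterlim level at_top sequentially"
  unfolding filterlim_at_top eventually_sequentially
proof
  fix k
  obtain n :: nat where n: "ln (real (q k)) \<le> real n" using real_arch_simple by blast
  have "real (q k) = exp (ln (real (q k)))" using denom_pos[of k] by simp
  also have "\<dots> \<le> exp (real n)" using n by simp
  finally have "k \<le> level n" unfolding level_def by (intro le_index) auto
  then show "\<exists>N. \<forall>n\<ge>N. k \<le> level n" using level_mono order_trans by blast
qed

text \<open>Thickness is tested on the lattice vector of the convergent p_v / q_v: one of its two
  components is at least e / 2, so exp n is comparable to q_v or to q_(v+1).\<close>

lemma thick_time_level:
  assumes "thick_time \<alpha> z e (real n)"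
  shows "e / 2 * exp (real n) \<le> real (q (level n)) \<or> e / 2 * real (q (Suc (level n))) \<le> exp (real n)"
proof -
  let ?v = "level n"
  have "int (q ?v) \<noteq> 0" using denom_pos[of ?v] by simp
  then have "e \<le> exp (real n) * \<bar>of_int (cf_num \<alpha> ?v) - of_int (int (q ?v)) * \<alpha>\<bar> + exp (- real n) * \<bar>of_int (int (q ?v))\<bar>"
    using assms unfolding thick_time_def by blast
  also have "\<bar>of_int (cf_num \<alpha> ?v) - of_int (int (q ?v)) * \<alpha>\<bar> = \<bar>\<theta> ?v\<bar>"
    unfolding cf_err_def by (simp add: abs_minus_commute)
  finally have "e \<le> exp (real n) * \<bar>\<theta> ?v\<bar> + exp (- real n) * real (q ?v)" by simp
  then consider "e / 2 \<le> exp (real n) * \<bar>\<theta> ?v\<bar>" | "e / 2 \<le> exp (- real n) * real (q ?v)" by linarith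
  then show ?thesis
  proof cases
    case 1
    also have "exp (real n) * \<bar>\<theta> ?v\<bar> \<le> exp (real n) * (1 / real (q (Suc ?v)))"
      using abs_err_less_inverse[of ?v] by (intro mult_left_mono) auto
    finally show ?thesis using denom_pos[of "Suc ?v"] by (simp add: field_simps del: cf_denom.simps)
  next
    case 2
    then have "e / 2 * exp (real n) \<le> exp (- real n) * real (q ?v) * exp (real n)" by (intro mult_right_mono) auto
    also have "\<dots> = real (q ?v)" by (simp add: exp_minus field_simps)
    finally show ?thesis by simp
  qed
qed

text \<open>However long the gap between two denominators is, thick times occur only near its two
  ends. This turns a count of levels into a count of thick times.\<close>

lemma thick_times_per_level:
  assumes e: "0 < e"
  shows "finite {n. thick_time \<alpha> z e (real n) \<and> level n = v}" (is "finite ?S")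
    and "card {n. thick_time \<alpha> z e (real n) \<and> level n = v} \<le> 2 * (nat \<lfloor>ln (2 / e)\<rfloor> + 1)"
proof -
  let ?W = "\<lambda>A. {n::nat. A \<le> exp (real n) \<and> exp (real n) \<le> 2 / e * A}"
  have sub: "?S \<subseteq> ?W (real (q v)) \<union> ?W (e / 2 * real (q (Suc v)))"
  proof
    fix n assume n: "n \<in> ?S"
    then have b: "real (q v) \<le> exp (real n)" "exp (real n) < real (q (Suc v))" using level_bounds[of n] by auto
    from n have "e / 2 * exp (real n) \<le> real (q v) \<or> e / 2 * real (q (Suc v)) \<le> exp (real n)"
      using thick_time_level[of z e n] by auto
    then show "n \<in> ?W (real (q v)) \<union> ?W (e / 2 * real (q (Suc v)))"
      using b e by (auto simp: field_simps simp del: cf_denom.simps)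
  qed
  have fin: "finite (?W A)" for A
  proof -
    obtain k :: nat where k: "2 / e * A < real k" using reals_Archimedean2 by blast
    have "?W A \<subseteq> {..k}"
    proof
      fix n assume "n \<in> ?W A"
      then have "exp (real n) \<le> 2 / e * A" by blast
      then have "real n < real k" using k exp_ge_add_one_self[of "real n"] by linarith
      then show "n \<in> {..k}" by simp
    qed
    then show ?thesis by (rule finite_subset) simp
  qed
  show "finite ?S" using sub fin by (meson finite_Un finite_subset)
  have "card ?S \<le> card (?W (real (q v)) \<union> ?W (e / 2 * real (q (Suc v))))"
    using sub finite_UnI[OF fin fin] by (rule card_mono[rotated])
  also have "\<dots> \<le> card (?W (real (q v))) + card (?W (e / 2 * real (q (Suc v))))" by (rule card_Un_le)
  also have "\<dots> \<le> (nat \<lfloor>ln (2 / e)\<rfloor> + 1) + (nat \<lfloor>ln (2 / e)\<rfloor> + 1)"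
    using e denom_pos[of v] denom_pos[of "Suc v"] by (intro add_mono card_exp_window) (auto simp del: cf_denom.simps)
  finally show "card ?S \<le> 2 * (nat \<lfloor>ln (2 / e)\<rfloor> + 1)" by simp
qed

text \<open>The increment over r steps splits into r increments over one step, and each of the r
  resulting sums telescopes.\<close>

lemma sum_log_ratio_le:
  "(\<Sum>v<m. ln (real (q (v + r))) - ln (real (q v))) \<le> real r * ln (real (q (m + r)))"
proof (induction r)
  case (Suc r)
  have ln_mono: "ln (real (q i)) \<le> ln (real (q j))" if "i \<le> j" for i j
    using denom_mono[OF that] denom_pos by simp
  have "(\<Sum>v<m. ln (real (q (v + Suc r))) - ln (real (q v)))
      = (\<Sum>v<m. ln (real (q (Suc v + r))) - ln (real (q (v + r)))) + (\<Sum>v<m. ln (real (q (v + r))) - ln (real (q v)))"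
    by (simp add: sum.distrib[symmetric] del: cf_denom.simps)
  also have "(\<Sum>v<m. ln (real (q (Suc v + r))) - ln (real (q (v + r)))) = ln (real (q (m + r))) - ln (real (q (0 + r)))"
    by (rule sum_lessThan_telescope)
  also have "\<dots> \<le> ln (real (q (m + Suc r)))"
  proof -
    have "0 \<le> ln (real (q (0 + r)))" using denom_pos[of r] by (simp add: Suc_le_eq)
    then show ?thesis using ln_mono[of "m + r" "m + Suc r"] by simp
  qed
  finally have "(\<Sum>v<m. ln (real (q (v + Suc r))) - ln (real (q v)))
      \<le> ln (real (q (m + Suc r))) + real r * ln (real (q (m + r)))" using Suc by linarith
  also have "real r * ln (real (q (m + r))) \<le> real r * ln (real (q (m + Suc r)))"
    by (intro mult_left_mono ln_mono) auto
  finally show ?case by (simp add: algebra_simps del: cf_denom.simps)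
qed simp

text \<open>Markov's inequality for the summands of \<open>sum_log_ratio_le\<close>.\<close>

lemma card_large_ratio:
  assumes E: "1 < E"
  shows "real (card {v. v \<le> level N \<and> E * real (q v) < real (q (v + r))}) \<le> real r / ln E * real N + (real r + 1)"
proof -
  \<comment> \<open>Stopping r levels early keeps q_(v+r) below exp N; at most r + 1 levels are left
    out.\<close>
  define m where "m = level N - r"
  let ?A = "{v. v < m \<and> E * real (q v) < real (q (v + r))}"
  have lnE: "0 < ln E" using E by simp
  have dpos: "0 < real (q i)" for i using denom_pos[of i] by simp
  have "real (card ?A) * ln E = (\<Sum>v\<in>?A. ln E)" by simp
  also have "\<dots> \<le> (\<Sum>v\<in>?A. ln (real (q (v + r))) - ln (real (q v)))"
  proof (rule sum_mono)
    fix v assume "v \<in> ?A"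
    then have "ln (E * real (q v)) \<le> ln (real (q (v + r)))" using dpos E by auto
    then show "ln E \<le> ln (real (q (v + r))) - ln (real (q v))" using E dpos[of v] by (simp add: ln_mult_pos)
  qed
  also have "\<dots> \<le> (\<Sum>v<m. ln (real (q (v + r))) - ln (real (q v)))"
    using denom_mono dpos by (intro sum_mono2) auto
  also have "\<dots> \<le> real r * real N"
  proof (cases "m = 0")
    case False
    then have "m + r = level N" unfolding m_def by simp
    have "(\<Sum>v<m. ln (real (q (v + r))) - ln (real (q v))) \<le> real r * ln (real (q (level N)))"
      using sum_log_ratio_le[of r m] \<open>m + r = level N\<close> by simp
    also have "ln (real (q (level N))) \<le> ln (exp (real N))"
      using level_bounds(1)[of N] dpos[of "level N"] by (subst ln_le_cancel_iff) auto
    finally show ?thesis by (simp add: mult_left_mono)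
  qed simp
  finally have A: "real (card ?A) \<le> real r / ln E * real N" using lnE by (simp add: field_simps)
  have "{v. v \<le> level N \<and> E * real (q v) < real (q (v + r))} \<subseteq> ?A \<union> {m..level N}" by auto
  then have "card {v. v \<le> level N \<and> E * real (q v) < real (q (v + r))} \<le> card (?A \<union> {m..level N})"
    by (intro card_mono) auto
  also have "\<dots> \<le> card ?A + card {m..level N}" by (rule card_Un_le)
  also have "card {m..level N} \<le> r + 1" unfolding m_def by simp
  finally show ?thesis using A by linarith
qed

lemma thick_large_ratio_count:
  assumes e: "0 < e" and \<epsilon>: "0 < \<epsilon>"
  shows "\<exists>E C. 1 < E \<and> (\<forall>N. real (card ({n. thick_time \<alpha> z e (real n) \<and> E * real (q (level n)) < real (q (level n + r))} \<inter> {..<N}))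
      \<le> \<epsilon> * real N + C)"
proof -
  define M where "M = 2 * (nat \<lfloor>ln (2 / e)\<rfloor> + 1)"
  \<comment> \<open>Chosen so that M r / ln E \<le> \<epsilon>; the summand 1 ensures E > 1 also for
    r = 0.\<close>
  define E where "E = exp (1 + real M * real r / \<epsilon>)"
  have lnE: "ln E = 1 + real M * real r / \<epsilon>" by (simp add: E_def)
  have t0: "0 \<le> real M * real r / \<epsilon>" using \<epsilon> by simp
  then have E: "1 < E" by (simp add: E_def)
  show ?thesis
  proof (rule exI[of _ E], rule exI[of _ "real M * (real r + 1)"], intro conjI allI)
    show "1 < E" by (rule E)
    fix N
    let ?V = "{v. v \<le> level N \<and> E * real (q v) < real (q (v + r))}"
    let ?S = "\<lambda>v. {n. thick_time \<alpha> z e (real n) \<and> level n = v}"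
    have fin: "finite ?V" by (rule finite_subset[of _ "{..level N}"]) auto
    have "{n. thick_time \<alpha> z e (real n) \<and> E * real (q (level n)) < real (q (level n + r))} \<inter> {..<N} \<subseteq> (\<Union>v\<in>?V. ?S v)"
      using level_mono[of _ N] by auto
    then have "card ({n. thick_time \<alpha> z e (real n) \<and> E * real (q (level n)) < real (q (level n + r))} \<inter> {..<N}) \<le> card (\<Union>v\<in>?V. ?S v)"
      using fin thick_times_per_level(1)[OF e] by (intro card_mono) auto
    also have "\<dots> \<le> (\<Sum>v\<in>?V. card (?S v))" by (rule card_UN_le[OF fin])
    also have "\<dots> \<le> card ?V * M" using thick_times_per_level(2)[OF e] sum_bounded_above[of ?V "\<lambda>v. card (?S v)" M] unfolding M_def by simp
    finally have "real (card ({n. thick_time \<alpha> z e (real n) \<and> E * real (q (level n)) < real (q (level n + r))} \<inter> {..<N})) \<le> real (card ?V * M)" by (rule of_nat_mono)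
    also have "\<dots> = real M * real (card ?V)" by simp
    also have "\<dots> \<le> real M * (real r / ln E * real N + (real r + 1))"
      by (intro mult_left_mono card_large_ratio[OF E]) simp
    also have "\<dots> = real M * real r / ln E * real N + real M * (real r + 1)" by (simp add: algebra_simps)
    also have "real M * real r / ln E * real N \<le> \<epsilon> * real N"
    proof (rule mult_right_mono)
      have "real M * real r \<le> \<epsilon> * ln E" unfolding lnE using \<epsilon> by (simp add: field_simps)
      then show "real M * real r / ln E \<le> \<epsilon>" using lnE t0 by (simp add: field_simps)
    qed simp
    finally show "real (card ({n. thick_time \<alpha> z e (real n) \<and> E * real (q (level n)) < real (q (level n + r))} \<inter> {..<N}))
        \<le> \<epsilon> * real N + real M * (real r + 1)" by simp
  qed
qed

end

section \<open>The length attached to a time\<close>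

lemma le_twice_floor: "y \<le> 2 * real (nat \<lfloor>y\<rfloor>)" if "1 \<le> y" for y :: real
proof -
  have "1 \<le> \<lfloor>y\<rfloor>" using that by simp
  then have "real (nat \<lfloor>y\<rfloor>) = of_int \<lfloor>y\<rfloor>" "1 \<le> real_of_int \<lfloor>y\<rfloor>" by simp_all
  then show ?thesis by linarith
qed

context irrational_rotation
begin

text \<open>The factor \<open>8\<close> keeps the multiplier below a quarter of the next digit, as (A9) requires.\<close>

definition multiplier :: "nat \<Rightarrow> nat" where
  "multiplier s = (if exp (real s) \<le> 8 * real (q (level s)) then 1
     else nat \<lfloor>exp (real s) / (8 * real (q (level s)))\<rfloor>)"

definition len :: "nat \<Rightarrow> nat" where
  "len s = multiplier s * q (level s)"

text \<open>How far exp s has advanced into the gap after q_v, rounded down so that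
  \<open>density_tail\<close> applies. It dominates the multiplier and so controls (A6), (A8) and
  the number of bad scales.\<close>

definition depth :: "nat \<Rightarrow> nat" where
  "depth s = nat \<lfloor>exp (real s) / real (q (level s))\<rfloor>"

lemma denom_real_pos: "0 < real (q k)"
  using denom_pos[of k] by simp

lemma multiplier_pos: "0 < multiplier s"
  unfolding multiplier_def using denom_real_pos[of "level s"] by (auto simp: field_simps)

lemma multiplier_le: "real (multiplier s) * real (q (level s)) \<le> exp (real s)"
proof (cases "exp (real s) \<le> 8 * real (q (level s))")
  case True
  then show ?thesis using level_bounds(1)[of s] by (simp add: multiplier_def)
next
  case False
  let ?y = "exp (real s) / (8 * real (q (level s)))"
  have "0 \<le> ?y" using denom_real_pos[of "level s"] by simp
  then have "real (multiplier s) \<le> ?y" using False unfolding multiplier_def by simp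
  then have "real (multiplier s) * real (q (level s)) \<le> ?y * real (q (level s))" by (intro mult_right_mono) auto
  also have "\<dots> \<le> exp (real s)" using denom_real_pos[of "level s"] by simp
  finally show ?thesis .
qed

lemma multiplier_le_depth: "multiplier s \<le> depth s"
  using multiplier_le[of s] denom_real_pos[of "level s"]
  unfolding depth_def by (simp add: le_nat_iff le_floor_iff field_simps)

lemma len_le: "real (len s) \<le> exp (real s)"
  using multiplier_le by (simp add: len_def)

text \<open>The 16 is the factor 8 in \<open>multiplier\<close> times the factor 2 lost by rounding
  down.\<close>

lemma len_ge: "exp (real s) \<le> 16 * real (len s)"
proof (cases "exp (real s) \<le> 8 * real (q (level s))")
  case True
  then show ?thesis unfolding len_def multiplier_def by simp
next
  case False
  let ?y = "exp (real s) / (8 * real (q (level s)))"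
  have "1 \<le> ?y" using denom_real_pos[of "level s"] False by (simp add: field_simps)
  then have "?y \<le> 2 * real (multiplier s)" using le_twice_floor False unfolding multiplier_def by simp
  then have "?y * (8 * real (q (level s))) \<le> 2 * real (multiplier s) * (8 * real (q (level s)))"
    by (intro mult_right_mono) auto
  then show ?thesis using denom_real_pos[of "level s"] by (simp add: len_def)
qed

text \<open>The witness is the level of s: exp s < (a_(v+1) + 1) q_v gives 8 p \<le> a_(v+1), and a
  multiplier from the second branch forces a_(v+1) > 7.\<close>

lemma len_admissible:
  "\<exists>v. q v \<le> len s \<and> len s < q (v + 1) \<and>
     (len s = q v \<or> a (v + 1) > 4 \<and> (\<exists>p. 0 < p \<and> p \<le> a (v + 1) div 4 \<and> len s = p * q v))"
proof (intro exI[of _ "level s"] conjI)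
  let ?v = "level s"
  show "q ?v \<le> len s" using multiplier_pos[of s] by (simp add: len_def)
  have "real (len s) < real (q (Suc ?v))" using len_le[of s] level_bounds(2)[of s] by linarith
  then show "len s < q (?v + 1)" by (simp del: cf_denom.simps)
  show "len s = q ?v \<or> a (?v + 1) > 4 \<and> (\<exists>p. 0 < p \<and> p \<le> a (?v + 1) div 4 \<and> len s = p * q ?v)"
  proof (cases "exp (real s) \<le> 8 * real (q ?v)")
    case True
    then show ?thesis by (simp add: len_def multiplier_def)
  next
    case False
    let ?y = "exp (real s) / (8 * real (q ?v))"
    have "real (q (Suc ?v)) \<le> real ((a (Suc ?v) + 1) * q ?v)" by (rule of_nat_mono) (rule denom_Suc_le)
    then have "exp (real s) < (real (a (Suc ?v)) + 1) * real (q ?v)" using level_bounds(2)[of s] by (simp add: algebra_simps)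
    then have y: "8 * ?y < real (a (Suc ?v)) + 1" using denom_real_pos[of ?v] by (simp add: field_simps)
    have y1: "1 < ?y" using denom_real_pos[of ?v] False by (simp add: field_simps)
    have "real (multiplier s) \<le> ?y" using y1 False unfolding multiplier_def by simp
    then have "8 * multiplier s < a (Suc ?v) + 1" using y by linarith
    moreover have "7 < real (a (Suc ?v))" using y y1 by linarith
    ultimately have "4 < a (Suc ?v)" "multiplier s \<le> a (Suc ?v) div 4" by linarith+
    then show ?thesis using multiplier_pos[of s] by (auto simp: len_def)
  qed
qed

lemma visits_len_range:
  assumes z: "0 < z" "z < 1"
  shows "Max (visits \<alpha> z (len s) ` {0..<1}) - Min (visits \<alpha> z (len s) ` {0..<1}) \<le> 6 * depth s"
proof -
  let ?V = "visits \<alpha> z (len s) ` {0..<1}"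
  have ne: "?V \<noteq> {}" by simp
  obtain x where x: "Max ?V = visits \<alpha> z (len s) x" "x \<in> {0..<1}"
    using Max_in[OF finite_visits_image ne] by (rule imageE)
  obtain y where y: "Min ?V = visits \<alpha> z (len s) y" "y \<in> {0..<1}"
    using Min_in[OF finite_visits_image ne] by (rule imageE)
  have "real (Max ?V) - real (Min ?V) \<le> 6 * real (multiplier s)"
    using visits_multiple_denom_bounds[OF z x(2), of "multiplier s" "level s"]
      visits_multiple_denom_bounds[OF z y(2), of "multiplier s" "level s"]
    unfolding x(1) y(1) unfolding len_def by linarith
  then show ?thesis using multiplier_le_depth[of s] by linarith
qed

lemma integral_circle_dist_len_le:
  "\<bar>LBINT x:{0..<1}. circle_dist ((rot \<alpha> ^^ len s) x) x\<bar> \<le> real (depth s) * \<bar>\<theta> (level s)\<bar>"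
proof -
  have "real (len s) * \<alpha> - of_int (int (multiplier s) * cf_num \<alpha> (level s)) = real (multiplier s) * \<theta> (level s)"
    by (simp add: len_def cf_err_def algebra_simps)
  from integral_circle_dist_le[OF this]
  have "\<bar>LBINT x:{0..<1}. circle_dist ((rot \<alpha> ^^ len s) x) x\<bar> \<le> real (multiplier s) * \<bar>\<theta> (level s)\<bar>"
    by (simp add: abs_mult)
  also have "\<dots> \<le> real (depth s) * \<bar>\<theta> (level s)\<bar>"
    using multiplier_le_depth[of s] by (intro mult_right_mono) auto
  finally show ?thesis .
qed

text \<open>Denominators at least double in two steps, so 4 (\<kappa> + 1) steps gain a factor
  4^(\<kappa> + 1), more than exp (\<kappa> + 1).\<close>

lemma index_window:
  assumes "exp (real n) \<le> y" "y \<le> exp (real n + real \<kappa> + 1)"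
  shows "level n \<le> cf_index \<alpha> y" "cf_index \<alpha> y \<le> level n + (4 * \<kappa> + 4)"
proof -
  have y1: "1 \<le> y" using assms(1) one_le_exp_iff[of "real n"] by linarith
  show "level n \<le> cf_index \<alpha> y" using level_bounds(1)[of n] assms(1) by (intro le_index y1) linarith
  show "cf_index \<alpha> y \<le> level n + (4 * \<kappa> + 4)"
  proof (rule ccontr)
    assume "\<not> ?thesis"
    then have "Suc (level n) + 2 * (2 * (\<kappa> + 1)) \<le> cf_index \<alpha> y" by simp
    then have "q (Suc (level n) + 2 * (2 * (\<kappa> + 1))) \<le> q (cf_index \<alpha> y)" by (rule denom_mono)
    then have "2 ^ (2 * (\<kappa> + 1)) * q (Suc (level n)) \<le> q (cf_index \<alpha> y)"
      using denom_add_even[of "2 * (\<kappa> + 1)" "Suc (level n)"] by linarith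
    then have "real (2 ^ (2 * (\<kappa> + 1)) * q (Suc (level n))) \<le> real (q (cf_index \<alpha> y))" by (rule of_nat_mono)
    also have "\<dots> \<le> y" by (rule index_bounds(1)[OF y1])
    finally have "4 ^ (\<kappa> + 1) * real (q (Suc (level n))) \<le> y" by (simp add: power_mult del: cf_denom.simps)
    also have "y \<le> exp 1 ^ (\<kappa> + 1) * exp (real n)"
      using assms(2) by (simp add: exp_add exp_of_nat_mult[symmetric] algebra_simps)
    also have "\<dots> \<le> 4 ^ (\<kappa> + 1) * exp (real n)"
      using exp_le by (intro mult_right_mono power_mono) auto
    finally have "real (q (Suc (level n))) \<le> exp (real n)" by simp
    then show False using level_bounds(2)[of n] by linarith
  qed
qed

lemma digit_bound:
  assumes "level n \<le> j" "Suc j \<le> level n + R" "real (q (level n + R)) \<le> E * real (q (level n))" "1 < E"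
  shows "real (a (Suc j)) < E + 1"
proof -
  have "real (a (Suc j) * q j) \<le> real (q (Suc j))" by (rule of_nat_mono) (rule digit_mult_denom_le)
  also have "\<dots> \<le> real (q (level n + R))" by (rule of_nat_mono) (rule denom_mono[OF assms(2)])
  also have "\<dots> \<le> E * real (q (level n))" by (rule assms)
  also have "\<dots> \<le> E * real (q j)" using denom_mono[OF assms(1)] assms(4) by (intro mult_left_mono) auto
  finally show ?thesis using denom_real_pos[of j] by simp
qed

text \<open>Such a trajectory singles out a joining vector with horizontal part below 1 / q_(k+1).
  Its contribution to the thickness inequality is at most e / 2, so the vertical part, which is
  close to the length, must be large.\<close>

lemma vertical_length_bound:
  assumes z: "0 < z" "z < 1" and th: "thick_time \<alpha> z e (real n)" and e: "0 < e"
    and big: "2 / e * exp (real n) \<le> real (q (Suc k))" and k: "0 < k"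
    and h: "h \<in> vertical_lengths (assoc_torus \<alpha> z) (infdist (real (q k) * \<alpha>) \<int>)"
  shows "e / 4 * exp (real n) \<le> h"
proof -
  let ?r = "infdist (real (q k) * \<alpha>) \<int>"
  have "?r \<le> dist (real (q k) * \<alpha>) (of_int (cf_num \<alpha> k))" by (rule infdist_le) simp
  also have "\<dots> = \<bar>\<theta> k\<bar>" by (simp add: dist_real_def cf_err_def)
  also have "\<dots> < 1 / real (q (Suc k))" by (rule abs_err_less_inverse)
  finally have r: "?r < 1 / real (q (Suc k))" .
  \<comment> \<open>For k = 0 the next denominator may be 1; positivity of k makes it at least 2, so
    the radius is below 1/2.\<close>
  obtain k' where k': "k = Suc k'" using k by (cases k) auto
  have "1 < q (Suc k)" using denom_strict[of k'] denom_pos[of k] unfolding k' by linarith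
  then have "1 / real (q (Suc k)) \<le> 1 / 2" by (intro divide_left_mono) (auto simp del: cf_denom.simps)
  then have r2: "?r < 1 / 2" using r by linarith
  have T: "torus_data_rel (vector [1, 0], vector [- \<alpha>, 1], vector [0, 0], vector [z, 0])
      (vector [1, 0], vector [- \<alpha>, 1], vector [0, 0], vector [z, 0])"
    by (rule torus_data_rel_refl[OF assoc_torus_data[OF z]])
  from h obtain s w where s: "h = \<bar>s\<bar>" "w \<in> torus_lattice (vector [1, 0]) (vector [- \<alpha>, 1])"
      "dist (vector [0, 0] + vector [0, s] :: real^2) (vector [z, 0] + w) < ?r"
    unfolding assoc_torus_def vertical_lengths.abs_eq[OF T] by auto
  obtain m i :: int where w: "w = of_int m *\<^sub>R vector [1, 0] + of_int i *\<^sub>R vector [- \<alpha>, 1]"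
    using s(2) unfolding torus_lattice_def by blast
  have cmp: "\<bar>(vector [0, 0] + vector [0, s] - (vector [z, 0] + w) :: real^2) $ j\<bar> < ?r" for j
    using component_le_norm_cart[of "vector [0, 0] + vector [0, s] - (vector [z, 0] + w) :: real^2" j] s(3)
    by (simp add: dist_norm)
  have c1: "\<bar>z + of_int m - of_int i * \<alpha>\<bar> < ?r"
    using cmp[of 1] unfolding w by (simp add: abs_if split: if_splits)
  have c2: "\<bar>s - of_int i\<bar> < ?r" using cmp[of 2] unfolding w by simp
  have "e \<le> exp (real n) * \<bar>z + of_int m - of_int i * \<alpha>\<bar> + exp (- real n) * \<bar>of_int i\<bar>"
    using th unfolding thick_time_def by blast
  moreover have "exp (real n) * \<bar>z + of_int m - of_int i * \<alpha>\<bar> \<le> exp (real n) * (1 / real (q (Suc k)))"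
    using c1 r by (intro mult_left_mono) auto
  moreover have "exp (real n) * (1 / real (q (Suc k))) \<le> e / 2"
    using big e denom_real_pos[of "Suc k"] by (simp add: field_simps del: cf_denom.simps)
  ultimately have "e / 2 \<le> exp (- real n) * \<bar>of_int i\<bar>" by linarith
  then have "e / 2 * exp (real n) \<le> exp (- real n) * \<bar>of_int i\<bar> * exp (real n)" by (intro mult_right_mono) auto
  also have "\<dots> = \<bar>of_int i\<bar>" by (simp add: exp_minus field_simps)
  finally have i: "e / 2 * exp (real n) \<le> \<bar>of_int i\<bar>" .
  moreover have "0 < e / 2 * exp (real n)" using e by simp
  ultimately have "i \<noteq> 0" by auto
  then have "1 \<le> \<bar>real_of_int i\<bar>" by linarith
  then have "\<bar>real_of_int i\<bar> / 2 \<le> \<bar>s\<bar>" using c2 r2 by linarith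
  then show ?thesis using i s(1) by linarith
qed

end

section \<open>The sequences of the assumptions\<close>

context irrational_rotation
begin

text \<open>The shift \<sigma> cancels the factor c up to rounding, and \<kappa> absorbs G and the
  16 of \<open>len_ge\<close>. The resulting window for c L around exp n is independent of
  c.\<close>

lemma scaled_len_bounds:
  assumes c: "0 < c" "c < 1" and \<kappa>: "16 * G \<le> exp (real \<kappa>)" and \<sigma>: "\<sigma> = \<kappa> + nat \<lceil>ln (1 / c)\<rceil>"
  shows "G * exp (real n) \<le> c * real (len (n + \<sigma>))" "c * real (len (n + \<sigma>)) \<le> exp (real n + real \<kappa> + 1)"
proof -
  have "0 < ln (1 / c)" using c by (simp add: ln_div)
  then have b: "real n + real \<kappa> + ln (1 / c) \<le> real (n + \<sigma>)" "real (n + \<sigma>) \<le> real n + real \<kappa> + 1 + ln (1 / c)"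
    unfolding \<sigma> by (simp_all add: of_nat_nat) linarith+
  have ec: "c * exp (x + ln (1 / c)) = exp x" for x using c by (simp add: exp_add)
  have "16 * G * exp (real n) \<le> exp (real \<kappa>) * exp (real n)" using \<kappa> by (intro mult_right_mono) auto
  also have "\<dots> = c * exp (real n + real \<kappa> + ln (1 / c))" unfolding ec by (simp add: exp_add)
  also have "\<dots> \<le> c * exp (real (n + \<sigma>))" using b(1) c by (intro mult_left_mono) auto
  also have "\<dots> \<le> c * (16 * real (len (n + \<sigma>)))" using c by (intro mult_left_mono len_ge) simp
  finally show "G * exp (real n) \<le> c * real (len (n + \<sigma>))" by simp
  have "c * real (len (n + \<sigma>)) \<le> c * exp (real (n + \<sigma>))" using c by (intro mult_left_mono len_le) simp
  also have "\<dots> \<le> c * exp (real n + real \<kappa> + 1 + ln (1 / c))" using b(2) c by (intro mult_left_mono) auto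
  finally show "c * real (len (n + \<sigma>)) \<le> exp (real n + real \<kappa> + 1)" unfolding ec .
qed

text \<open>The deterministic half of the argument: properties of single times imply all of
  (A0)-(A9). The index k is the successor of the last index whose denominator is at most c
  L.\<close>

lemma A_sequences_of_times:
  fixes f :: "nat \<Rightarrow> nat"
  assumes z: "0 < z" "z < 1" and e: "0 < e" and c: "0 < c" "c < 1" and \<eta>: "0 < \<eta>" "\<eta> < 1"
    and \<kappa>: "16 * max 1 (2 / e) \<le> exp (real \<kappa>)" and \<sigma>: "\<sigma> = \<kappa> + nat \<lceil>ln (1 / c)\<rceil>"
    and R: "R = 4 * \<kappa> + 7" and E: "1 < E" "E' * c < 1"
    and lim: "filterlim f at_top sequentially"
    and thick: "\<And>i. thick_time \<alpha> z e (real (f i))"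
    and ratio: "\<And>i. real (q (level (f i) + R)) \<le> E * real (q (level (f i)))"
    and ratio': "\<And>i. real (q (level (f i) + (R + l))) \<le> E' * real (q (level (f i)))"
    and depth: "\<And>i. depth (f i + \<sigma>) < B"
    and good: "\<And>i. \<not> bad_scale \<alpha> z \<eta> (len (f i + \<sigma>)) j"
    and k0: "\<And>j v p. k0 \<le> j \<Longrightarrow> j < v \<Longrightarrow> 0 < p \<Longrightarrow> p \<le> B \<Longrightarrow> c * (real p * real (q v)) \<noteq> real (q j)"
    and fk0: "\<And>i. k0 \<le> level (f i)"
  shows "A_sequences \<alpha> z (E + 1) (E + 1) (E + 1) (4 * E / e + 1) l \<eta> (scale \<eta> j) c (6 * B + 1)
    (\<lambda>i. len (f i + \<sigma>)) (\<lambda>i. Suc (cf_index \<alpha> (c * real (len (f i + \<sigma>)))))"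
proof -
  define L where "L = (\<lambda>i. len (f i + \<sigma>))"
  define J where "J = (\<lambda>i. cf_index \<alpha> (c * real (L i)))"
  define w where "w = (\<lambda>i. level (f i))"
  have L1: "max 1 (2 / e) * exp (real (f i)) \<le> c * real (L i)" and L2: "c * real (L i) \<le> exp (real (f i) + real \<kappa> + 1)" for i
    using scaled_len_bounds[OF c \<kappa> \<sigma>, of "f i"] unfolding L_def by auto
  have ef: "exp (real (f i)) \<le> c * real (L i)" for i
  proof -
    have "1 * exp (real (f i)) \<le> max 1 (2 / e) * exp (real (f i))" by (intro mult_right_mono) auto
    with L1[of i] show ?thesis by linarith
  qed
  have ef2: "2 / e * exp (real (f i)) \<le> c * real (L i)" for i
  proof -
    have "2 / e * exp (real (f i)) \<le> max 1 (2 / e) * exp (real (f i))" by (intro mult_right_mono) auto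
    with L1[of i] show ?thesis by linarith
  qed
  have y1: "1 \<le> c * real (L i)" for i using ef[of i] one_le_exp_iff[of "real (f i)"] by linarith
  have Jlo: "w i \<le> J i" and Jhi: "J i \<le> w i + (4 * \<kappa> + 4)" for i
    using index_window[OF ef L2, of i] unfolding J_def w_def by auto
  have Jb: "real (q (J i)) \<le> c * real (L i)" "c * real (L i) < real (q (Suc (J i)))" for i
    unfolding J_def using index_bounds[OF y1] by auto
  have qw: "real (q (w i)) \<le> exp (real (f i))" for i unfolding w_def by (rule level_bounds)
  \<comment> \<open>The ratio bound gives q_(k+l) \<le> E' exp n \<le> E' c L, and E' c < 1.\<close>
  have A7: "q (Suc (J i) + l) < L i" for i
  proof -
    have "real (q (Suc (J i) + l)) \<le> real (q (w i + (R + l)))"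
      using Jhi[of i] R by (intro of_nat_mono denom_mono) simp
    also have "\<dots> \<le> E' * real (q (w i))" using ratio' unfolding w_def .
    finally have le: "real (q (Suc (J i) + l)) \<le> E' * real (q (w i))" .
    then have "0 < E' * real (q (w i))" using denom_real_pos[of "Suc (J i) + l"] by linarith
    then have E': "0 < E'" using denom_real_pos[of "w i"] by (simp add: zero_less_mult_iff)
    have "E' * real (q (w i)) \<le> E' * (c * real (L i))" using qw[of i] ef[of i] E' by (intro mult_left_mono) auto
    also have "\<dots> = (E' * c) * real (L i)" by simp
    also have "\<dots> < 1 * real (L i)"
    proof (rule mult_strict_right_mono[OF E(2)])
      show "0 < real (L i)" using y1[of i] c by (cases "L i = 0") auto
    qed
    finally show ?thesis using le by simp
  qed
  \<comment> \<open>Equality in (A0) is excluded by \<open>k0\<close>, whose requirement that the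
    index lie below the level of L follows from (A7).\<close>
  have strict: "real (q (J i)) \<noteq> c * real (L i)" for i
  proof -
    let ?s = "f i + \<sigma>"
    have "real (L i) < real (q (Suc (level ?s)))" unfolding L_def using len_le[of ?s] level_bounds(2)[of ?s] by linarith
    then have "q (Suc (J i) + l) < q (Suc (level ?s))" using A7[of i] by linarith
    then have "Suc (J i) + l < Suc (level ?s)" using denom_mono by (meson not_le)
    then have "J i < level ?s" by simp
    moreover have "k0 \<le> J i" using fk0[of i] Jlo[of i] unfolding w_def by simp
    moreover have "multiplier ?s \<le> B" using multiplier_le_depth[of ?s] depth[of i] by simp
    ultimately have "c * (real (multiplier ?s) * real (q (level ?s))) \<noteq> real (q (J i))"
      using multiplier_pos by (intro k0) auto
    then show ?thesis unfolding L_def len_def by simp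
  qed
  \<comment> \<open>The digits of (A1)-(A3) have indices J + 1 to J + 3, at most w + 4 \<kappa> + 7:
    this is the origin of R.\<close>
  have dig: "real (a (Suc m)) < E + 1" if "J i \<le> m" "m \<le> J i + 2" for i m
    using Jlo[of i] Jhi[of i] that ratio[of i] E(1) R
    by (intro digit_bound[of "f i" m R E]) (auto simp: w_def)
  \<comment> \<open>Here q_k \<le> E exp n while h \<ge> (e / 4) exp n, hence 4 E / e; the added 1
    makes the constant exceed 1.\<close>
  have A4: "real (q (Suc (J i))) / (4 * E / e + 1) \<le> h"
    if h: "h \<in> vertical_lengths (assoc_torus \<alpha> z) (infdist (real (q (Suc (J i))) * \<alpha>) \<int>)" for i h
  proof -
    have "2 / e * exp (real (f i)) \<le> real (q (Suc (Suc (J i))))"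
      using ef2[of i] Jb(2)[of i] denom_le_Suc[of "Suc (J i)"] by linarith
    from vertical_length_bound[OF z thick e this _ h] have lb: "e / 4 * exp (real (f i)) \<le> h" by simp
    have "real (q (Suc (J i))) \<le> real (q (w i + R))" using Jhi[of i] R by (intro of_nat_mono denom_mono) simp
    also have "\<dots> \<le> E * real (q (w i))" unfolding w_def by (rule ratio)
    also have "\<dots> \<le> E * exp (real (f i))" using qw[of i] E(1) by (intro mult_left_mono) auto
    also have "\<dots> = (4 * E / e) * (e / 4 * exp (real (f i)))" using e by simp
    also have "\<dots> \<le> (4 * E / e + 1) * h"
      using lb E(1) e by (intro mult_mono) auto
    finally show ?thesis using E(1) e by (simp add: divide_le_eq mult.commute add_pos_pos)
  qed
  have A6: "(\<lambda>i. LBINT x:{0..<1}. circle_dist ((rot \<alpha> ^^ L i) x) x) \<longlonglongrightarrow> 0"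
  proof (rule Lim_null_comparison)
    have "filterlim (\<lambda>i. f i + \<sigma>) at_top sequentially"
      by (rule filterlim_at_top_mono[OF lim]) simp
    from filterlim_compose[OF level_unbounded this]
    have "filterlim (\<lambda>i. level (f i + \<sigma>)) at_top sequentially" .
    from tendsto_mult_right_zero[OF tendsto_rabs_zero[OF filterlim_compose[OF err_tendsto_0 this]], of "real B"]
    show "(\<lambda>i. real B * \<bar>\<theta> (level (f i + \<sigma>))\<bar>) \<longlonglongrightarrow> 0" .
    have "norm (LBINT x:{0..<1}. circle_dist ((rot \<alpha> ^^ L i) x) x) \<le> real B * \<bar>\<theta> (level (f i + \<sigma>))\<bar>" for i
    proof -
      have "real (depth (f i + \<sigma>)) * \<bar>\<theta> (level (f i + \<sigma>))\<bar> \<le> real B * \<bar>\<theta> (level (f i + \<sigma>))\<bar>"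
        using depth[of i] by (intro mult_right_mono) auto
      then show ?thesis using integral_circle_dist_len_le[of "f i + \<sigma>"] unfolding L_def real_norm_def by linarith
    qed
    then show "\<forall>\<^sub>F i in sequentially. norm (LBINT x:{0..<1}. circle_dist ((rot \<alpha> ^^ L i) x) x) \<le> real B * \<bar>\<theta> (level (f i + \<sigma>))\<bar>"
      by simp
  qed
  have A8: "Max (visits \<alpha> z (L i) ` {0..<1}) - Min (visits \<alpha> z (L i) ` {0..<1}) < 6 * B + 1" for i
    using visits_len_range[OF z, of "f i + \<sigma>"] depth[of i] unfolding L_def by linarith
  have "A_sequences \<alpha> z (E + 1) (E + 1) (E + 1) (4 * E / e + 1) l \<eta> (scale \<eta> j) c (6 * B + 1) L (\<lambda>i. Suc (J i))"
    unfolding A_sequences_def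
  proof (intro conjI allI ballI)
    fix i
    show "real (q (Suc (J i) - 1)) < c * real (L i)" using Jb(1)[of i] strict[of i] by simp
    show "c * real (L i) < real (q (Suc (J i)))" by (rule Jb)
    show "real (a (Suc (J i))) < E + 1" by (rule dig) auto
    show "real (a (Suc (J i) + 1)) < E + 1" using dig[of i "Suc (J i)"] by simp
    show "real (a (Suc (J i) + 2)) < E + 1" using dig[of i "Suc (Suc (J i))"] by simp
    show "\<exists>u. scale \<eta> j < measure lborel {x \<in> {0..<1}. visits \<alpha> z (L i) x = u} \<and>
        (measure lborel {x \<in> {0..<1}. visits \<alpha> z (L i) x < u} < \<eta> * scale \<eta> j \<or>
         measure lborel {x \<in> {0..<1}. u < visits \<alpha> z (L i) x} < \<eta> * scale \<eta> j)"
      using good_scale_level[OF \<eta> good, of i] unfolding L_def by blast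
    show "q (Suc (J i) + l) < L i" by (rule A7)
    show "\<exists>v. q v \<le> L i \<and> L i < q (v + 1) \<and>
        (L i = q v \<or> 4 < a (v + 1) \<and> (\<exists>p>0. p \<le> a (v + 1) div 4 \<and> L i = p * q v))"
      unfolding L_def by (rule len_admissible)
  qed (use A4 A6 A8 in blast)+
  then show ?thesis unfolding J_def L_def .
qed

end

theorem proposition1p5:
  fixes \<alpha> z :: real and T :: "real \<Rightarrow> real"
  assumes "0 < \<alpha>" "\<alpha> < 1" "\<alpha> \<notin> \<rat>"
    and "0 < z" "z < 1"
    and "\<forall>x\<in>{0..<1}. x \<notin> {0..<z} \<longrightarrow> rot \<alpha> x \<in> {0..<z}"
    and "\<forall>x\<in>{0..<z}. T x = first_return_map (rot \<alpha>) {0..<z} x"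
    and "three_iet z T"
    and "\<exists>\<tau> \<nu>. (\<forall>n. 0 < \<tau> n) \<and> filterlim \<tau> at_top sequentially \<and>
           weak_star_convergent (\<lambda>n. geod_average (assoc_torus \<alpha> z) (\<tau> n)) \<nu> \<and>
           \<nu> \<noteq> null_measure borel"
  shows "A_assumptions \<alpha> z"
proof -
  interpret irrational_rotation \<alpha> using assms(1-3) by unfold_locales
  note z = assms(4,5)
  obtain \<tau> \<nu> where \<tau>: "\<And>n. 0 < \<tau> n" "filterlim \<tau> at_top sequentially"
    and \<nu>: "weak_star_convergent (\<lambda>n. geod_average (assoc_torus \<alpha> z) (\<tau> n)) \<nu>" "\<nu> \<noteq> null_measure borel"
    using assms(9) by blast
  obtain e \<delta> and N :: "nat \<Rightarrow> nat" where e: "0 < e" and \<delta>: "0 < \<delta>" and N: "filterlim N at_top sequentially"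
    and freq: "\<forall>\<^sub>F i in sequentially. \<delta> * real (N i) \<le> real (card ({n. thick_time \<alpha> z e (real n)} \<inter> {..<N i}))"
    using positive_thick_integer_frequency[OF z \<tau> \<nu>] by blast
  obtain U d where Useq: "U \<le> sequentially" and d: "limit_density N U d"
    using limit_density_exists[OF N] by blast
  interpret limit_density N U d by (rule d)
  define H where "H = {n. thick_time \<alpha> z e (real n)}"
  have dH: "\<delta> \<le> d H" unfolding H_def by (rule density_ge) (rule filter_leD[OF Useq freq])
  \<comment> \<open>Four exceptional sets of density at most \<epsilon> leave at least half of
    \<delta>.\<close>
  define \<epsilon> where "\<epsilon> = \<delta> / 8"
  have \<epsilon>: "0 < \<epsilon>" using \<delta> by (simp add: \<epsilon>_def)

  have "\<exists>E. 1 < E \<and> d {n \<in> H. E * real (q (level n)) < real (q (level n + r))} \<le> \<epsilon>" for r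
  proof -
    obtain E C where E: "1 < E" and C: "\<And>N. real (card ({n. thick_time \<alpha> z e (real n) \<and>
        E * real (q (level n)) < real (q (level n + r))} \<inter> {..<N})) \<le> \<epsilon> * real N + C"
      using thick_large_ratio_count[OF e \<epsilon>, of z r] by blast
    from density_le[OF C] E show ?thesis unfolding H_def by auto
  qed
  then obtain E :: "nat \<Rightarrow> real" where E: "\<And>r. 1 < E r"
    and dE: "\<And>r. d {n \<in> H. E r * real (q (level n)) < real (q (level n + r))} \<le> \<epsilon>" by metis
  obtain B where B: "\<And>Z. d {n. B \<le> depth n \<and> depth n < Z} \<le> \<epsilon>" using density_tail[OF \<epsilon>] by blast
  \<comment> \<open>The exceptional set is formed at unshifted times s, so the scale depends on
    \<eta> and B but not on c or \<ell>.\<close>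
  have "\<exists>j. d {s. depth s < B \<and> bad_scale \<alpha> z \<eta> (len s) j} \<le> \<epsilon>" if \<eta>: "0 < \<eta>" "\<eta> < 1" for \<eta>
  proof -
    have "card {j \<in> {..<m}. s \<in> {s. depth s < B \<and> bad_scale \<alpha> z \<eta> (len s) j}} \<le> 6 * B" for m s
    proof (cases "depth s < B")
      case True
      have "card {j \<in> {..<m}. bad_scale \<alpha> z \<eta> (len s) j} \<le> 6 * depth s"
        using card_bad_scales[OF \<eta>] visits_len_range[OF z] by (rule order_trans)
      then show ?thesis using True by simp
    qed simp
    from density_small_member[OF \<epsilon> this] show ?thesis by blast
  qed
  then obtain j :: "real \<Rightarrow> nat"
    where j: "\<And>\<eta>. 0 < \<eta> \<Longrightarrow> \<eta> < 1 \<Longrightarrow> d {s. depth s < B \<and> bad_scale \<alpha> z \<eta> (len s) (j \<eta>)} \<le> \<epsilon>" by metis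

  \<comment> \<open>Under the maximum, 1 gives c L \<ge> exp n, and 2 / e gives the lower bound on
    q_(k+1) that \<open>vertical_length_bound\<close> requires.\<close>
  obtain \<kappa> :: nat where "ln (16 * max 1 (2 / e)) \<le> real \<kappa>" using real_arch_simple by blast
  moreover have "0 < 16 * max 1 (2 / e)" by (simp add: less_max_iff_disj)
  ultimately have \<kappa>: "16 * max 1 (2 / e) \<le> exp (real \<kappa>)" by (metis exp_le_cancel_iff exp_ln)
  define R where "R = 4 * \<kappa> + 7"

  have main: "\<exists>L k. A_sequences \<alpha> z (E R + 1) (E R + 1) (E R + 1) (4 * E R / e + 1) l \<eta> (scale \<eta> (j \<eta>)) c (6 * B + 1) L k"
    if \<eta>: "0 < \<eta>" "\<eta> < 1" and c: "0 < c" "c < min 1 (1 / E (R + l))" for l \<eta> c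
  proof -
    have c1: "c < 1" using c by simp
    have Ec: "E (R + l) * c < 1" using c E[of "R + l"] by (simp add: field_simps)
    define \<sigma> where "\<sigma> = \<kappa> + nat \<lceil>ln (1 / c)\<rceil>"
    \<comment> \<open>A crude bound for the depth at n + \<sigma>, from exp n < q_(w+1) \<le> E R
      q_w with w the level of n. It depends on c and serves only as the cutoff in
      \<open>density_tail\<close>; the bound that is kept is B.\<close>
    define Z where "Z = Suc (nat \<lfloor>exp (real \<sigma>) * E R\<rfloor>)"
    define Good where "Good = {n \<in> H. real (q (level n + R)) \<le> E R * real (q (level n)) \<and>
      real (q (level n + (R + l))) \<le> E (R + l) * real (q (level n)) \<and>
      depth (n + \<sigma>) < B \<and> \<not> bad_scale \<alpha> z \<eta> (len (n + \<sigma>)) (j \<eta>)}"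
    have depth_Z: "depth (n + \<sigma>) < Z" if "real (q (level n + R)) \<le> E R * real (q (level n))" for n
    proof -
      have pos: "0 < real (q (level n))" "0 < real (q (level (n + \<sigma>)))" by (rule denom_real_pos)+
      have mono: "real (q (level n)) \<le> real (q (level (n + \<sigma>)))"
        by (intro of_nat_mono denom_mono level_mono) simp
      have "exp (real n) \<le> real (q (Suc (level n)))" using level_bounds(2)[of n] by simp
      also have "\<dots> \<le> real (q (level n + R))" unfolding R_def by (intro of_nat_mono denom_mono) simp
      also note that
      finally have "exp (real n) \<le> E R * real (q (level (n + \<sigma>)))"
        using mult_left_mono[OF mono, of "E R"] E[of R] by linarith
      then have "exp (real \<sigma>) * exp (real n) \<le> exp (real \<sigma>) * (E R * real (q (level (n + \<sigma>))))" by simp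
      then have "exp (real (n + \<sigma>)) / real (q (level (n + \<sigma>))) \<le> exp (real \<sigma>) * E R"
        using pos by (simp add: exp_add field_simps)
      then show ?thesis unfolding depth_def Z_def by (intro le_imp_less_Suc nat_mono floor_mono)
    qed
    define B1 B2 B3 B4 where
      "B1 = {n \<in> H. E R * real (q (level n)) < real (q (level n + R))}" and
      "B2 = {n \<in> H. E (R + l) * real (q (level n)) < real (q (level n + (R + l)))}" and
      "B3 = {n. n + \<sigma> \<in> {s. B \<le> depth s \<and> depth s < Z}}" and
      "B4 = {n. n + \<sigma> \<in> {s. depth s < B \<and> bad_scale \<alpha> z \<eta> (len s) (j \<eta>)}}"
    have "H \<subseteq> Good \<union> (B1 \<union> (B2 \<union> (B3 \<union> B4)))"
      unfolding Good_def B1_def B2_def B3_def B4_def using depth_Z by (auto simp: not_less not_le)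
    then have "d H \<le> d (Good \<union> (B1 \<union> (B2 \<union> (B3 \<union> B4))))" by (rule density_mono)
    also have "\<dots> \<le> d Good + (d B1 + (d B2 + (d B3 + d B4)))"
      by (intro order_trans[OF density_Un_le] add_left_mono order_refl)
    also have "\<dots> \<le> d Good + (\<epsilon> + (\<epsilon> + (\<epsilon> + \<epsilon>)))"
    proof (intro add_mono order_refl)
      show "d B1 \<le> \<epsilon>" "d B2 \<le> \<epsilon>" unfolding B1_def B2_def by (rule dE)+
      show "d B3 \<le> \<epsilon>" unfolding B3_def by (rule order_trans[OF density_vimage_add_le B])
      show "d B4 \<le> \<epsilon>" unfolding B4_def by (rule order_trans[OF density_vimage_add_le j[OF \<eta>]])
    qed
    finally have "0 < d Good" using dH \<delta> unfolding \<epsilon>_def by simp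
    then have inf: "infinite Good" using density_finite by fastforce
    \<comment> \<open>The successor provides a positive bound on the multiplier even if B is
      0.\<close>
    obtain k0 where k0: "\<And>j v p. k0 \<le> j \<Longrightarrow> j < v \<Longrightarrow> 0 < p \<Longrightarrow> p \<le> Suc B \<Longrightarrow> c * (real p * real (q v)) \<noteq> real (q j)"
      using multiple_denom_ne_denom[OF c(1), of "Suc B"] by blast
    obtain n0 where n0: "\<And>n. n0 \<le> n \<Longrightarrow> k0 \<le> level n"
      using level_unbounded unfolding filterlim_at_top eventually_sequentially by blast
    define A where "A = Good - {..<n0}"
    have infA: "infinite A" unfolding A_def using inf by (rule Diff_infinite_finite[rotated]) simp
    define f where "f = enumerate A"
    have f: "f i \<in> A" for i unfolding f_def by (rule enumerate_in_set[OF infA])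
    have "filterlim f at_top sequentially"
      unfolding f_def by (rule filterlim_subseq[OF strict_mono_enumerate[OF infA]])
    then show ?thesis
    proof (intro exI, rule A_sequences_of_times[OF z e c(1) c1 \<eta> \<kappa> \<sigma>_def R_def E Ec])
      fix i
      show "thick_time \<alpha> z e (real (f i))" "real (q (level (f i) + R)) \<le> E R * real (q (level (f i)))"
        "real (q (level (f i) + (R + l))) \<le> E (R + l) * real (q (level (f i)))"
        "depth (f i + \<sigma>) < B" "\<not> bad_scale \<alpha> z \<eta> (len (f i + \<sigma>)) (j \<eta>)"
        using f[of i] unfolding A_def Good_def H_def by auto
      show "k0 \<le> level (f i)" using f[of i] n0 unfolding A_def by auto
    next
      fix m v p assume "k0 \<le> m" "m < v" "0 < p" "p \<le> B"
      then show "c * (real p * real (q v)) \<noteq> real (q m)" using k0 by simp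
    qed
  qed
  have "1 < E R" by (rule E)
  show ?thesis unfolding A_assumptions_def
  proof (rule exI[of _ "E R + 1"], rule exI[of _ "E R + 1"], rule exI[of _ "E R + 1"],
      rule exI[of _ "4 * E R / e + 1"], rule exI[of _ 1], intro conjI)
    show "\<exists>ch cl kc. (\<forall>\<eta>. 0 < \<eta> \<and> \<eta> < 1 \<longrightarrow> ch \<eta> > 0) \<and> (\<forall>l. cl l > 0) \<and>
          (\<forall>l \<eta> c. 0 < \<eta> \<and> \<eta> < 1 \<and> 0 < c \<and> c < cl l \<longrightarrow>
             (\<exists>L k. A_sequences \<alpha> z (E R + 1) (E R + 1) (E R + 1) (4 * E R / e + 1) l \<eta> (ch \<eta>) c (kc c) L k))"
    proof (rule exI[of _ "\<lambda>\<eta>. scale \<eta> (j \<eta>)"], rule exI[of _ "\<lambda>l. min 1 (1 / E (R + l))"],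
        rule exI[of _ "\<lambda>_. 6 * B + 1"], intro conjI allI impI)
      show "0 < min 1 (1 / E (R + l))" for l using E[of "R + l"] by simp
    qed (use main scale_pos in blast)+
  qed (use \<open>1 < E R\<close> e in simp_all)
qed

end
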